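(* Let $M$ be a locally finite MV-algebra, and let $\upsilon_M\colon M\to\Upsilon M$ be its universal state. Then $\Upsilon M$ is semisimple.
   Context: An MV-algebra is locally finite if each of its finitely generated subalgebras is finite. It is semisimple if the intersection of its maximal ideals is $\{0\}$; equivalently, its radical is trivial. In an MV-algebra, $a\odot b=\neg(\neg a\oplus\neg b)$ and $1=\neg0$. For an MV-algebra $N$, $\Xi N$ is its unital Abelian $\ell$-group under Mundici's equivalence, with $N$ identified with the unit interval of $\Xi N$. A state $s\colon M\to N$ of MV-algebras is a map with $s(1)=1$ and $s(a\oplus b)=s(a)+s(b)$ (in $\Xi N$) whenever $a\odot b=0$. The universal state of $M$ is a state $\upsilon_M\colon M\to\Upsilon M$ such that every state $t\colon M\to N$ equals $h\circ\upsilon_M$ for exactly one MV-algebra homomorphism $h\colon\Upsilon M\to N$. *)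

theory Defs
  imports "HOL-Algebra.Congruence" "HOL-Library.FuncSet"
begin

section \<open>MV-algebras\<close>

record 'a mv_struct = "'a partial_object" +
  mv_plus :: "'a \<Rightarrow> 'a \<Rightarrow> 'a" (infixl "\<oplus>\<index>" 65)
  mv_neg :: "'a \<Rightarrow> 'a" ("\<sim>\<index> _" [81] 80)
  mv_zero :: 'a ("\<zero>\<index>")

definition mv_one :: "('a, 'm) mv_struct_scheme \<Rightarrow> 'a" ("\<one>\<index>")
  where "\<one>\<^bsub>A\<^esub> = \<sim>\<^bsub>A\<^esub> \<zero>\<^bsub>A\<^esub>"

definition mv_times :: "('a, 'm) mv_struct_scheme \<Rightarrow> 'a \<Rightarrow> 'a \<Rightarrow> 'a" (infixl "\<odot>\<index>" 70)
  where "a \<odot>\<^bsub>A\<^esub> b = \<sim>\<^bsub>A\<^esub> (\<sim>\<^bsub>A\<^esub> a \<oplus>\<^bsub>A\<^esub> \<sim>\<^bsub>A\<^esub> b)"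

definition mv_le :: "('a, 'm) mv_struct_scheme \<Rightarrow> 'a \<Rightarrow> 'a \<Rightarrow> bool"
  where "mv_le A a b \<longleftrightarrow> \<sim>\<^bsub>A\<^esub> a \<oplus>\<^bsub>A\<^esub> b = \<one>\<^bsub>A\<^esub>"

locale mv_algebra =
  fixes A :: "('a, 'm) mv_struct_scheme" (structure)
  assumes zero_closed [simp, intro]: "\<zero> \<in> carrier A"
    and neg_closed [simp, intro]: "x \<in> carrier A \<Longrightarrow> \<sim> x \<in> carrier A"
    and plus_closed [simp, intro]: "\<lbrakk>x \<in> carrier A; y \<in> carrier A\<rbrakk> \<Longrightarrow> x \<oplus> y \<in> carrier A"
    and plus_assoc: "\<lbrakk>x \<in> carrier A; y \<in> carrier A; z \<in> carrier A\<rbrakk>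
      \<Longrightarrow> (x \<oplus> y) \<oplus> z = x \<oplus> (y \<oplus> z)"
    and plus_comm: "\<lbrakk>x \<in> carrier A; y \<in> carrier A\<rbrakk> \<Longrightarrow> x \<oplus> y = y \<oplus> x"
    and plus_zero: "x \<in> carrier A \<Longrightarrow> x \<oplus> \<zero> = x"
    and neg_neg: "x \<in> carrier A \<Longrightarrow> \<sim> (\<sim> x) = x"
    and plus_one: "x \<in> carrier A \<Longrightarrow> x \<oplus> \<sim> \<zero> = \<sim> \<zero>"
    and lukasiewicz: "\<lbrakk>x \<in> carrier A; y \<in> carrier A\<rbrakk>
      \<Longrightarrow> \<sim> (\<sim> x \<oplus> y) \<oplus> y = \<sim> (\<sim> y \<oplus> x) \<oplus> x"

text \<open>Homomorphisms are extensional outside the carrier, so that equality of homomorphisms as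
  HOL functions is equality on the carrier.\<close>

definition mv_hom :: "('a, 'm) mv_struct_scheme \<Rightarrow> ('b, 'n) mv_struct_scheme \<Rightarrow> ('a \<Rightarrow> 'b) set"
  where "mv_hom A B = {h \<in> carrier A \<rightarrow>\<^sub>E carrier B.
    h \<zero>\<^bsub>A\<^esub> = \<zero>\<^bsub>B\<^esub> \<and>
    (\<forall>x\<in>carrier A. h (\<sim>\<^bsub>A\<^esub> x) = \<sim>\<^bsub>B\<^esub> (h x)) \<and>
    (\<forall>x\<in>carrier A. \<forall>y\<in>carrier A. h (x \<oplus>\<^bsub>A\<^esub> y) = h x \<oplus>\<^bsub>B\<^esub> h y)}"

definition mv_subalgebra :: "('a, 'm) mv_struct_scheme \<Rightarrow> 'a set \<Rightarrow> bool"
  where "mv_subalgebra A B \<longleftrightarrow> B \<subseteq> carrier A \<and> \<zero>\<^bsub>A\<^esub> \<in> B \<and>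
    (\<forall>x\<in>B. \<sim>\<^bsub>A\<^esub> x \<in> B) \<and> (\<forall>x\<in>B. \<forall>y\<in>B. x \<oplus>\<^bsub>A\<^esub> y \<in> B)"

definition mv_generated :: "('a, 'm) mv_struct_scheme \<Rightarrow> 'a set \<Rightarrow> 'a set"
  where "mv_generated A S = \<Inter>{B. mv_subalgebra A B \<and> S \<subseteq> B}"

definition mv_locally_finite :: "('a, 'm) mv_struct_scheme \<Rightarrow> bool"
  where "mv_locally_finite A \<longleftrightarrow>
    (\<forall>S. S \<subseteq> carrier A \<and> finite S \<longrightarrow> finite (mv_generated A S))"

definition mv_ideal :: "('a, 'm) mv_struct_scheme \<Rightarrow> 'a set \<Rightarrow> bool"
  where "mv_ideal A I \<longleftrightarrow> I \<subseteq> carrier A \<and> \<zero>\<^bsub>A\<^esub> \<in> I \<and>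
    (\<forall>x\<in>carrier A. \<forall>y\<in>I. mv_le A x y \<longrightarrow> x \<in> I) \<and>
    (\<forall>x\<in>I. \<forall>y\<in>I. x \<oplus>\<^bsub>A\<^esub> y \<in> I)"

definition mv_maximal_ideal :: "('a, 'm) mv_struct_scheme \<Rightarrow> 'a set \<Rightarrow> bool"
  where "mv_maximal_ideal A I \<longleftrightarrow> mv_ideal A I \<and> I \<noteq> carrier A \<and>
    (\<forall>J. mv_ideal A J \<and> I \<subset> J \<longrightarrow> J = carrier A)"

text \<open>The intersection is taken inside the carrier: the one-element algebra has no maximal ideal,
  and its radical is the whole algebra \<open>{0}\<close>.\<close>

definition mv_radical :: "('a, 'm) mv_struct_scheme \<Rightarrow> 'a set"
  where "mv_radical A = carrier A \<inter> \<Inter>{I. mv_maximal_ideal A I}"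

definition mv_semisimple :: "('a, 'm) mv_struct_scheme \<Rightarrow> bool"
  where "mv_semisimple A \<longleftrightarrow> mv_radical A = {\<zero>\<^bsub>A\<^esub>}"


section \<open>The unital Abelian l-group of an MV-algebra\<close>

text \<open>The inverse of Mundici's functor, by Chang's construction: good sequences form a cancellative
  Abelian monoid, the positive cone of the l-group, whose elements are formal differences of good
  sequences. Sequences \<open>(a\<^sub>1, a\<^sub>2, \<dots>)\<close> are indexed from \<open>0\<close>, so \<open>x i\<close> is \<open>a\<^bsub>i+1\<^esub>\<close>.\<close>

definition good_seqs :: "('a, 'm) mv_struct_scheme \<Rightarrow> (nat \<Rightarrow> 'a) set"
  where "good_seqs A = {x. (\<forall>i. x i \<in> carrier A) \<and>
    (\<forall>i. x i \<oplus>\<^bsub>A\<^esub> x (Suc i) = x i) \<and> (\<exists>n. \<forall>i\<ge>n. x i = \<zero>\<^bsub>A\<^esub>)}"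

text \<open>The \<open>n\<close>-th entry of the sum is
  \<open>x\<^sub>n \<oplus> (x\<^sub>0 \<odot> y\<^bsub>n-1\<^esub>) \<oplus> \<dots> \<oplus> (x\<^bsub>n-1\<^esub> \<odot> y\<^sub>0) \<oplus> y\<^sub>n\<close>.\<close>

definition gs_add :: "('a, 'm) mv_struct_scheme \<Rightarrow> (nat \<Rightarrow> 'a) \<Rightarrow> (nat \<Rightarrow> 'a) \<Rightarrow> (nat \<Rightarrow> 'a)"
  where "gs_add A x y = (\<lambda>n. x n \<oplus>\<^bsub>A\<^esub>
    foldr (\<lambda>i z. (x i \<odot>\<^bsub>A\<^esub> y (n - Suc i)) \<oplus>\<^bsub>A\<^esub> z) [0..<n] (y n))"

definition gs_single :: "('a, 'm) mv_struct_scheme \<Rightarrow> 'a \<Rightarrow> (nat \<Rightarrow> 'a)"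
  where "gs_single A a = (\<lambda>n. if n = 0 then a else \<zero>\<^bsub>A\<^esub>)"

definition gs_rel :: "('a, 'm) mv_struct_scheme
    \<Rightarrow> (((nat \<Rightarrow> 'a) \<times> (nat \<Rightarrow> 'a)) \<times> ((nat \<Rightarrow> 'a) \<times> (nat \<Rightarrow> 'a))) set"
  where "gs_rel A = {((x, y), (x', y')). x \<in> good_seqs A \<and> y \<in> good_seqs A \<and>
    x' \<in> good_seqs A \<and> y' \<in> good_seqs A \<and> gs_add A x y' = gs_add A x' y}"

record 'g unital_lgroup = "'g partial_object" +
  lg_add :: "'g \<Rightarrow> 'g \<Rightarrow> 'g"
  lg_zero :: 'g
  lg_le :: "'g \<Rightarrow> 'g \<Rightarrow> bool"
  lg_unit :: 'g

definition Xi :: "('a, 'm) mv_struct_scheme \<Rightarrow> ((nat \<Rightarrow> 'a) \<times> (nat \<Rightarrow> 'a)) set unital_lgroup"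
  where "Xi A = \<lparr>
    carrier = (good_seqs A \<times> good_seqs A) // gs_rel A,
    lg_add = (\<lambda>P Q. \<Union>(x, y)\<in>P. \<Union>(x', y')\<in>Q. gs_rel A `` {(gs_add A x x', gs_add A y y')}),
    lg_zero = gs_rel A `` {(gs_single A \<zero>\<^bsub>A\<^esub>, gs_single A \<zero>\<^bsub>A\<^esub>)},
    lg_le = (\<lambda>P Q. \<exists>(x, y)\<in>P. \<exists>(x', y')\<in>Q.
      \<forall>i. mv_le A (gs_add A x y' i) (gs_add A x' y i)),
    lg_unit = gs_rel A `` {(gs_single A \<one>\<^bsub>A\<^esub>, gs_single A \<zero>\<^bsub>A\<^esub>)}\<rparr>"

text \<open>The identification of \<open>A\<close> with the unit interval of \<open>Xi A\<close>.\<close>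

definition Xi_embed :: "('a, 'm) mv_struct_scheme \<Rightarrow> 'a \<Rightarrow> ((nat \<Rightarrow> 'a) \<times> (nat \<Rightarrow> 'a)) set"
  where "Xi_embed A a = gs_rel A `` {(gs_single A a, gs_single A \<zero>\<^bsub>A\<^esub>)}"


section \<open>States and universal states\<close>

definition mv_state :: "('a, 'm) mv_struct_scheme \<Rightarrow> ('b, 'n) mv_struct_scheme \<Rightarrow> ('a \<Rightarrow> 'b) \<Rightarrow> bool"
  where "mv_state M N s \<longleftrightarrow> s \<in> carrier M \<rightarrow> carrier N \<and> s \<one>\<^bsub>M\<^esub> = \<one>\<^bsub>N\<^esub> \<and>
    (\<forall>a\<in>carrier M. \<forall>b\<in>carrier M. a \<odot>\<^bsub>M\<^esub> b = \<zero>\<^bsub>M\<^esub> \<longrightarrow>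
      Xi_embed N (s (a \<oplus>\<^bsub>M\<^esub> b)) = lg_add (Xi N) (Xi_embed N (s a)) (Xi_embed N (s b)))"

definition universal_among ::
    "'c itself \<Rightarrow> 'a mv_struct \<Rightarrow> 'b mv_struct \<Rightarrow> ('a \<Rightarrow> 'b) \<Rightarrow> bool"
  where "universal_among (_ :: 'c itself) M U \<upsilon> \<longleftrightarrow>
    (\<forall>(N :: 'c mv_struct) t. mv_algebra N \<and> mv_state M N t \<longrightarrow>
      (\<exists>!h. h \<in> mv_hom U N \<and> (\<forall>a\<in>carrier M. h (\<upsilon> a) = t a)))"

datatype 'v mv_term = Var 'v | Zero | Neg "'v mv_term" | Plus "'v mv_term" "'v mv_term"

text \<open>A formula cannot quantify over all types of carriers, so the test algebras range over
  all MV-algebras carried by subsets of two types that suffice for arbitrary ones. On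
  \<^typ>\<open>'a mv_term set\<close> lives the algebra \<open>T\<close> of MV-terms with variables in \<open>M\<close> modulo the
  equations that make \<open>M \<rightarrow> T\<close> a state; it has the universal property with respect to test
  algebras of every type. Testing \<open>U\<close> against \<open>T\<close> gives \<open>U \<rightarrow> T\<close>, and testing \<open>U\<close> against itself
  (type \<^typ>\<open>'b\<close>) shows that the composite \<open>U \<rightarrow> T \<rightarrow> U\<close> is the identity. Hence \<open>U\<close> is isomorphic to \<open>T\<close>
  under \<open>M\<close>, and universal with respect to algebras of every type.\<close>

definition universal_state :: "'a mv_struct \<Rightarrow> 'b mv_struct \<Rightarrow> ('a \<Rightarrow> 'b) \<Rightarrow> bool"
  where "universal_state M U \<upsilon> \<longleftrightarrow> mv_algebra U \<and> mv_state M U \<upsilon> \<and>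
    universal_among TYPE('a mv_term set) M U \<upsilon> \<and> universal_among TYPE('b) M U \<upsilon>"

end

theory Submission
  imports Defs "HOL-Algebra.FiniteProduct" "HOL-Library.Countable" Complex_Main
begin

text \<open>A nonzero element \<open>e\<close> of the universal algebra \<open>U\<close> is the value of a term at finitely many elements
  \<open>\<upsilon> a\<close>, and it stays nonzero in some totally ordered quotient of \<open>U\<close>, that is, in the unit interval of a
  totally ordered group. The elements \<open>a\<close> lie in a finite subalgebra of \<open>M\<close>, in which every element is
  an orthogonal sum of atoms; so the term is evaluated by finitely many comparisons of integral linear
  forms in the images of the atoms. By Fourier--Motzkin elimination the same comparisons hold at a rational
  point \<open>x\<close>, hence the term is nonzero at \<open>x\<close> as well.

  The point \<open>x\<close> comes from a state of \<open>M\<close>: for each atom \<open>b\<close>, a prime ideal of \<open>M\<close> that avoids \<open>b\<close>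
  contains all other atoms, and by local finiteness its quotient embeds into the rational unit interval; a
  combination of these maps takes the values \<open>x\<close> at the atoms. The induced homomorphism from \<open>U\<close> to the
  rational unit interval does not vanish at \<open>e\<close>, and its kernel is a maximal ideal.\<close>

text \<open>Sums in \<open>Xi\<close> are unions over all representatives, so being a state includes
  a cancellation law for good sequences. It is proved for chains, where good sequences are the
  nonnegative elements of a group. This is enough: the state built by hand has values in the
  rational chain, and a subalgebra of \<open>U\<close> inherits the law from \<open>U\<close>. The
  composite of \<open>\<upsilon>\<close> with a map to a chain quotient is only asked to be
  additive.

  Total order matters because it decides each truncated sum by the sign of one linear form. The
  group of the chain quotient may be non-Archimedean, so values in it cannot simply be replaced by
  rational ones. The signs of forms in it are a total preorder, however, and finitely many of them
  can be realized by rationals. Strict inequalities are recorded as the failure of the reversed weak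
  ones.

  A point prescribed on the atoms of a finite subalgebra must still be extended to all of
  \<open>M\<close>. This is why the functionals come from prime ideals of \<open>M\<close> and not
  of the subalgebra.\<close>

no_notation Group.monoid.one ("\<one>\<index>")

section \<open>Arithmetic of MV-algebras\<close>

definition mv_minus :: "('a, 'm) mv_struct_scheme \<Rightarrow> 'a \<Rightarrow> 'a \<Rightarrow> 'a" (infixl "\<ominus>\<index>" 70)
  where "a \<ominus>\<^bsub>A\<^esub> b = a \<odot>\<^bsub>A\<^esub> \<sim>\<^bsub>A\<^esub> b"

definition mv_meet :: "('a, 'm) mv_struct_scheme \<Rightarrow> 'a \<Rightarrow> 'a \<Rightarrow> 'a"
  where "mv_meet A a b = a \<ominus>\<^bsub>A\<^esub> (a \<ominus>\<^bsub>A\<^esub> b)"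

context mv_algebra
begin

abbreviation le (infix "\<preceq>" 50) where "x \<preceq> y \<equiv> mv_le A x y"

lemma one_closed [simp, intro]: "\<one> \<in> carrier A"
  by (simp add: mv_one_def)

lemma times_closed [simp, intro]: "\<lbrakk>x \<in> carrier A; y \<in> carrier A\<rbrakk> \<Longrightarrow> x \<odot> y \<in> carrier A"
  by (simp add: mv_times_def)

lemma minus_closed [simp, intro]: "\<lbrakk>x \<in> carrier A; y \<in> carrier A\<rbrakk> \<Longrightarrow> x \<ominus> y \<in> carrier A"
  by (simp add: mv_minus_def)

lemma meet_closed [simp, intro]: "\<lbrakk>x \<in> carrier A; y \<in> carrier A\<rbrakk> \<Longrightarrow> mv_meet A x y \<in> carrier A"
  by (simp add: mv_meet_def)

declare neg_neg [simp] plus_zero [simp]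

lemma neg_zero [simp]: "\<sim> \<zero> = \<one>" by (simp add: mv_one_def)
lemma neg_one [simp]: "\<sim> \<one> = \<zero>" unfolding mv_one_def by (rule neg_neg) simp
lemma plus_one_right [simp]: "x \<in> carrier A \<Longrightarrow> x \<oplus> \<one> = \<one>" using plus_one by simp
lemma one_plus [simp]: "x \<in> carrier A \<Longrightarrow> \<one> \<oplus> x = \<one>" by (simp add: plus_comm[of \<one>])
lemma zero_plus [simp]: "x \<in> carrier A \<Longrightarrow> \<zero> \<oplus> x = x" by (simp add: plus_comm[of \<zero>])

lemma plus_left_comm:
  "\<lbrakk>x \<in> carrier A; y \<in> carrier A; z \<in> carrier A\<rbrakk> \<Longrightarrow> x \<oplus> (y \<oplus> z) = y \<oplus> (x \<oplus> z)"
  by (metis plus_assoc plus_comm)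

lemmas plus_ac = plus_assoc plus_comm plus_left_comm

lemma neg_inject: "\<lbrakk>x \<in> carrier A; y \<in> carrier A\<rbrakk> \<Longrightarrow> \<sim> x = \<sim> y \<longleftrightarrow> x = y"
  by (metis neg_neg)

lemma times_comm: "\<lbrakk>x \<in> carrier A; y \<in> carrier A\<rbrakk> \<Longrightarrow> x \<odot> y = y \<odot> x"
  by (simp add: mv_times_def plus_comm)

lemma times_assoc: "\<lbrakk>x \<in> carrier A; y \<in> carrier A; z \<in> carrier A\<rbrakk> \<Longrightarrow> (x \<odot> y) \<odot> z = x \<odot> (y \<odot> z)"
  by (simp add: mv_times_def plus_assoc)

lemma times_left_comm:
  "\<lbrakk>x \<in> carrier A; y \<in> carrier A; z \<in> carrier A\<rbrakk> \<Longrightarrow> x \<odot> (y \<odot> z) = y \<odot> (x \<odot> z)"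
  by (metis times_assoc times_comm)

lemmas times_ac = times_assoc times_comm times_left_comm

lemma neg_plus: "\<lbrakk>x \<in> carrier A; y \<in> carrier A\<rbrakk> \<Longrightarrow> \<sim> (x \<oplus> y) = \<sim> x \<odot> \<sim> y"
  by (simp add: mv_times_def)

lemma neg_times: "\<lbrakk>x \<in> carrier A; y \<in> carrier A\<rbrakk> \<Longrightarrow> \<sim> (x \<odot> y) = \<sim> x \<oplus> \<sim> y"
  by (simp add: mv_times_def)

lemma times_one [simp]: "x \<in> carrier A \<Longrightarrow> x \<odot> \<one> = x" by (simp add: mv_times_def)
lemma one_times [simp]: "x \<in> carrier A \<Longrightarrow> \<one> \<odot> x = x" by (simp add: mv_times_def)
lemma times_zero [simp]: "x \<in> carrier A \<Longrightarrow> x \<odot> \<zero> = \<zero>" by (simp add: mv_times_def)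
lemma zero_times [simp]: "x \<in> carrier A \<Longrightarrow> \<zero> \<odot> x = \<zero>" by (simp add: mv_times_def)

lemma neg_plus_self [simp]: "x \<in> carrier A \<Longrightarrow> \<sim> x \<oplus> x = \<one>"
  using lukasiewicz[of x \<one>] by simp

lemma plus_neg_self [simp]: "x \<in> carrier A \<Longrightarrow> x \<oplus> \<sim> x = \<one>"
  by (simp add: plus_comm[of x])

lemma times_neg_self [simp]: "x \<in> carrier A \<Longrightarrow> x \<odot> \<sim> x = \<zero>" "x \<in> carrier A \<Longrightarrow> \<sim> x \<odot> x = \<zero>"
  by (simp_all add: mv_times_def)

lemma minus_zero [simp]: "x \<in> carrier A \<Longrightarrow> x \<ominus> \<zero> = x" by (simp add: mv_minus_def)

lemma minus_le_iff: 
  "\<lbrakk>x \<in> carrier A; y \<in> carrier A; z \<in> carrier A\<rbrakk> \<Longrightarrow> x \<ominus> y \<preceq> z \<longleftrightarrow> x \<preceq> y \<oplus> z"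
  by (simp add: mv_le_def mv_minus_def neg_times plus_assoc)

lemma le_refl [simp]: "x \<in> carrier A \<Longrightarrow> x \<preceq> x" by (simp add: mv_le_def)
lemma zero_le [simp]: "x \<in> carrier A \<Longrightarrow> \<zero> \<preceq> x" by (simp add: mv_le_def)
lemma le_one [simp]: "x \<in> carrier A \<Longrightarrow> x \<preceq> \<one>" by (simp add: mv_le_def)

lemma le_antisym: "\<lbrakk>x \<preceq> y; y \<preceq> x; x \<in> carrier A; y \<in> carrier A\<rbrakk> \<Longrightarrow> x = y"
  using lukasiewicz[of x y] by (simp add: mv_le_def)

text \<open>The Lukasiewicz axiom with one side collapsed: under \<open>x \<preceq> y\<close> the
  term \<open>\<sim> (\<sim> x \<oplus> y)\<close> is zero.\<close>

lemma plus_minus_of_le: "\<lbrakk>x \<preceq> y; x \<in> carrier A; y \<in> carrier A\<rbrakk> \<Longrightarrow> x \<oplus> (y \<ominus> x) = y"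
  using lukasiewicz[of x y] by (simp add: mv_le_def mv_minus_def mv_times_def plus_comm)

lemma le_plus: "\<lbrakk>x \<in> carrier A; y \<in> carrier A\<rbrakk> \<Longrightarrow> x \<preceq> x \<oplus> y"
  by (simp add: mv_le_def plus_assoc[symmetric])

lemma le_plus': "\<lbrakk>x \<in> carrier A; y \<in> carrier A\<rbrakk> \<Longrightarrow> x \<preceq> y \<oplus> x"
  by (simp add: le_plus plus_comm[of y])

lemma le_trans: 
  assumes "x \<preceq> y" "y \<preceq> z" "x \<in> carrier A" "y \<in> carrier A" "z \<in> carrier A"
  shows "x \<preceq> z"
proof -
  have "z = (x \<oplus> (y \<ominus> x)) \<oplus> (z \<ominus> y)" using assms by (simp add: plus_minus_of_le)
  also have "\<dots> = x \<oplus> ((y \<ominus> x) \<oplus> (z \<ominus> y))" using assms by (simp add: plus_assoc)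
  finally show ?thesis using assms le_plus by (metis minus_closed plus_closed)
qed

lemma le_zero_iff: "x \<in> carrier A \<Longrightarrow> x \<preceq> \<zero> \<longleftrightarrow> x = \<zero>"
  by (metis le_antisym zero_closed zero_le)

lemma one_le_iff: "x \<in> carrier A \<Longrightarrow> \<one> \<preceq> x \<longleftrightarrow> x = \<one>"
  by (metis le_antisym one_closed le_one)

lemma neg_le_neg_iff: "\<lbrakk>x \<in> carrier A; y \<in> carrier A\<rbrakk> \<Longrightarrow> \<sim> x \<preceq> \<sim> y \<longleftrightarrow> y \<preceq> x"
  by (simp add: mv_le_def plus_comm)

lemma plus_mono:
  assumes "x \<preceq> y" "z \<preceq> w" "x \<in> carrier A" "y \<in> carrier A" "z \<in> carrier A" "w \<in> carrier A"
  shows "x \<oplus> z \<preceq> y \<oplus> w"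
proof -
  have "y \<oplus> w = (x \<oplus> (y \<ominus> x)) \<oplus> (z \<oplus> (w \<ominus> z))" using assms by (simp add: plus_minus_of_le)
  also have "\<dots> = (x \<oplus> z) \<oplus> ((y \<ominus> x) \<oplus> (w \<ominus> z))" using assms by (simp add: plus_ac)
  finally show ?thesis using assms by (simp add: le_plus)
qed

lemma times_mono:
  assumes "x \<preceq> y" "z \<preceq> w" "x \<in> carrier A" "y \<in> carrier A" "z \<in> carrier A" "w \<in> carrier A"
  shows "x \<odot> z \<preceq> y \<odot> w"
  unfolding mv_times_def using assms by (simp add: neg_le_neg_iff plus_mono)

lemma times_le: "\<lbrakk>x \<in> carrier A; y \<in> carrier A\<rbrakk> \<Longrightarrow> x \<odot> y \<preceq> x"
  using times_mono[of x x y \<one>] by simp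

lemma times_le': "\<lbrakk>x \<in> carrier A; y \<in> carrier A\<rbrakk> \<Longrightarrow> x \<odot> y \<preceq> y"
  using times_mono[of x \<one> y y] by simp

lemma minus_le: "\<lbrakk>x \<in> carrier A; y \<in> carrier A\<rbrakk> \<Longrightarrow> x \<ominus> y \<preceq> x"
  by (simp add: mv_minus_def times_le)

lemma minus_eq_zero_iff: "\<lbrakk>x \<in> carrier A; y \<in> carrier A\<rbrakk> \<Longrightarrow> x \<ominus> y = \<zero> \<longleftrightarrow> x \<preceq> y"
  using minus_le_iff[of x y \<zero>] by (simp add: le_zero_iff)

lemma times_eq_zero_iff: "\<lbrakk>x \<in> carrier A; y \<in> carrier A\<rbrakk> \<Longrightarrow> x \<odot> y = \<zero> \<longleftrightarrow> x \<preceq> \<sim> y"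
  using minus_eq_zero_iff[of x "\<sim> y"] by (simp add: mv_minus_def)

lemma plus_eq_one_iff: "\<lbrakk>x \<in> carrier A; y \<in> carrier A\<rbrakk> \<Longrightarrow> x \<oplus> y = \<one> \<longleftrightarrow> \<sim> x \<preceq> y"
  by (simp add: mv_le_def)

lemma plus_eq_zero: "\<lbrakk>x \<oplus> y = \<zero>; x \<in> carrier A; y \<in> carrier A\<rbrakk> \<Longrightarrow> x = \<zero>"
  by (metis le_plus le_zero_iff)

lemma minus_plus_le: "\<lbrakk>x \<in> carrier A; y \<in> carrier A\<rbrakk> \<Longrightarrow> x \<preceq> y \<oplus> (x \<ominus> y)"
  using minus_le_iff[of x y "x \<ominus> y"] by simp

lemma meet_comm: "\<lbrakk>x \<in> carrier A; y \<in> carrier A\<rbrakk> \<Longrightarrow> mv_meet A x y = mv_meet A y x"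
  using lukasiewicz[of "\<sim> x" "\<sim> y"]
  by (simp add: mv_meet_def mv_minus_def mv_times_def plus_comm)

lemma meet_le: "\<lbrakk>x \<in> carrier A; y \<in> carrier A\<rbrakk> \<Longrightarrow> mv_meet A x y \<preceq> x"
  by (simp add: mv_meet_def minus_le)

lemma meet_le': "\<lbrakk>x \<in> carrier A; y \<in> carrier A\<rbrakk> \<Longrightarrow> mv_meet A x y \<preceq> y"
  by (metis meet_comm meet_le)

lemma meet_eq: "\<lbrakk>x \<preceq> y; x \<in> carrier A; y \<in> carrier A\<rbrakk> \<Longrightarrow> mv_meet A x y = x"
  by (metis mv_meet_def minus_eq_zero_iff minus_zero)

text \<open>Written as \<open>w \<odot> (\<sim> w \<oplus> z)\<close> the meet is visibly monotone
  in \<open>z\<close>, and the meet of \<open>w\<close> with \<open>v\<close> is \<open>v\<close>.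
  Hence the meet is the greatest lower bound.\<close>

lemma le_meet:
  assumes "v \<preceq> p" "v \<preceq> w" "v \<in> carrier A" "p \<in> carrier A" "w \<in> carrier A"
  shows "v \<preceq> mv_meet A p w"
proof -
  have meet: "mv_meet A w z = w \<odot> (\<sim> w \<oplus> z)" if "z \<in> carrier A" for z
    using that assms by (simp add: mv_meet_def mv_minus_def neg_times)
  have "mv_meet A w v \<preceq> mv_meet A w p"
    using assms by (simp add: meet times_mono plus_mono)
  then show ?thesis using assms by (metis meet_comm meet_eq)
qed

text \<open>The dual of \<open>plus_minus_of_le\<close> under negation; it cancels a summand from an
  orthogonal sum.\<close>

lemma minus_plus_cancel: 
  "\<lbrakk>x \<preceq> \<sim> y; x \<in> carrier A; y \<in> carrier A\<rbrakk> \<Longrightarrow> (x \<oplus> y) \<odot> \<sim> y = x"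
proof -
  assume "x \<preceq> \<sim> y" and c: "x \<in> carrier A" "y \<in> carrier A"
  then have "y \<preceq> \<sim> x" using neg_le_neg_iff[of "\<sim> x" y] by simp
  then have "\<sim> (y \<oplus> (\<sim> x \<ominus> y)) = x" using c by (simp add: plus_minus_of_le)
  then show "(x \<oplus> y) \<odot> \<sim> y = x" using c by (simp add: neg_plus neg_times mv_minus_def times_comm)
qed

text \<open>Prelinearity has to come from the axioms, because the representation by chains below
  rests on it. Symmetry of the meet, used for \<open>x\<close> and \<open>y \<oplus> ?t\<close> and
  again for \<open>\<sim> y\<close> and \<open>?t\<close>, brings the meet below
  \<open>?t \<odot> (\<sim> (y \<oplus> ?t) \<oplus> x)\<close>, which in turn is below
  \<open>y \<odot> \<sim> y\<close>.\<close>

lemma minus_disjoint: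
  assumes x: "x \<in> carrier A" and y: "y \<in> carrier A"
  shows "mv_meet A (x \<ominus> y) (y \<ominus> x) = \<zero>"
proof -
  let ?t = "y \<ominus> x"
  have "mv_meet A (x \<ominus> y) ?t = (x \<odot> \<sim> y) \<odot> (\<sim> x \<oplus> (y \<oplus> ?t))"
    using x y by (simp add: mv_meet_def mv_minus_def neg_times neg_plus plus_assoc)
  also have "\<dots> = (x \<odot> (\<sim> x \<oplus> (y \<oplus> ?t))) \<odot> \<sim> y"
    using x y by (simp add: times_ac)
  also have "x \<odot> (\<sim> x \<oplus> (y \<oplus> ?t)) = mv_meet A x (y \<oplus> ?t)"
    using x y by (simp add: mv_meet_def mv_minus_def neg_times)
  also have "\<dots> = mv_meet A (y \<oplus> ?t) x" using x y by (simp add: meet_comm)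
  also have "\<dots> = (y \<oplus> ?t) \<odot> (\<sim> (y \<oplus> ?t) \<oplus> x)"
    using x y by (simp add: mv_meet_def mv_minus_def neg_times)
  also have "\<dots> \<odot> \<sim> y = ((y \<oplus> ?t) \<odot> \<sim> y) \<odot> (\<sim> (y \<oplus> ?t) \<oplus> x)"
    using x y by (simp add: times_ac)
  also have "(y \<oplus> ?t) \<odot> \<sim> y = mv_meet A (\<sim> y) ?t"
    using x y by (simp add: mv_meet_def mv_minus_def neg_times neg_plus times_comm)
  also have "\<dots> = ?t \<odot> (\<sim> ?t \<oplus> \<sim> y)"
    using x y by (simp add: meet_comm[of "\<sim> y"]) (simp add: mv_meet_def mv_minus_def neg_times)
  finally have eq: "mv_meet A (x \<ominus> y) ?t = (?t \<odot> (\<sim> ?t \<oplus> \<sim> y)) \<odot> (\<sim> (y \<oplus> ?t) \<oplus> x)" .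
  have le: "mv_meet A (x \<ominus> y) ?t \<preceq> ?t \<odot> (\<sim> (y \<oplus> ?t) \<oplus> x)"
    unfolding eq using x y by (intro times_mono times_le) auto
  have "?t \<odot> (\<sim> (y \<oplus> ?t) \<oplus> x) = y \<odot> mv_meet A (\<sim> x) (\<sim> (y \<oplus> ?t))"
    using x y by (simp add: mv_meet_def mv_minus_def neg_times times_assoc plus_comm)
  also have "\<dots> \<preceq> y \<odot> \<sim> y"
  proof (intro times_mono)
    show "mv_meet A (\<sim> x) (\<sim> (y \<oplus> ?t)) \<preceq> \<sim> y"
      by (rule le_trans[of _ "\<sim> (y \<oplus> ?t)"]) (use x y in \<open>auto simp: meet_le' neg_le_neg_iff le_plus\<close>)
  qed (use x y in auto)
  finally have "?t \<odot> (\<sim> (y \<oplus> ?t) \<oplus> x) \<preceq> \<zero>" using y by simp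
  then show ?thesis using le x y by (metis le_zero_iff meet_closed minus_closed neg_closed plus_closed times_closed)
qed

text \<open>With \<open>?z\<close> for the meet, \<open>?z \<ominus> b\<close> is below both
  \<open>a\<close> and \<open>w\<close> and vanishes; so \<open>?z\<close> is below \<open>b\<close>
  and \<open>w\<close> and vanishes too. Iterated, this carries disjointness over to
  multiples.\<close>

lemma disjoint_plus:
  assumes a: "mv_meet A a w = \<zero>" and b: "mv_meet A b w = \<zero>" and c: "a \<in> carrier A" "b \<in> carrier A" "w \<in> carrier A"
  shows "mv_meet A (a \<oplus> b) w = \<zero>"
proof -
  let ?z = "mv_meet A (a \<oplus> b) w"
  have z: "?z \<in> carrier A" "?z \<preceq> a \<oplus> b" "?z \<preceq> w" using c by (auto simp: meet_le meet_le')
  have below: "v = \<zero>" if "v \<preceq> p" "v \<preceq> w" "mv_meet A p w = \<zero>" "v \<in> carrier A" "p \<in> carrier A" for v p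
    using le_meet[of v p w] that c by (simp add: le_zero_iff)
  have "?z \<ominus> b \<preceq> a" using z c by (simp add: minus_le_iff plus_comm)
  moreover have "?z \<ominus> b \<preceq> w" using z c le_trans minus_le minus_closed by metis
  ultimately have "?z \<ominus> b = \<zero>" using below a z c by blast
  then have "?z \<preceq> b" using z c by (simp add: minus_eq_zero_iff)
  then show ?thesis using below b z c by blast
qed

text \<open>The elements \<open>\<sim> (a \<oplus> b)\<close> and \<open>a \<odot> b\<close> are the
  two differences of \<open>\<sim> b\<close> and \<open>a\<close>, hence disjoint, and subtracting a
  disjoint element changes nothing. The identity makes \<open>a \<oplus> b\<close>,
  \<open>a \<odot> b\<close>, \<open>\<zero>\<close>, ... a good sequence.\<close>

lemma plus_times_absorb: 
  assumes "a \<in> carrier A" "b \<in> carrier A"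
  shows "(a \<oplus> b) \<oplus> (a \<odot> b) = a \<oplus> b"
proof -
  let ?X = "\<sim> b \<ominus> a" and ?Y = "a \<ominus> \<sim> b"
  have "?X \<ominus> (?X \<ominus> ?Y) = \<zero>" using minus_disjoint[of "\<sim> b" a] assms by (simp add: mv_meet_def)
  then have "?X \<preceq> ?X \<ominus> ?Y" using assms by (simp add: minus_eq_zero_iff)
  then have "?X \<ominus> ?Y = ?X" using assms by (simp add: le_antisym minus_le)
  then have "\<sim> (?X \<ominus> ?Y) = \<sim> ?X" by simp
  then show ?thesis using assms by (simp add: mv_minus_def neg_times neg_plus plus_comm)
qed

end

section \<open>Prime ideals and chains\<close>

text \<open>The condition is linearity of the quotient order. Where a proper ideal is wanted,
  properness comes from an element outside it.\<close>

definition mv_prime_ideal :: "('a, 'm) mv_struct_scheme \<Rightarrow> 'a set \<Rightarrow> bool"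
  where "mv_prime_ideal A P \<longleftrightarrow> mv_ideal A P \<and>
    (\<forall>x\<in>carrier A. \<forall>y\<in>carrier A. x \<ominus>\<^bsub>A\<^esub> y \<in> P \<or> y \<ominus>\<^bsub>A\<^esub> x \<in> P)"

locale mv_chain = mv_algebra +
  assumes zero_neq_one: "\<zero> \<noteq> \<one>"
    and linear: "\<lbrakk>x \<in> carrier A; y \<in> carrier A\<rbrakk> \<Longrightarrow> mv_le A x y \<or> mv_le A y x"

context mv_algebra
begin

definition nmult :: "nat \<Rightarrow> 'a \<Rightarrow> 'a" where "nmult n u = ((\<oplus>) u ^^ n) \<zero>"

lemma nmult_simps [simp]: "nmult 0 u = \<zero>" "nmult (Suc n) u = u \<oplus> nmult n u"
  by (simp_all add: nmult_def)

lemma nmult_closed [simp, intro]: "u \<in> carrier A \<Longrightarrow> nmult n u \<in> carrier A"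
  by (induction n) auto

lemma nmult_add: "u \<in> carrier A \<Longrightarrow> nmult (m + n) u = nmult m u \<oplus> nmult n u"
  by (induction m) (auto simp: plus_assoc)

text \<open>The set is the ideal generated by \<open>I\<close> and \<open>u\<close>, in the explicit
  form that a maximality argument can exploit.\<close>

lemma ideal_extend:
  assumes I: "mv_ideal A I" and u: "u \<in> carrier A"
  shows "mv_ideal A {z \<in> carrier A. \<exists>p\<in>I. \<exists>n. z \<preceq> p \<oplus> nmult n u}" (is "mv_ideal A ?J")
proof -
  have Ic: "I \<subseteq> carrier A" "\<zero> \<in> I" and Ip: "\<And>x y. x \<in> I \<Longrightarrow> y \<in> I \<Longrightarrow> x \<oplus> y \<in> I"
    using I by (auto simp: mv_ideal_def)
  have plus: "x \<oplus> y \<in> ?J" if xy: "x \<in> ?J" "y \<in> ?J" for x y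
  proof -
    obtain p n q m where pn: "p \<in> I" "x \<preceq> p \<oplus> nmult n u" "q \<in> I" "y \<preceq> q \<oplus> nmult m u"
      using xy by auto
    have pq: "p \<in> carrier A" "q \<in> carrier A" using pn Ic by auto
    have "x \<oplus> y \<preceq> (p \<oplus> nmult n u) \<oplus> (q \<oplus> nmult m u)"
      using xy pn pq u by (intro plus_mono) auto
    also have "\<dots> = (p \<oplus> q) \<oplus> nmult (n + m) u"
      using pq u by (simp add: nmult_add plus_ac)
    finally show ?thesis using xy Ip[OF pn(1,3)] by auto
  qed
  have down: "x \<in> ?J" if xy: "x \<in> carrier A" "y \<in> ?J" "x \<preceq> y" for x y
  proof -
    obtain p n where pn: "p \<in> I" "y \<preceq> p \<oplus> nmult n u" using xy by auto
    then have "x \<preceq> p \<oplus> nmult n u"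
      using xy u Ic le_trans[of x y "p \<oplus> nmult n u"] by auto
    then show ?thesis using xy pn by auto
  qed
  have "\<zero> \<in> ?J" using Ic u by (auto intro!: bexI[of _ \<zero>])
  then show ?thesis unfolding mv_ideal_def using plus down by blast
qed

lemma disjoint_nmult:
  assumes "mv_meet A u w = \<zero>" "u \<in> carrier A" "w \<in> carrier A"
  shows "mv_meet A (nmult n u) w = \<zero>"
proof (induction n)
  case 0
  then show ?case using assms by (simp add: meet_eq)
next
  case (Suc n)
  then show ?case using assms by (simp add: disjoint_plus)
qed

text \<open>Zorn's lemma gives an ideal \<open>P\<close> maximal among those avoiding
  \<open>e\<close>. If \<open>x \<ominus> y\<close> and \<open>y \<ominus> x\<close> were both
  outside, then modulo elements of \<open>P\<close> the element \<open>e\<close> would lie below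
  multiples of two disjoint elements, hence in \<open>P\<close>.\<close>

lemma prime_ideal_avoiding:
  assumes e: "e \<in> carrier A" "e \<noteq> \<zero>"
  obtains P where "mv_prime_ideal A P" "e \<notin> P"
proof -
  let ?F = "{I. mv_ideal A I \<and> e \<notin> I}"
  have "mv_ideal A {\<zero>}" by (auto simp: mv_ideal_def le_zero_iff)
  then have ne: "?F \<noteq> {}" using e by auto
  have "\<Union>C \<in> ?F" if C: "C \<noteq> {}" "subset.chain ?F C" for C
  proof -
    have CF: "C \<subseteq> ?F" and ch: "\<And>I J. I \<in> C \<Longrightarrow> J \<in> C \<Longrightarrow> I \<subseteq> J \<or> J \<subseteq> I"
      using C by (auto simp: subset.chain_def)
    have id: "I \<subseteq> carrier A" "\<zero> \<in> I" "\<And>x y. x \<in> carrier A \<Longrightarrow> y \<in> I \<Longrightarrow> x \<preceq> y \<Longrightarrow> x \<in> I"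
       "\<And>x y. x \<in> I \<Longrightarrow> y \<in> I \<Longrightarrow> x \<oplus> y \<in> I" if "I \<in> C" for I
    proof -
      have "mv_ideal A I" using CF that by auto
      then show "I \<subseteq> carrier A" "\<zero> \<in> I" "\<And>x y. x \<in> carrier A \<Longrightarrow> y \<in> I \<Longrightarrow> x \<preceq> y \<Longrightarrow> x \<in> I"
       "\<And>x y. x \<in> I \<Longrightarrow> y \<in> I \<Longrightarrow> x \<oplus> y \<in> I"
        unfolding mv_ideal_def by blast+
    qed
    have "x \<oplus> y \<in> \<Union>C" if xy: "x \<in> \<Union>C" "y \<in> \<Union>C" for x y
    proof -
      obtain I J where IJ: "I \<in> C" "x \<in> I" "J \<in> C" "y \<in> J" using xy by blast
      then consider "I \<subseteq> J" | "J \<subseteq> I" using ch by blast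
      then show ?thesis
      proof cases
        case 1
        then have "x \<oplus> y \<in> J" using id(4)[of J x y] IJ by blast
        then show ?thesis using IJ by blast
      next
        case 2
        then have "x \<oplus> y \<in> I" using id(4)[of I x y] IJ by blast
        then show ?thesis using IJ by blast
      qed
    qed
    moreover have "\<Union>C \<subseteq> carrier A" "\<zero> \<in> \<Union>C" using id(1,2) C(1) by blast+
    moreover have "x \<in> \<Union>C" if "x \<in> carrier A" "y \<in> \<Union>C" "x \<preceq> y" for x y
      using that id(3) by (metis UnionE UnionI)
    ultimately have "mv_ideal A (\<Union>C)" unfolding mv_ideal_def by simp
    then show ?thesis using CF by auto
  qed
  then obtain P where P: "P \<in> ?F" and max: "\<And>X. X \<in> ?F \<Longrightarrow> P \<subseteq> X \<Longrightarrow> X = P"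
    using subset_Zorn_nonempty[OF ne] by blast
  have Pid: "mv_ideal A P" "e \<notin> P" using P by auto
  have Pc: "P \<subseteq> carrier A" and Pp: "\<And>x y. x \<in> P \<Longrightarrow> y \<in> P \<Longrightarrow> x \<oplus> y \<in> P"
    and Pd: "\<And>x y. x \<in> carrier A \<Longrightarrow> y \<in> P \<Longrightarrow> x \<preceq> y \<Longrightarrow> x \<in> P"
    using Pid by (auto simp: mv_ideal_def)
  have reach: "\<exists>p\<in>P. \<exists>n. e \<preceq> p \<oplus> nmult n u" if u: "u \<in> carrier A" "u \<notin> P" for u
  proof (rule ccontr)
    let ?J = "{z \<in> carrier A. \<exists>p\<in>P. \<exists>n. z \<preceq> p \<oplus> nmult n u}"
    assume "\<not> ?thesis"
    then have "?J \<in> ?F" using ideal_extend[OF Pid(1) u(1)] by auto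
    moreover have "p \<in> ?J" if "p \<in> P" for p
      using that Pc u by (auto intro!: bexI[of _ p] exI[of _ 0])
    ultimately have "?J = P" using max by blast
    moreover have "\<zero> \<in> P" using Pid by (simp add: mv_ideal_def)
    then have "u \<in> ?J" using u by (auto intro!: bexI[of _ \<zero>] exI[of _ 1])
    ultimately show False using u by auto
  qed
  have "x \<ominus> y \<in> P \<or> y \<ominus> x \<in> P" if xy: "x \<in> carrier A" "y \<in> carrier A" for x y
  proof (rule ccontr)
    let ?u = "x \<ominus> y" and ?v = "y \<ominus> x"
    assume "\<not> ?thesis"
    then obtain p m q n where pq: "p \<in> P" "q \<in> P" "e \<preceq> p \<oplus> nmult m ?u" "e \<preceq> q \<oplus> nmult n ?v"
      using reach xy by (metis minus_closed)
    have c: "p \<in> carrier A" "q \<in> carrier A" "?u \<in> carrier A" "?v \<in> carrier A"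
      using pq Pc xy by auto
    have "mv_meet A (nmult m ?u) ?v = \<zero>"
      using disjoint_nmult minus_disjoint xy c by blast
    then have "mv_meet A ?v (nmult m ?u) = \<zero>"
      using c by (simp add: meet_comm)
    then have "mv_meet A (nmult n ?v) (nmult m ?u) = \<zero>"
      using disjoint_nmult c by blast
    \<comment> \<open>Subtracting \<open>p \<oplus> q\<close> serves both bounds on \<open>e\<close>
      at once: what remains is below both of the disjoint multiples.\<close>
    moreover have "e \<ominus> (p \<oplus> q) \<preceq> nmult m ?u"
    proof -
      have "e \<preceq> (p \<oplus> nmult m ?u) \<oplus> q" using e c pq(3) by (intro le_trans[OF pq(3) le_plus]) auto
      then show ?thesis using e c by (simp add: minus_le_iff plus_ac)
    qed
    moreover have "e \<ominus> (p \<oplus> q) \<preceq> nmult n ?v"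
    proof -
      have "e \<preceq> (q \<oplus> nmult n ?v) \<oplus> p" using e c by (intro le_trans[OF pq(4) le_plus]) auto
      then show ?thesis using e c by (simp add: minus_le_iff plus_ac)
    qed
    ultimately have "e \<ominus> (p \<oplus> q) \<preceq> \<zero>"
      using le_meet e c by (metis minus_closed nmult_closed plus_closed)
    then have "e \<preceq> p \<oplus> q" using e c by (simp add: minus_le_iff)
    then show False using Pd Pp pq e Pid by blast
  qed
  then have "mv_prime_ideal A P" using Pid(1) unfolding mv_prime_ideal_def by blast
  then show ?thesis using that Pid(2) by blast
qed

lemma minus_triangle:
  assumes "x \<in> carrier A" "y \<in> carrier A" "z \<in> carrier A"
  shows "x \<ominus> z \<preceq> (x \<ominus> y) \<oplus> (y \<ominus> z)"
proof -
  have "x \<preceq> y \<oplus> (x \<ominus> y)" "y \<preceq> z \<oplus> (y \<ominus> z)" using assms by (auto simp: minus_plus_le)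
  then have "x \<preceq> (z \<oplus> (y \<ominus> z)) \<oplus> (x \<ominus> y)"
    using assms by (meson le_refl le_trans minus_closed plus_closed plus_mono)
  then show ?thesis using assms by (simp add: minus_le_iff plus_ac)
qed

lemma plus_minus_plus_le:
  assumes "x \<in> carrier A" "y \<in> carrier A" "z \<in> carrier A" "w \<in> carrier A"
  shows "(x \<oplus> z) \<ominus> (y \<oplus> w) \<preceq> (x \<ominus> y) \<oplus> (z \<ominus> w)"
proof -
  have "x \<oplus> z \<preceq> (y \<oplus> (x \<ominus> y)) \<oplus> (w \<oplus> (z \<ominus> w))"
    using assms by (simp add: plus_mono minus_plus_le)
  then show ?thesis using assms by (simp add: minus_le_iff plus_ac)
qed

lemma neg_minus_neg: "\<lbrakk>x \<in> carrier A; y \<in> carrier A\<rbrakk> \<Longrightarrow> \<sim> x \<ominus> \<sim> y = y \<ominus> x"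
  by (simp add: mv_minus_def times_comm)

text \<open>The quotient by an ideal is carried by a set of representatives, which keeps its elements in
  the type of the original algebra.\<close>

lemma quotient_exists:
  assumes P: "mv_ideal A P"
  obtains C :: "'a mv_struct" and f where "mv_algebra C" "f \<in> mv_hom A C" "f ` carrier A = carrier C"
    "\<And>x y. \<lbrakk>x \<in> carrier A; y \<in> carrier A\<rbrakk> \<Longrightarrow> f x = f y \<longleftrightarrow> x \<ominus> y \<in> P \<and> y \<ominus> x \<in> P"
proof -
  have Pc: "P \<subseteq> carrier A" "\<zero> \<in> P" and Pp: "\<And>x y. x \<in> P \<Longrightarrow> y \<in> P \<Longrightarrow> x \<oplus> y \<in> P"
    and Pd: "\<And>x y. y \<in> P \<Longrightarrow> x \<preceq> y \<Longrightarrow> x \<in> carrier A \<Longrightarrow> x \<in> P"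
    using P by (auto simp: mv_ideal_def)
  define E where "E x y \<longleftrightarrow> x \<ominus> y \<in> P \<and> y \<ominus> x \<in> P" for x y
  have E_refl: "E x x" if "x \<in> carrier A" for x using that Pc by (simp add: E_def mv_minus_def)
  have E_sym: "E x y \<Longrightarrow> E y x" for x y by (simp add: E_def)
  have E_trans: "E x z" if "E x y" "E y z" "x \<in> carrier A" "y \<in> carrier A" "z \<in> carrier A" for x y z
    using that unfolding E_def by (meson Pd Pp minus_closed minus_triangle)
  have E_plus: "E (x \<oplus> z) (y \<oplus> w)" if "E x y" "E z w"
    "x \<in> carrier A" "y \<in> carrier A" "z \<in> carrier A" "w \<in> carrier A" for x y z w
    using that unfolding E_def by (meson Pd Pp minus_closed plus_closed plus_minus_plus_le)
  have E_neg: "E (\<sim> x) (\<sim> y)" if "E x y" "x \<in> carrier A" "y \<in> carrier A" for x y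
    using that unfolding E_def by (simp add: neg_minus_neg)
  define f where "f = restrict (\<lambda>x. SOME y. y \<in> carrier A \<and> E x y) (carrier A)"
  have f: "f x \<in> carrier A \<and> E x (f x)" if "x \<in> carrier A" for x
    using someI[of "\<lambda>y. y \<in> carrier A \<and> E x y" x] that E_refl by (simp add: f_def)
  have f_eq: "f x = f y \<longleftrightarrow> E x y" if "x \<in> carrier A" "y \<in> carrier A" for x y
  proof
    assume "f x = f y"
    then show "E x y" using f that by (metis E_sym E_trans)
  next
    assume "E x y"
    \<comment> \<open>Equivalent elements have the same predicate under \<open>SOME\<close>, so the
      same representative is chosen for them.\<close>
    then have "(\<lambda>z. z \<in> carrier A \<and> E x z) = (\<lambda>z. z \<in> carrier A \<and> E y z)"
      using that by (metis E_sym E_trans)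
    then show "f x = f y" using that by (simp add: f_def)
  qed
  define C :: "'a mv_struct" where "C = \<lparr>carrier = f ` carrier A, mv_plus = \<lambda>x y. f (x \<oplus> y),
     mv_neg = \<lambda>x. f (\<sim> x), mv_zero = f \<zero>\<rparr>"
  have C_plus: "f x \<oplus>\<^bsub>C\<^esub> f y = f (x \<oplus> y)" if "x \<in> carrier A" "y \<in> carrier A" for x y
    using that f E_plus E_sym by (simp add: C_def f_eq)
  have C_neg: "\<sim>\<^bsub>C\<^esub> f x = f (\<sim> x)" if "x \<in> carrier A" for x
    using that f E_neg E_sym by (simp add: C_def f_eq)
  have C_zero: "\<zero>\<^bsub>C\<^esub> = f \<zero>" by (simp add: C_def)
  have C_car: "carrier C = f ` carrier A" by (simp add: C_def)
  have "mv_algebra C"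
  proof
    show "\<sim>\<^bsub>C\<^esub> (\<sim>\<^bsub>C\<^esub> x \<oplus>\<^bsub>C\<^esub> y) \<oplus>\<^bsub>C\<^esub> y = \<sim>\<^bsub>C\<^esub> (\<sim>\<^bsub>C\<^esub> y \<oplus>\<^bsub>C\<^esub> x) \<oplus>\<^bsub>C\<^esub> x" 
      if "x \<in> carrier C" "y \<in> carrier C" for x y
      using that by (auto simp: C_car C_plus C_neg lukasiewicz)
    show "x \<oplus>\<^bsub>C\<^esub> y = y \<oplus>\<^bsub>C\<^esub> x" if "x \<in> carrier C" "y \<in> carrier C" for x y
      using that by (auto simp: C_car C_plus plus_comm)
  qed (auto simp: C_car C_plus C_neg C_zero plus_assoc)
  moreover have "f \<in> mv_hom A C"
    by (auto simp: mv_hom_def C_plus C_neg C_zero C_car) (auto simp: f_def)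
  ultimately show ?thesis using that C_car f_eq unfolding E_def by simp
qed

end

lemma mv_hom_simps:
  assumes "f \<in> mv_hom A B"
  shows "x \<in> carrier A \<Longrightarrow> f x \<in> carrier B"
    and "f \<zero>\<^bsub>A\<^esub> = \<zero>\<^bsub>B\<^esub>"
    and "x \<in> carrier A \<Longrightarrow> f (\<sim>\<^bsub>A\<^esub> x) = \<sim>\<^bsub>B\<^esub> f x"
    and "\<lbrakk>x \<in> carrier A; y \<in> carrier A\<rbrakk> \<Longrightarrow> f (x \<oplus>\<^bsub>A\<^esub> y) = f x \<oplus>\<^bsub>B\<^esub> f y"
  using assms by (auto simp: mv_hom_def)

lemma mv_hom_derived:
  assumes "f \<in> mv_hom A B" and "mv_algebra A"
  shows "f \<one>\<^bsub>A\<^esub> = \<one>\<^bsub>B\<^esub>"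
    and "\<lbrakk>x \<in> carrier A; y \<in> carrier A\<rbrakk> \<Longrightarrow> f (x \<odot>\<^bsub>A\<^esub> y) = f x \<odot>\<^bsub>B\<^esub> f y"
    and "\<lbrakk>x \<in> carrier A; y \<in> carrier A\<rbrakk> \<Longrightarrow> f (x \<ominus>\<^bsub>A\<^esub> y) = f x \<ominus>\<^bsub>B\<^esub> f y"
proof -
  interpret mv_algebra A by fact
  show "f \<one>\<^bsub>A\<^esub> = \<one>\<^bsub>B\<^esub>"
    using mv_hom_simps[OF assms(1)] by (metis mv_one_def zero_closed)
  have *: "f (x \<odot>\<^bsub>A\<^esub> y) = f x \<odot>\<^bsub>B\<^esub> f y" if "x \<in> carrier A" "y \<in> carrier A" for x y
    using that by (simp add: mv_times_def mv_hom_simps[OF assms(1)])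
  then show "\<lbrakk>x \<in> carrier A; y \<in> carrier A\<rbrakk> \<Longrightarrow> f (x \<odot>\<^bsub>A\<^esub> y) = f x \<odot>\<^bsub>B\<^esub> f y" .
  show "\<lbrakk>x \<in> carrier A; y \<in> carrier A\<rbrakk> \<Longrightarrow> f (x \<ominus>\<^bsub>A\<^esub> y) = f x \<ominus>\<^bsub>B\<^esub> f y"
    by (simp add: mv_minus_def * mv_hom_simps[OF assms(1)])
qed

text \<open>Chang's representation by chains, one element at a time. Primality makes the quotient
  linear, and the image of \<open>e\<close> keeps it nontrivial: if \<open>\<zero>\<close> and
  \<open>\<one>\<close> agreed in it, everything would be zero.\<close>

lemma (in mv_algebra) hom_to_chain_exists:
  assumes e: "e \<in> carrier A" "e \<noteq> \<zero>"
  obtains C :: "'a mv_struct" and f where "mv_chain C" "f \<in> mv_hom A C" "f e \<noteq> \<zero>\<^bsub>C\<^esub>"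
proof -
  obtain P where P: "mv_prime_ideal A P" "e \<notin> P" using prime_ideal_avoiding e by blast
  then have Pi: "mv_ideal A P" by (simp add: mv_prime_ideal_def)
  obtain C :: "'a mv_struct" and f where C: "mv_algebra C" "f \<in> mv_hom A C" "f ` carrier A = carrier C"
    and f_eq: "\<And>x y. \<lbrakk>x \<in> carrier A; y \<in> carrier A\<rbrakk> \<Longrightarrow> f x = f y \<longleftrightarrow> x \<ominus> y \<in> P \<and> y \<ominus> x \<in> P"
    using quotient_exists[OF Pi] by blast
  interpret C: mv_algebra C by fact
  have zero: "f x = \<zero>\<^bsub>C\<^esub> \<longleftrightarrow> x \<in> P" if "x \<in> carrier A" for x
  proof -
    have "\<zero> \<ominus> x = \<zero>" using that by (simp add: mv_minus_def)
    moreover have "\<zero> \<in> P" using Pi by (simp add: mv_ideal_def)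
    ultimately show ?thesis
      using f_eq[of x \<zero>] mv_hom_simps(2)[OF C(2)] that by simp
  qed
  have ne: "f e \<noteq> \<zero>\<^bsub>C\<^esub>" using zero e P by simp
  have "mv_le C u v \<or> mv_le C v u" if uv: "u \<in> carrier C" "v \<in> carrier C" for u v
  proof -
    obtain x y where xy: "x \<in> carrier A" "y \<in> carrier A" "u = f x" "v = f y"
      using uv C(3) by (metis imageE)
    then have "x \<ominus> y \<in> P \<or> y \<ominus> x \<in> P" using P by (simp add: mv_prime_ideal_def)
    then have "f (x \<ominus> y) = \<zero>\<^bsub>C\<^esub> \<or> f (y \<ominus> x) = \<zero>\<^bsub>C\<^esub>" using zero xy by auto
    then show ?thesis 
      using xy uv by (simp add: mv_hom_derived(3)[OF C(2) mv_algebra_axioms] C.minus_eq_zero_iff)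
  qed
  moreover have "\<zero>\<^bsub>C\<^esub> \<noteq> \<one>\<^bsub>C\<^esub>"
  proof
    assume "\<zero>\<^bsub>C\<^esub> = \<one>\<^bsub>C\<^esub>"
    then have "f e = \<zero>\<^bsub>C\<^esub>"
      using C.le_one[of "f e"] C.le_zero_iff mv_hom_simps(1)[OF C(2)] e by metis
    then show False using ne by simp
  qed
  ultimately have "mv_chain C" by (intro mv_chain.intro mv_chain_axioms.intro C(1))
  then show ?thesis using that C(2) ne by blast
qed

section \<open>The totally ordered group of an MV-chain\<close>

context mv_algebra
begin

lemma neg_le_iff: "\<lbrakk>x \<in> carrier A; y \<in> carrier A\<rbrakk> \<Longrightarrow> \<sim> x \<preceq> y \<longleftrightarrow> \<sim> y \<preceq> x"
  by (simp add: mv_le_def plus_comm)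

text \<open>In additive terms both sides are \<open>a + b + c - 1\<close> cut off at zero, since
  \<open>a + c\<close> and \<open>b + c\<close> stay within the unit. The local claim brings the
  left side into a form symmetric in \<open>a\<close> and \<open>b\<close>. This lemma and the next
  two are associativity of \<open>carry_add\<close>, case by case.\<close>

lemma times_plus_swap:
  assumes "c \<preceq> \<sim> a" "c \<preceq> \<sim> b" "a \<in> carrier A" "b \<in> carrier A" "c \<in> carrier A"
  shows "a \<odot> (b \<oplus> c) = b \<odot> (a \<oplus> c)"
proof -
  have *: "a \<odot> (b \<oplus> c) = \<sim> (c \<oplus> ((\<sim> a \<ominus> c) \<oplus> (\<sim> b \<ominus> c)))"
    if c: "c \<preceq> \<sim> a" "c \<preceq> \<sim> b" "a \<in> carrier A" "b \<in> carrier A" for a b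
  proof -
    have "a = \<sim> (c \<oplus> (\<sim> a \<ominus> c))" using c assms(5) by (simp add: plus_minus_of_le)
    moreover have "b \<oplus> c = \<sim> (\<sim> b \<ominus> c)" using c assms(5) by (simp add: mv_minus_def neg_times)
    ultimately have "a \<odot> (b \<oplus> c) = \<sim> (c \<oplus> (\<sim> a \<ominus> c)) \<odot> \<sim> (\<sim> b \<ominus> c)" by simp
    also have "\<dots> = \<sim> ((c \<oplus> (\<sim> a \<ominus> c)) \<oplus> (\<sim> b \<ominus> c))"
      using c assms(5) by (subst neg_plus[of "c \<oplus> (\<sim> a \<ominus> c)"]) auto
    finally show ?thesis using c assms(5) by (simp add: plus_assoc)
  qed
  show ?thesis using *[of a b] *[of b a] assms by (simp add: plus_comm)
qed

lemma plus_times_swap: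
  assumes "\<sim> a \<preceq> c" "\<sim> b \<preceq> c" "a \<in> carrier A" "b \<in> carrier A" "c \<in> carrier A"
  shows "a \<oplus> (b \<odot> c) = b \<oplus> (a \<odot> c)"
proof -
  have "\<sim> a \<odot> (\<sim> b \<oplus> \<sim> c) = \<sim> b \<odot> (\<sim> a \<oplus> \<sim> c)"
    using assms by (intro times_plus_swap) (auto simp: neg_le_iff)
  then have "\<sim> (a \<oplus> (b \<odot> c)) = \<sim> (b \<oplus> (a \<odot> c))"
    using assms by (simp add: neg_plus neg_times)
  then show ?thesis using assms by (simp add: neg_inject)
qed

text \<open>Here \<open>b + c\<close> reaches the unit and \<open>a + c\<close> stays within it;
  both sides are \<open>a + b + c - 1\<close>, and nothing is cut off.\<close>

lemma plus_times_modular: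
  assumes "\<sim> b \<preceq> c" "c \<preceq> \<sim> a" and c: "a \<in> carrier A" "b \<in> carrier A" "c \<in> carrier A"
  shows "a \<oplus> (b \<odot> c) = b \<odot> (a \<oplus> c)"
proof -
  have "\<sim> b \<preceq> \<sim> a" using assms le_trans neg_closed by metis
  then have ab: "a \<preceq> b" using c by (simp add: neg_le_neg_iff)
  let ?r = "b \<odot> c"
  have c_eq: "c = \<sim> b \<oplus> ?r"
    using plus_minus_of_le[OF assms(1)] c by (simp add: mv_minus_def times_comm)
  have "a \<oplus> ?r \<preceq> a \<oplus> (b \<ominus> a)"
    using c assms(2) by (simp add: plus_mono mv_minus_def times_mono)
  then have "a \<oplus> ?r \<preceq> \<sim> (\<sim> b)" using ab c by (simp add: plus_minus_of_le)
  then have "((a \<oplus> ?r) \<oplus> \<sim> b) \<odot> \<sim> (\<sim> b) = a \<oplus> ?r"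
    using c by (intro minus_plus_cancel) auto
  moreover have "(a \<oplus> ?r) \<oplus> \<sim> b = a \<oplus> c"
    using c by (subst (2) c_eq) (simp add: plus_ac)
  ultimately show ?thesis using c by (simp add: times_comm)
qed

text \<open>Addition in \<open>\<int> \<times> A\<close> with carry; the pair \<open>(n, a)\<close> stands for \<open>n\<close> units plus \<open>a\<close>.\<close>

definition carry_add :: "int \<times> 'a \<Rightarrow> int \<times> 'a \<Rightarrow> int \<times> 'a"
  where "carry_add g h = (if snd g \<oplus> snd h = \<one> then (fst g + fst h + 1, snd g \<odot> snd h)
    else (fst g + fst h, snd g \<oplus> snd h))"

text \<open>Leaving out \<open>\<one>\<close> makes the pairs normal forms:
  \<open>(n, \<one>)\<close> and \<open>(n + 1, \<zero>)\<close> would denote the same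
  element.\<close>

definition chang_group :: "(int \<times> 'a) monoid"
  where "chang_group = \<lparr>carrier = UNIV \<times> (carrier A - {\<one>}), mult = carry_add, one = (0, \<zero>)\<rparr>"

definition chang_embed :: "'a \<Rightarrow> int \<times> 'a"
  where "chang_embed c = (if c = \<one> then (1, \<zero>) else (0, c))"

end

context mv_chain
begin

lemma plus_eq_one_or_times_eq_zero:
  "\<lbrakk>x \<in> carrier A; y \<in> carrier A\<rbrakk> \<Longrightarrow> x \<oplus> y = \<one> \<or> x \<odot> y = \<zero>"
  using linear[of "\<sim> x" y] by (auto simp: plus_eq_one_iff times_eq_zero_iff[of y x] times_comm[of x y])

lemma times_neq_one: "\<lbrakk>x \<in> carrier A; y \<in> carrier A; x \<noteq> \<one>\<rbrakk> \<Longrightarrow> x \<odot> y \<noteq> \<one>"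
  using times_le one_le_iff by metis

text \<open>Associativity in exchange form, which is symmetric in \<open>a\<close> and
  \<open>b\<close>: of the four cases given by whether \<open>b \<oplus> c\<close> and
  \<open>a \<oplus> c\<close> carry, the two mixed ones are mirror images.\<close>

lemma carry_add_left_comm:
  assumes "a \<in> carrier A - {\<one>}" "b \<in> carrier A - {\<one>}" "c \<in> carrier A - {\<one>}"
  shows "carry_add (k, a) (carry_add (l, b) (m, c)) = carry_add (l, b) (carry_add (k, a) (m, c))"
proof -
  note [simp] = carry_add_def
  have c: "a \<in> carrier A" "b \<in> carrier A" "c \<in> carrier A" using assms by auto
  have mixed: "carry_add (k, a) (carry_add (l, b) (m, c)) = carry_add (l, b) (carry_add (k, a) (m, c))"
    if bc: "b \<oplus> c = \<one>" and ac: "a \<oplus> c \<noteq> \<one>" and [simp]: "a \<in> carrier A" "b \<in> carrier A" for a b k l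
  proof -
    have [simp]: "c \<in> carrier A" by fact
    have ac0: "a \<odot> c = \<zero>" using plus_eq_one_or_times_eq_zero[of a c] ac by simp
    have "a \<oplus> (b \<odot> c) \<preceq> a \<oplus> c" by (simp add: plus_mono times_le')
    then have ne: "a \<oplus> (b \<odot> c) \<noteq> \<one>" using ac one_le_iff by (metis \<open>a \<in> carrier A\<close> \<open>c \<in> carrier A\<close> plus_closed)
    have "b \<oplus> (a \<oplus> c) = \<one>" using bc by (simp add: plus_left_comm)
    moreover have "a \<oplus> (b \<odot> c) = b \<odot> (a \<oplus> c)"
      using bc ac0 by (intro plus_times_modular) (auto simp: plus_eq_one_iff times_eq_zero_iff times_comm[of a])
    ultimately show ?thesis using bc ac ne by simp
  qed
  consider "b \<oplus> c \<noteq> \<one>" "a \<oplus> c \<noteq> \<one>" | "b \<oplus> c = \<one>" "a \<oplus> c = \<one>" | "b \<oplus> c = \<one>" "a \<oplus> c \<noteq> \<one>"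
    | "b \<oplus> c \<noteq> \<one>" "a \<oplus> c = \<one>" by blast
  then show ?thesis
  proof cases
    case 1
    then have "b \<odot> c = \<zero>" "a \<odot> c = \<zero>" using plus_eq_one_or_times_eq_zero c by blast+
    then have "a \<odot> (b \<oplus> c) = b \<odot> (a \<oplus> c)"
      using c by (intro times_plus_swap) (auto simp: times_eq_zero_iff times_comm[of _ c])
    then show ?thesis using 1 c plus_left_comm[of a b c] by simp
  next
    case 2
    then have "a \<oplus> (b \<odot> c) = b \<oplus> (a \<odot> c)"
      using c by (intro plus_times_swap) (auto simp: plus_eq_one_iff)
    then show ?thesis using 2 c times_left_comm[of a b c] by simp
  next
    case 3
    then show ?thesis using mixed c by blast
  next
    case 4
    then show ?thesis using mixed[of a b l k] c by simp
  qed
qed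

lemma carry_add_comm:
  "\<lbrakk>a \<in> carrier A; b \<in> carrier A\<rbrakk> \<Longrightarrow> carry_add (k, a) (l, b) = carry_add (l, b) (k, a)"
  by (simp add: carry_add_def plus_comm times_comm)

lemma chang_group_comm_group: "comm_group chang_group"
proof (rule comm_groupI)
  show "x \<otimes>\<^bsub>chang_group\<^esub> y \<in> carrier chang_group"
    if "x \<in> carrier chang_group" "y \<in> carrier chang_group" for x y
    using that by (auto simp: chang_group_def carry_add_def times_neq_one)
  show "one chang_group \<in> carrier chang_group"
    using zero_neq_one by (simp add: chang_group_def)
  show comm: "x \<otimes>\<^bsub>chang_group\<^esub> y = y \<otimes>\<^bsub>chang_group\<^esub> x"
    if "x \<in> carrier chang_group" "y \<in> carrier chang_group" for x y
    using that carry_add_comm by (auto simp: chang_group_def)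
  show "x \<otimes>\<^bsub>chang_group\<^esub> y \<otimes>\<^bsub>chang_group\<^esub> z = x \<otimes>\<^bsub>chang_group\<^esub> (y \<otimes>\<^bsub>chang_group\<^esub> z)"
    if xyz: "x \<in> carrier chang_group" "y \<in> carrier chang_group" "z \<in> carrier chang_group" for x y z
  proof -
    obtain k a l b m c where eq: "x = (k, a)" "y = (l, b)" "z = (m, c)" by (metis surj_pair)
    then have c: "a \<in> carrier A - {\<one>}" "b \<in> carrier A - {\<one>}" "c \<in> carrier A - {\<one>}"
      using xyz by (auto simp: chang_group_def)
    have cl: "carry_add (k, a) (l, b) \<in> UNIV \<times> carrier A"
      using c by (auto simp: carry_add_def)
    have "carry_add (carry_add (k, a) (l, b)) (m, c) = carry_add (m, c) (carry_add (k, a) (l, b))"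
      using cl c carry_add_comm by (cases "carry_add (k, a) (l, b)") auto
    also have "\<dots> = carry_add (k, a) (carry_add (m, c) (l, b))"
      by (rule carry_add_left_comm) (use c in auto)
    also have "carry_add (m, c) (l, b) = carry_add (l, b) (m, c)"
      by (rule carry_add_comm) (use c in auto)
    finally show ?thesis by (simp add: eq chang_group_def)
  qed
  show "one chang_group \<otimes>\<^bsub>chang_group\<^esub> x = x" if "x \<in> carrier chang_group" for x
    using that by (auto simp: chang_group_def carry_add_def)
  show "\<exists>y\<in>carrier chang_group. y \<otimes>\<^bsub>chang_group\<^esub> x = one chang_group"
    if x: "x \<in> carrier chang_group" for x
  proof -
    obtain k a where eq: "x = (k, a)" "a \<in> carrier A" "a \<noteq> \<one>" using x by (auto simp: chang_group_def)
    show ?thesis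
    \<comment> \<open>As \<open>\<sim> a \<oplus> a\<close> carries, the inverse has to give back
      one more unit, whence \<open>- k - 1\<close>. At zero this would require the excluded second
      component \<open>\<one>\<close>.\<close>
    proof (cases "a = \<zero>")
      case True
      then show ?thesis using eq zero_neq_one
        by (intro bexI[of _ "(- k, \<zero>)"]) (auto simp: chang_group_def carry_add_def)
    next
      case False
      then have "\<sim> a \<noteq> \<one>" using eq by (metis neg_neg neg_one)
      then show ?thesis using eq
        by (intro bexI[of _ "(- k - 1, \<sim> a)"]) (auto simp: chang_group_def carry_add_def)
    qed
  qed
qed

sublocale G: comm_group chang_group
  rewrites "carrier chang_group = UNIV \<times> (carrier A - {\<one>})"
    and "mult chang_group = carry_add"
    and "one chang_group = (0, \<zero>)"
  by (rule chang_group_comm_group) (simp_all add: chang_group_def)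

lemma chang_embed_closed [simp, intro]:
  "c \<in> carrier A \<Longrightarrow> chang_embed c \<in> UNIV \<times> (carrier A - {\<one>})"
  using zero_neq_one by (auto simp: chang_embed_def)

lemma chang_embed_add:
  assumes "a \<odot> b = \<zero>" "a \<in> carrier A" "b \<in> carrier A"
  shows "chang_embed (a \<oplus> b) = carry_add (chang_embed a) (chang_embed b)"
  using assms zero_neq_one by (auto simp: chang_embed_def carry_add_def)

lemma fst_chang_embed: "0 \<le> fst (chang_embed c)"
  by (simp add: chang_embed_def)

lemma fst_carry_add: "fst g + fst h \<le> fst (carry_add g h)"
  by (simp add: carry_add_def)

text \<open>A pair in normal form has its sign in the integer part, so \<open>0 \<le> fst g\<close>
  is the positive cone. Nonnegative plus positive is not neutral, and this is where the strict
  inequalities below come from.\<close>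

lemma carry_add_chang_embed_neq:
  assumes "c \<in> carrier A" "c \<noteq> \<zero>" "g \<in> UNIV \<times> (carrier A - {\<one>})" "0 \<le> fst g"
  shows "carry_add g (chang_embed c) \<noteq> (0, \<zero>)"
  using assms plus_eq_zero[of c "snd g"]
  by (auto simp: chang_embed_def carry_add_def plus_comm split: if_splits)

text \<open>Adding \<open>g\<close> and its inverse carries at most one unit, so the two integer
  parts cannot both be negative.\<close>

lemma chang_cone_total: 
  assumes "g \<in> UNIV \<times> (carrier A - {\<one>})"
  shows "0 \<le> fst g \<or> 0 \<le> fst (m_inv chang_group g)"
proof -
  let ?h = "m_inv chang_group g"
  have "carry_add g ?h = (0, \<zero>)" using G.r_inv[OF assms] .
  then have "fst g + fst ?h + (if snd g \<oplus> snd ?h = \<one> then 1 else 0) = 0"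
    by (simp add: carry_add_def split: if_splits)
  then show ?thesis by (intro disjCI) (auto split: if_splits)
qed

end

section \<open>States and good sequences\<close>

text \<open>The part of the notion of state that is expressed inside the MV-algebras; it passes
  through homomorphisms by plain computation.\<close>

definition mv_additive :: "('a, 'm) mv_struct_scheme \<Rightarrow> ('b, 'n) mv_struct_scheme \<Rightarrow> ('a \<Rightarrow> 'b) \<Rightarrow> bool"
  where "mv_additive M N s \<longleftrightarrow> s \<in> carrier M \<rightarrow> carrier N \<and> s \<one>\<^bsub>M\<^esub> = \<one>\<^bsub>N\<^esub> \<and>
    (\<forall>a\<in>carrier M. \<forall>b\<in>carrier M. a \<odot>\<^bsub>M\<^esub> b = \<zero>\<^bsub>M\<^esub> \<longrightarrow>
      s a \<odot>\<^bsub>N\<^esub> s b = \<zero>\<^bsub>N\<^esub> \<and> s (a \<oplus>\<^bsub>M\<^esub> b) = s a \<oplus>\<^bsub>N\<^esub> s b)"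

context mv_algebra
begin

lemma foldr_plus_zero:
  "\<lbrakk>\<And>i. i \<in> set xs \<Longrightarrow> t i = \<zero>; w \<in> carrier A\<rbrakk> \<Longrightarrow> foldr (\<lambda>i z. t i \<oplus> z) xs w = w"
  by (induction xs) auto

lemma foldr_plus_closed:
  "\<lbrakk>\<And>i. i \<in> set xs \<Longrightarrow> t i \<in> carrier A; w \<in> carrier A\<rbrakk> \<Longrightarrow> foldr (\<lambda>i z. t i \<oplus> z) xs w \<in> carrier A"
  by (induction xs) auto

lemma foldr_plus_one:
  assumes "\<And>i. i \<in> set xs \<Longrightarrow> t i \<in> carrier A" "w \<in> carrier A" "w = \<one> \<or> (\<exists>i\<in>set xs. t i = \<one>)"
  shows "foldr (\<lambda>i z. t i \<oplus> z) xs w = \<one>"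
  using assms
proof (induction xs)
  case (Cons j xs)
  have "foldr (\<lambda>i z. t i \<oplus> z) xs w \<in> carrier A" by (rule foldr_plus_closed) (use Cons.prems in auto)
  moreover have "t j \<in> carrier A" using Cons.prems by simp
  moreover have "t j = \<one> \<or> foldr (\<lambda>i z. t i \<oplus> z) xs w = \<one>"
  proof (cases "t j = \<one>")
    case False
    then have "foldr (\<lambda>i z. t i \<oplus> z) xs w = \<one>"
      by (intro Cons.IH) (use Cons.prems in auto)
    then show ?thesis ..
  qed simp
  ultimately show ?case by auto
qed simp

lemma gs_single_good: "a \<in> carrier A \<Longrightarrow> gs_single A a \<in> good_seqs A"
  by (auto simp: good_seqs_def gs_single_def intro: exI[of _ 1])

lemma gs_add_single:
  assumes "a \<in> carrier A" "b \<in> carrier A"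
  shows "gs_add A (gs_single A a) (gs_single A b) = 
    (\<lambda>n. if n = 0 then a \<oplus> b else if n = 1 then a \<odot> b else \<zero>)"
proof
  fix n :: nat
  consider "n = 0" | "n = 1" | "n \<ge> 2" by linarith
  then show "gs_add A (gs_single A a) (gs_single A b) n = 
    (if n = 0 then a \<oplus> b else if n = 1 then a \<odot> b else \<zero>)"
  proof cases
    case 3
    have "foldr (\<lambda>i z. (gs_single A a i \<odot> gs_single A b (n - Suc i)) \<oplus> z) [0..<n] (gs_single A b n)
      = gs_single A b n"
      by (rule foldr_plus_zero) (use assms 3 in \<open>auto simp: gs_single_def\<close>)
    then show ?thesis using 3 by (simp add: gs_add_def) (simp add: gs_single_def)
  qed (use assms in \<open>auto simp: gs_add_def gs_single_def\<close>)
qed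

lemma gs_add_single_good:
  assumes "a \<in> carrier A" "b \<in> carrier A"
  shows "gs_add A (gs_single A a) (gs_single A b) \<in> good_seqs A"
  unfolding gs_add_single[OF assms] good_seqs_def
  using assms by (auto simp: plus_times_absorb intro: exI[of _ 2])

lemma gs_add_zero:
  assumes "x \<in> good_seqs A"
  shows "gs_add A x (gs_single A \<zero>) = x"
proof
  have assms: "x i \<in> carrier A" for i using assms by (simp add: good_seqs_def)
  fix n
  have "foldr (\<lambda>i z. (x i \<odot> gs_single A \<zero> (n - Suc i)) \<oplus> z) [0..<n] (gs_single A \<zero> n) = gs_single A \<zero> n"
    by (rule foldr_plus_zero) (use assms in \<open>auto simp: gs_single_def\<close>)
  then show "gs_add A x (gs_single A \<zero>) n = x n" using assms by (simp add: gs_add_def) (simp add: gs_single_def)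
qed

end

lemma lg_add_Xi: "lg_add (Xi N) P Q = (\<Union>(x, y)\<in>P. \<Union>(x', y')\<in>Q. gs_rel N `` {(gs_add N x x', gs_add N y y')})"
  by (simp add: Xi_def)

text \<open>The sum of classes in \<open>Xi\<close> is a union over all representatives, so that a state must moreover
  satisfy an instance of cancellation for good sequences.\<close>

definition gs_sum_rep :: "('b, 'n) mv_struct_scheme \<Rightarrow> 'b \<Rightarrow> 'b \<Rightarrow> (nat \<Rightarrow> 'b) \<Rightarrow> (nat \<Rightarrow> 'b) \<Rightarrow>
    (nat \<Rightarrow> 'b) \<Rightarrow> (nat \<Rightarrow> 'b) \<Rightarrow> bool"
  where "gs_sum_rep N a b z w y y' \<longleftrightarrow>
    {z, w, y, y', gs_add N (gs_single N a) y, gs_add N (gs_single N b) y', gs_add N y y',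
      gs_add N (gs_add N (gs_single N a) y) (gs_add N (gs_single N b) y')} \<subseteq> good_seqs N \<and>
    gs_add N (gs_add N (gs_add N (gs_single N a) y) (gs_add N (gs_single N b) y')) w = gs_add N z (gs_add N y y')"

text \<open>The pair \<open>(z, w)\<close> runs through the formal differences in the sum of the
  classes of \<open>a\<close> and \<open>b\<close>, whose representatives have second parts
  \<open>y\<close> and \<open>y'\<close>. The conclusion says that \<open>(z, w)\<close> lies in the
  class of \<open>a \<oplus> b\<close>.\<close>

definition gs_cancel :: "('b, 'n) mv_struct_scheme \<Rightarrow> 'b \<Rightarrow> 'b \<Rightarrow> bool"
  where "gs_cancel N a b \<longleftrightarrow>
    (\<forall>z w y y'. gs_sum_rep N a b z w y y' \<longrightarrow> gs_add N (gs_single N (a \<oplus>\<^bsub>N\<^esub> b)) w = z)"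

lemma Xi_embed_mem:
  assumes "mv_algebra N" "a \<in> carrier N"
  shows "(x, y) \<in> Xi_embed N a \<longleftrightarrow> x \<in> good_seqs N \<and> y \<in> good_seqs N \<and> x = gs_add N (gs_single N a) y"
proof -
  interpret mv_algebra N by fact
  show ?thesis using assms gs_add_zero
    by (auto simp: Xi_embed_def gs_rel_def gs_single_good)
qed

text \<open>Representatives with zero second part give a canonical pair in the sum. Comparing it
  with the class of \<open>c\<close> at the entries 0 and 1 yields \<open>c = a \<oplus> b\<close>
  and orthogonality; equality of the classes at arbitrary pairs is cancellation.\<close>

lemma Xi_embed_add_iff:
  assumes "mv_algebra N" and a: "a \<in> carrier N" and b: "b \<in> carrier N" and c: "c \<in> carrier N"
  shows "Xi_embed N c = lg_add (Xi N) (Xi_embed N a) (Xi_embed N b) \<longleftrightarrow>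
    a \<odot>\<^bsub>N\<^esub> b = \<zero>\<^bsub>N\<^esub> \<and> c = a \<oplus>\<^bsub>N\<^esub> b \<and> gs_cancel N a b" (is "?L \<longleftrightarrow> ?R")
proof -
  interpret mv_algebra N by fact
  note mem = Xi_embed_mem[OF assms(1)]
  let ?s = "gs_single N" and ?p = "gs_add N"
  have zz: "?p (?s \<zero>\<^bsub>N\<^esub>) (?s \<zero>\<^bsub>N\<^esub>) = ?s \<zero>\<^bsub>N\<^esub>"
    by (rule gs_add_zero) (simp add: gs_single_good)
  have z0: "?p x (?s \<zero>\<^bsub>N\<^esub>) = x" if "x \<in> good_seqs N" for x
    using that by (intro gs_add_zero)
  have selfmem: "(?s d, ?s \<zero>\<^bsub>N\<^esub>) \<in> Xi_embed N d" if "d \<in> carrier N" for d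
    using that z0 gs_single_good by (simp add: mem)
  let ?S = "{(z, w). \<exists>y y'. gs_sum_rep N a b z w y y'}"
  have sum: "lg_add (Xi N) (Xi_embed N a) (Xi_embed N b) = ?S"
  proof (intro equalityI subsetI)
    fix v assume "v \<in> lg_add (Xi N) (Xi_embed N a) (Xi_embed N b)"
    then obtain x y x' y' where m: "(x, y) \<in> Xi_embed N a" "(x', y') \<in> Xi_embed N b"
      "v \<in> gs_rel N `` {(?p x x', ?p y y')}"
      unfolding lg_add_Xi by blast
    then have "gs_sum_rep N a b (fst v) (snd v) y y'"
      by (auto simp: gs_rel_def mem a b gs_sum_rep_def)
    then show "v \<in> ?S" by (cases v) auto
  next
    fix v assume "v \<in> ?S"
    then obtain z w y y' where v: "v = (z, w)" "gs_sum_rep N a b z w y y'" by blast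
    then have "(?p (?s a) y, y) \<in> Xi_embed N a" "(?p (?s b) y', y') \<in> Xi_embed N b"
      by (simp_all add: mem a b gs_sum_rep_def)
    moreover have "v \<in> gs_rel N `` {(?p (?p (?s a) y) (?p (?s b) y'), ?p y y')}"
      using v by (simp add: gs_rel_def gs_sum_rep_def)
    ultimately show "v \<in> lg_add (Xi N) (Xi_embed N a) (Xi_embed N b)"
      unfolding lg_add_Xi by blast
  qed
  have "gs_sum_rep N a b (?p (?s a) (?s b)) (?s \<zero>\<^bsub>N\<^esub>) (?s \<zero>\<^bsub>N\<^esub>) (?s \<zero>\<^bsub>N\<^esub>)"
    by (simp add: gs_sum_rep_def z0 gs_add_single_good gs_single_good a b)
  then have ab_mem: "(?p (?s a) (?s b), ?s \<zero>\<^bsub>N\<^esub>) \<in> ?S" by blast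
  show ?thesis
  proof
    assume L: ?L
    have "(?p (?s a) (?s b), ?s \<zero>\<^bsub>N\<^esub>) \<in> Xi_embed N c"
      using ab_mem L sum by simp
    then have eq: "?p (?s a) (?s b) = ?s c"
      using z0 gs_single_good c by (simp add: mem)
    from fun_cong[OF this, of 0] fun_cong[OF this, of 1]
    have ab: "a \<odot>\<^bsub>N\<^esub> b = \<zero>\<^bsub>N\<^esub>" "c = a \<oplus>\<^bsub>N\<^esub> b"
      using a b unfolding gs_add_single[OF a b] by (simp_all add: gs_single_def)
    have "gs_cancel N a b"
      unfolding gs_cancel_def
    proof (intro allI impI)
      fix z w y y' assume "gs_sum_rep N a b z w y y'"
      then have "(z, w) \<in> ?S" by blast
      then have "(z, w) \<in> Xi_embed N c" unfolding L sum .
      then show "?p (?s (a \<oplus>\<^bsub>N\<^esub> b)) w = z" using mem[OF c] ab(2) by simp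
    qed
    then show ?R using ab by blast
  next
    assume R: ?R
    have sub: "?S \<subseteq> Xi_embed N c"
    proof
      fix v assume "v \<in> ?S"
      then obtain z w y y' where v: "v = (z, w)" "gs_sum_rep N a b z w y y'" by blast
      then have "?p (?s c) w = z" using R unfolding gs_cancel_def by blast
      then show "v \<in> Xi_embed N c" using v by (simp add: mem[OF c] gs_sum_rep_def)
    qed
    have eq: "?p (?s a) (?s b) = ?s c"
      using R unfolding gs_add_single[OF a b] by (auto simp: gs_single_def)
    have "Xi_embed N c \<subseteq> lg_add (Xi N) (Xi_embed N a) (Xi_embed N b)"
    proof -
      have "Xi_embed N c = gs_rel N `` {(?p (?s a) (?s b), ?p (?s \<zero>\<^bsub>N\<^esub>) (?s \<zero>\<^bsub>N\<^esub>))}"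
        by (simp add: Xi_embed_def eq zz)
      then show ?thesis unfolding lg_add_Xi using selfmem[OF a] selfmem[OF b] by blast
    qed
    then show ?L using sub unfolding sum by (rule subset_antisym)
  qed
qed

lemma mv_state_iff:
  assumes "mv_algebra M" "mv_algebra N"
  shows "mv_state M N s \<longleftrightarrow> mv_additive M N s \<and>
    (\<forall>a\<in>carrier M. \<forall>b\<in>carrier M. a \<odot>\<^bsub>M\<^esub> b = \<zero>\<^bsub>M\<^esub> \<longrightarrow> gs_cancel N (s a) (s b))"
proof -
  interpret M: mv_algebra M by fact
  have *: "Xi_embed N (s (a \<oplus>\<^bsub>M\<^esub> b)) = lg_add (Xi N) (Xi_embed N (s a)) (Xi_embed N (s b)) \<longleftrightarrow>
    s a \<odot>\<^bsub>N\<^esub> s b = \<zero>\<^bsub>N\<^esub> \<and> s (a \<oplus>\<^bsub>M\<^esub> b) = s a \<oplus>\<^bsub>N\<^esub> s b \<and> gs_cancel N (s a) (s b)"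
    if "s \<in> carrier M \<rightarrow> carrier N" "a \<in> carrier M" "b \<in> carrier M" for a b
    using that by (intro Xi_embed_add_iff[OF assms(2)]) auto
  show ?thesis
  proof (cases "s \<in> carrier M \<rightarrow> carrier N")
    case True
    show ?thesis unfolding mv_state_def mv_additive_def using *[OF True] by blast
  qed (simp add: mv_state_def mv_additive_def)
qed

text \<open>Cancellation is a universal condition on good sequences, and a subset of the carrier has
  fewer of them under the same operations.\<close>

lemma gs_cancel_subalgebra:
  assumes "gs_cancel N a b" "B \<subseteq> carrier N"
  shows "gs_cancel (N\<lparr>carrier := B\<rparr>) a b"
proof -
  have eq: "gs_add (N\<lparr>carrier := B\<rparr>) = gs_add N" "gs_single (N\<lparr>carrier := B\<rparr>) = gs_single N"
    by (auto simp: gs_add_def gs_single_def mv_times_def fun_eq_iff)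
  have "good_seqs (N\<lparr>carrier := B\<rparr>) \<subseteq> good_seqs N"
    using assms(2) by (auto simp: good_seqs_def)
  then have "gs_sum_rep (N\<lparr>carrier := B\<rparr>) a b z w y y' \<Longrightarrow> gs_sum_rep N a b z w y y'" for z w y y'
    unfolding gs_sum_rep_def eq by blast
  then show ?thesis using assms(1) unfolding gs_cancel_def by (simp add: eq) blast
qed

section \<open>Good sequences over a chain and their cancellation law\<close>

context mv_chain
begin

text \<open>Unary notation for a nonnegative element of \<open>chang_group\<close>, with its
  fractional part as last digit.\<close>

definition gseq :: "int \<times> 'a \<Rightarrow> nat \<Rightarrow> 'a"
  where "gseq g i = (if int i < fst g then \<one> else if int i = fst g then snd g else \<zero>)"

text \<open>At the first entry \<open>x p\<close> different from \<open>\<one>\<close>, linearity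
  makes \<open>x p\<close> and the next entry orthogonal, and then
  \<open>x p \<oplus> x (Suc p) = x p\<close> cancels to \<open>x (Suc p) = \<zero>\<close>.\<close>

lemma good_seq_is_gseq:
  assumes x: "x \<in> good_seqs A"
  obtains g where "g \<in> UNIV \<times> (carrier A - {\<one>})" "0 \<le> fst g" "x = gseq g"
proof -
  have xc: "\<And>i. x i \<in> carrier A" and xs: "\<And>i. x i \<oplus> x (Suc i) = x i" and "\<exists>n. \<forall>i\<ge>n. x i = \<zero>"
    using x by (auto simp: good_seqs_def)
  then obtain n where "x n = \<zero>" by blast
  then have ex: "x n \<noteq> \<one>" using zero_neq_one by simp
  define p where "p = (LEAST i. x i \<noteq> \<one>)"
  have p: "x p \<noteq> \<one>" unfolding p_def by (rule LeastI[of "\<lambda>i. x i \<noteq> \<one>", OF ex])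
  have below: "x i = \<one>" if "i < p" for i
    using not_less_Least[of i "\<lambda>i. x i \<noteq> \<one>"] that unfolding p_def by blast
  have "x (Suc p) = \<zero>"
  proof -
    have ne: "x (Suc p) \<oplus> x p \<noteq> \<one>" using xs[of p] xc p by (simp add: plus_comm)
    then have "x (Suc p) \<odot> x p = \<zero>" using plus_eq_one_or_times_eq_zero xc by blast
    then have "(x (Suc p) \<oplus> x p) \<odot> \<sim> x p = x (Suc p)"
      using xc by (intro minus_plus_cancel) (auto simp: times_eq_zero_iff)
    then show ?thesis using xs[of p] xc by (simp add: plus_comm)
  qed
  then have above: "x (Suc p + k) = \<zero>" for k
  proof (induction k)
    case (Suc k)
    then show ?case using xs[of "Suc p + k"] xc[of "Suc p + Suc k"] by simp
  qed simp
  have "x = gseq (int p, x p)"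
  proof
    fix i
    consider "i < p" | "i = p" | k where "i = Suc p + k" by (metis less_iff_Suc_add linorder_neqE_nat add_Suc)
    then show "x i = gseq (int p, x p) i"
      by cases (use below above in \<open>auto simp: gseq_def\<close>)
  qed
  then show ?thesis using that[of "(int p, x p)"] p xc by auto
qed

lemma gseq_inj:
  assumes g: "g \<in> UNIV \<times> (carrier A - {\<one>})" "0 \<le> fst g"
    and h: "h \<in> UNIV \<times> (carrier A - {\<one>})" "0 \<le> fst h" and eq: "gseq g = gseq h"
  shows "g = h"
proof -
  have le: "fst g \<le> fst h" if "gseq g = gseq h" "h \<in> UNIV \<times> (carrier A - {\<one>})" "0 \<le> fst h" for g h
  proof (rule ccontr)
    assume "\<not> ?thesis"
    \<comment> \<open>At the smaller integer part one sequence still has \<open>\<one>\<close> and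
      the other its fractional part, which is not \<open>\<one>\<close>.\<close>
    then show False using fun_cong[OF that(1), of "nat (fst h)"] that(2,3) by (auto simp: gseq_def)
  qed
  have "fst g = fst h" using le[OF eq h] le[OF eq[symmetric] g] by simp
  moreover have "snd g = snd h" using fun_cong[OF eq, of "nat (fst h)"] calculation h by (simp add: gseq_def)
  ultimately show ?thesis by (simp add: prod_eq_iff)
qed

lemma gseq_chang_embed: "gseq (chang_embed a) = gs_single A a"
  by (auto simp: gseq_def chang_embed_def gs_single_def fun_eq_iff)

lemma gs_add_gseq_nat:
  assumes r: "r \<in> carrier A" and s: "s \<in> carrier A"
  shows "gs_add A (gseq (int p, r)) (gseq (int q, s)) n =
    (if n < p + q then \<one> else if n = p + q then r \<oplus> s else if n = Suc (p + q) then r \<odot> s else \<zero>)"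
proof -
  define x where "x = gseq (int p, r)"
  define y where "y = gseq (int q, s)"
  define t where "t i = x i \<odot> y (n - Suc i)" for i
  have x: "x i = (if i < p then \<one> else if i = p then r else \<zero>)" 
    and y: "y i = (if i < q then \<one> else if i = q then s else \<zero>)" for i
    by (simp_all add: x_def y_def gseq_def)
  have xc: "x i \<in> carrier A" and yc: "y i \<in> carrier A" for i using r s by (simp_all add: x y)
  have tc: "t i \<in> carrier A" for i using xc yc by (simp add: t_def)
  let ?f = "\<lambda>i z. t i \<oplus> z"
  have gs: "gs_add A (gseq (int p, r)) (gseq (int q, s)) n = x n \<oplus> foldr ?f [0..<n] (y n)"
    by (simp add: gs_add_def x_def y_def t_def)
  have fc: "foldr ?f xs (y n) \<in> carrier A" for xs
    by (rule foldr_plus_closed) (use tc yc in auto)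
  consider "n < p + q" | "n = p + q" | "n = Suc (p + q)" | "n > Suc (p + q)" by linarith
  then show ?thesis
  proof cases
    case 1
    have "x n = \<one> \<or> foldr ?f [0..<n] (y n) = \<one>"
    proof (cases "n < p \<or> n < q")
      case True
      then show ?thesis using foldr_plus_one[of "[0..<n]" t "y n"] tc yc by (auto simp: x y)
    next
      case False
      \<comment> \<open>The index \<open>n - q\<close> is below \<open>p\<close> and its partner
        index is \<open>q - 1\<close>, so both factors are \<open>\<one>\<close>.\<close>
      then have "t (n - q) = \<one>" "n - q < n" using 1 by (auto simp: t_def x y)
      then have "foldr ?f [0..<n] (y n) = \<one>" using tc yc by (intro foldr_plus_one) auto
      then show ?thesis by simp
    qed
    then show ?thesis using 1 gs xc fc by auto
  next
    case 2
    \<comment> \<open>At position \<open>p + q\<close> only the indices \<open>p - 1\<close> and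
      \<open>p\<close> contribute, with \<open>s\<close> and \<open>r\<close>. If
      \<open>p = 0\<close> or \<open>q = 0\<close>, one of these is missing, and \<open>y n\<close>
      or \<open>x n\<close> supplies its value.\<close>
    have t0: "t i = \<zero>" if "i < n" "Suc i < p \<or> p < i" for i
      using that 2 r s by (auto simp: t_def x y)
    have tp: "t p = r" if "q > 0" using that 2 r by (simp add: t_def x y)
    have tp1: "t (p - 1) = s" if "p > 0" using that 2 s by (simp add: t_def x y)
    have zero: "foldr ?f [a..<b] w = w" if "b \<le> n" "b < p \<or> p < a" "w \<in> carrier A" for a b w
      by (rule foldr_plus_zero) (use that t0 in auto)
    consider "p = 0" "q = 0" | "p = 0" "q > 0" | "p > 0" "q = 0" | "p > 0" "q > 0" by blast
    then have "x n \<oplus> foldr ?f [0..<n] (y n) = r \<oplus> s"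
    proof cases
      case 1
      then show ?thesis using 2 by (simp add: x y)
    next
      case c: 2
      then have "[0..<n] = p # [Suc p..<n]" using 2 by (simp add: upt_conv_Cons)
      then show ?thesis using c 2 tp zero[of n "Suc p" s] r s by (simp add: x y)
    next
      case c: 3
      then have "[0..<n] = [0..<p - 1] @ [p - 1]" using 2 by (cases p) auto
      then show ?thesis using c 2 tp1 zero[of "p - 1" 0 s] r s by (simp add: x y)
    next
      case c: 4
      have "[0..<n] = [0..<p - 1] @ [p - 1..<n]"
        using c 2 upt_add_eq_append[of 0 "p - 1" "n - (p - 1)"] by simp
      also have "[p - 1..<n] = (p - 1) # p # [Suc p..<n]"
        using c 2 by (simp add: upt_conv_Cons)
      finally show ?thesis using c 2 tp tp1 zero[of n "Suc p" \<zero>] zero[of "p - 1" 0 "s \<oplus> r"] r s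
        by (simp add: x y plus_comm)
    qed
    then show ?thesis using gs 2 by simp
  next
    case 3
    have t0: "t i = \<zero>" if "i < n" "i \<noteq> p" for i
      using that 3 r s by (auto simp: t_def x y)
    have tp: "t p = r \<odot> s" using 3 by (simp add: t_def x y)
    have zero: "foldr ?f [a..<b] w = w" if "b \<le> n" "b \<le> p \<or> p < a" "w \<in> carrier A" for a b w
      by (rule foldr_plus_zero) (use that t0 in auto)
    have "[0..<n] = [0..<p] @ [p..<n]"
      using 3 upt_add_eq_append[of 0 "p" "n - p"] by simp
    also have "[p..<n] = p # [Suc p..<n]" using 3 by (simp add: upt_conv_Cons)
    finally have "foldr ?f [0..<n] (y n) = r \<odot> s"
      using 3 tp zero[of n "Suc p" \<zero>] zero[of p 0 "r \<odot> s"] r s by (simp add: x y)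
    then show ?thesis using gs 3 r s by (simp add: x)
  next
    case 4
    have "foldr ?f [0..<n] (y n) = y n"
      by (rule foldr_plus_zero) (use 4 r s in \<open>auto simp: t_def x y\<close>)
    then show ?thesis using gs 4 by (simp add: x y)
  qed
qed

text \<open>The entries \<open>r \<oplus> s\<close> and \<open>r \<odot> s\<close> at positions
  \<open>p + q\<close> and \<open>p + q + 1\<close> are what \<open>carry_add\<close> makes of the
  fractional parts: in a chain, the first is \<open>\<one>\<close> or the second is zero.\<close>

lemma gs_add_gseq:
  assumes "g \<in> UNIV \<times> (carrier A - {\<one>})" "0 \<le> fst g" "h \<in> UNIV \<times> (carrier A - {\<one>})" "0 \<le> fst h"
  shows "gs_add A (gseq g) (gseq h) = gseq (carry_add g h)"
proof
  fix n
  obtain p r q s where gh: "g = (int p, r)" "h = (int q, s)" "r \<in> carrier A" "s \<in> carrier A"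
    using assms by (metis DiffD1 int_nat_eq mem_Sigma_iff prod.collapse nonneg_int_cases)
  then show "gs_add A (gseq g) (gseq h) n = gseq (carry_add g h) n"
    using plus_eq_one_or_times_eq_zero[of r s]
    by (auto simp: gs_add_gseq_nat) (auto simp: gseq_def carry_add_def)
qed

text \<open>Through \<open>gseq\<close> the hypothesis becomes an equation between nonnegative
  elements of an Abelian group, in which the common summand \<open>carry_add g g'\<close>
  cancels.\<close>

lemma gs_cancel_chain:
  assumes a: "a \<in> carrier A" and b: "b \<in> carrier A" and ab: "a \<odot> b = \<zero>"
  shows "gs_cancel A a b"
  unfolding gs_cancel_def
proof (intro allI impI)
  let ?G = "UNIV \<times> (carrier A - {\<one>}) :: (int \<times> 'a) set"
  let ?i = chang_embed and ?p = "gs_add A"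
  fix z w y y' assume "gs_sum_rep A a b z w y y'"
  then have good: "y \<in> good_seqs A" "y' \<in> good_seqs A" "z \<in> good_seqs A" "w \<in> good_seqs A"
    and eq: "?p (?p (?p (gs_single A a) y) (?p (gs_single A b) y')) w = ?p z (?p y y')"
    unfolding gs_sum_rep_def by auto
  obtain g where g: "g \<in> ?G" "0 \<le> fst g" "y = gseq g" using good_seq_is_gseq good(1) by blast
  obtain g' where g': "g' \<in> ?G" "0 \<le> fst g'" "y' = gseq g'" using good_seq_is_gseq good(2) by blast
  obtain h where h: "h \<in> ?G" "0 \<le> fst h" "z = gseq h" using good_seq_is_gseq good(3) by blast
  obtain k where k: "k \<in> ?G" "0 \<le> fst k" "w = gseq k" using good_seq_is_gseq good(4) by blast
  have i: "?i a \<in> ?G" "?i b \<in> ?G" "0 \<le> fst (?i a)" "0 \<le> fst (?i b)" using a b by (auto simp: fst_chang_embed)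
  have cl: "carry_add u v \<in> ?G" if "u \<in> ?G" "v \<in> ?G" for u v using G.m_closed that by blast
  have nn: "0 \<le> fst (carry_add u v)" if "0 \<le> fst u" "0 \<le> fst v" for u v :: "int \<times> 'a"
    using fst_carry_add[of u v] that by simp
  note [simp] = gs_add_gseq cl nn
  have "gseq (carry_add (carry_add (carry_add (?i a) g) (carry_add (?i b) g')) k) = gseq (carry_add h (carry_add g g'))"
    using eq g g' h k i by (simp add: gseq_chang_embed[symmetric])
  then have "carry_add (carry_add (carry_add (?i a) g) (carry_add (?i b) g')) k = carry_add h (carry_add g g')"
    by (rule gseq_inj[rotated 4]) (intro cl nn g(1,2) g'(1,2) h(1,2) k(1,2) i)+
  also have "carry_add (carry_add (carry_add (?i a) g) (carry_add (?i b) g')) k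
     = carry_add (carry_add (carry_add (?i a) (?i b)) k) (carry_add g g')"
    using g(1) g'(1) k(1) i by (simp add: G.m_ac)
  finally have "carry_add (carry_add (?i a) (?i b)) k = h"
    using g(1) g'(1) h(1) k(1) i by simp
  then show "?p (gs_single A (a \<oplus> b)) w = z"
    using ab a b i h k by (simp add: gseq_chang_embed[symmetric] chang_embed_add)
qed

end

section \<open>Terms and the rational unit interval\<close>

primrec tval :: "('a, 'm) mv_struct_scheme \<Rightarrow> ('v \<Rightarrow> 'a) \<Rightarrow> 'v mv_term \<Rightarrow> 'a" where
  "tval A s (Var v) = s v"
| "tval A s Zero = \<zero>\<^bsub>A\<^esub>"
| "tval A s (Neg p) = \<sim>\<^bsub>A\<^esub> tval A s p"
| "tval A s (Plus p q) = tval A s p \<oplus>\<^bsub>A\<^esub> tval A s q"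

lemma (in mv_algebra) tval_closed:
  "(\<And>v. v \<in> set_mv_term p \<Longrightarrow> s v \<in> carrier A) \<Longrightarrow> tval A s p \<in> carrier A"
  by (induction p) auto

lemma hom_tval:
  assumes "h \<in> mv_hom A B" "mv_algebra A" "\<And>v. v \<in> set_mv_term p \<Longrightarrow> s v \<in> carrier A"
    "\<And>v. v \<in> set_mv_term p \<Longrightarrow> h (s v) = s' v"
  shows "h (tval A s p) = tval B s' p"
proof -
  interpret mv_algebra A by fact
  show ?thesis using assms(3,4)
    by (induction p) (auto simp: mv_hom_simps[OF assms(1)] tval_closed)
qed

section \<open>Generation of the universal algebra by its state\<close>

lemma mv_algebra_subalgebra:
  assumes "mv_algebra A" "mv_subalgebra A B"
  shows "mv_algebra (A\<lparr>carrier := B\<rparr>)"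
proof -
  interpret mv_algebra A by fact
  have B: "x \<in> B \<Longrightarrow> x \<in> carrier A" "\<zero>\<^bsub>A\<^esub> \<in> B" "x \<in> B \<Longrightarrow> \<sim>\<^bsub>A\<^esub> x \<in> B"
    "x \<in> B \<Longrightarrow> y \<in> B \<Longrightarrow> x \<oplus>\<^bsub>A\<^esub> y \<in> B" for x y
    using assms(2) by (auto simp: mv_subalgebra_def)
  show ?thesis
  proof
    show "\<sim>\<^bsub>A\<lparr>carrier := B\<rparr>\<^esub> (\<sim>\<^bsub>A\<lparr>carrier := B\<rparr>\<^esub> x \<oplus>\<^bsub>A\<lparr>carrier := B\<rparr>\<^esub> y) \<oplus>\<^bsub>A\<lparr>carrier := B\<rparr>\<^esub> y =
      \<sim>\<^bsub>A\<lparr>carrier := B\<rparr>\<^esub> (\<sim>\<^bsub>A\<lparr>carrier := B\<rparr>\<^esub> y \<oplus>\<^bsub>A\<lparr>carrier := B\<rparr>\<^esub> x) \<oplus>\<^bsub>A\<lparr>carrier := B\<rparr>\<^esub> x"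
      if "x \<in> carrier (A\<lparr>carrier := B\<rparr>)" "y \<in> carrier (A\<lparr>carrier := B\<rparr>)" for x y
      using that B(1) by (simp add: lukasiewicz)
    show "x \<oplus>\<^bsub>A\<lparr>carrier := B\<rparr>\<^esub> y = y \<oplus>\<^bsub>A\<lparr>carrier := B\<rparr>\<^esub> x"
      if "x \<in> carrier (A\<lparr>carrier := B\<rparr>)" "y \<in> carrier (A\<lparr>carrier := B\<rparr>)" for x y
      using that B(1) by (simp add: plus_comm)
  qed (use B in \<open>auto simp: plus_assoc\<close>)
qed

text \<open>The values of terms form a subalgebra through which \<open>\<upsilon>\<close> factors.
  It is carried by a subset of the type of \<open>U\<close> and so is a legitimate test algebra;
  uniqueness makes the composite from \<open>U\<close> into it and back the identity.\<close>

lemma universal_state_generated: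
  fixes M :: "'a mv_struct" and U :: "'b mv_struct"
  assumes M: "mv_algebra M" and univ: "universal_state M U \<upsilon>" and e: "e \<in> carrier U"
  obtains p where "set_mv_term p \<subseteq> carrier M" "e = tval U \<upsilon> p"
proof -
  have U: "mv_algebra U" and st: "mv_state M U \<upsilon>" and un: "universal_among TYPE('b) M U \<upsilon>"
    using univ by (auto simp: universal_state_def)
  interpret M: mv_algebra M by fact
  interpret U: mv_algebra U by fact
  have \<upsilon>: "\<upsilon> a \<in> carrier U" if "a \<in> carrier M" for a using st that by (auto simp: mv_state_def)
  define B where "B = tval U \<upsilon> ` {p. set_mv_term p \<subseteq> carrier M}"
  have BU: "B \<subseteq> carrier U" using \<upsilon> by (auto simp: B_def intro!: U.tval_closed)
  have B\<upsilon>: "\<upsilon> a \<in> B" if "a \<in> carrier M" for a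
    unfolding B_def using that by (intro image_eqI[of _ _ "Var a"]) auto
  have sub: "mv_subalgebra U B"
    unfolding mv_subalgebra_def
  proof (intro conjI ballI BU)
    show "\<zero>\<^bsub>U\<^esub> \<in> B" unfolding B_def by (intro image_eqI[of _ _ Zero]) auto
  next
    fix x assume "x \<in> B"
    then obtain p where "x = tval U \<upsilon> p" "set_mv_term p \<subseteq> carrier M" by (auto simp: B_def)
    then show "\<sim>\<^bsub>U\<^esub> x \<in> B" unfolding B_def by (intro image_eqI[of _ _ "Neg p"]) auto
  next
    fix x y assume "x \<in> B" "y \<in> B"
    then obtain p q where "x = tval U \<upsilon> p" "set_mv_term p \<subseteq> carrier M"
      "y = tval U \<upsilon> q" "set_mv_term q \<subseteq> carrier M" by (auto simp: B_def)
    then show "x \<oplus>\<^bsub>U\<^esub> y \<in> B" unfolding B_def by (intro image_eqI[of _ _ "Plus p q"]) auto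
  qed
  let ?N = "U\<lparr>carrier := B\<rparr>"
  have N: "mv_algebra ?N" using mv_algebra_subalgebra[OF U sub] .
  have "mv_state M ?N \<upsilon>"
  proof -
    have add: "mv_additive M U \<upsilon>"
      and canc: "\<And>a b. a \<in> carrier M \<Longrightarrow> b \<in> carrier M \<Longrightarrow> a \<odot>\<^bsub>M\<^esub> b = \<zero>\<^bsub>M\<^esub> \<Longrightarrow> gs_cancel U (\<upsilon> a) (\<upsilon> b)"
      using st mv_state_iff[OF M U] by blast+
    have "mv_additive M ?N \<upsilon>"
    proof -
      have "\<one>\<^bsub>?N\<^esub> = \<one>\<^bsub>U\<^esub>" by (subst (1 2) mv_one_def) simp
      moreover have "x \<odot>\<^bsub>?N\<^esub> y = x \<odot>\<^bsub>U\<^esub> y" for x y by (simp add: mv_times_def)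
      ultimately show ?thesis using add B\<upsilon> unfolding mv_additive_def by simp
    qed
    then show ?thesis
      using canc gs_cancel_subalgebra[OF _ BU] by (simp add: mv_state_iff[OF M N])
  qed
  then obtain h where h: "h \<in> mv_hom U ?N" "\<And>a. a \<in> carrier M \<Longrightarrow> h (\<upsilon> a) = \<upsilon> a"
    using un N unfolding universal_among_def by blast
  have hU: "h \<in> mv_hom U U" using h(1) BU by (auto simp: mv_hom_def PiE_def Pi_def)
  have idU: "(\<lambda>x\<in>carrier U. x) \<in> mv_hom U U" by (auto simp: mv_hom_def)
  have "\<exists>!h. h \<in> mv_hom U U \<and> (\<forall>a\<in>carrier M. h (\<upsilon> a) = \<upsilon> a)"
    using un U st unfolding universal_among_def by blast
  then have "h = (\<lambda>x\<in>carrier U. x)" using hU idU h(2) \<upsilon> by (metis (no_types, lifting) restrict_apply')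
  then have "e \<in> B" using mv_hom_simps(1)[OF h(1) e] e by simp
  then show ?thesis using that by (auto simp: B_def)
qed

section \<open>The rational unit interval and its copies in other types\<close>

definition rat_mv :: "rat mv_struct"
  where "rat_mv = \<lparr>carrier = {0..1}, mv_plus = \<lambda>a b. min 1 (a + b), mv_neg = \<lambda>a. 1 - a, mv_zero = 0\<rparr>"

text \<open>Transport of structure along an injection \<open>f\<close>. The universal property tests
  only algebras on prescribed types, so the rational unit interval has to be copied into one of
  them.\<close>

definition mv_image :: "('a \<Rightarrow> 'b) \<Rightarrow> 'a mv_struct \<Rightarrow> 'b mv_struct"
  where "mv_image f A = \<lparr>carrier = f ` carrier A, mv_plus = \<lambda>x y. f (the_inv f x \<oplus>\<^bsub>A\<^esub> the_inv f y),
    mv_neg = \<lambda>x. f (\<sim>\<^bsub>A\<^esub> the_inv f x), mv_zero = f \<zero>\<^bsub>A\<^esub>\<rparr>"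

lemma rat_mv_simps [simp]:
  "carrier rat_mv = {0..1}" "a \<oplus>\<^bsub>rat_mv\<^esub> b = min 1 (a + b)" "\<sim>\<^bsub>rat_mv\<^esub> a = 1 - a" "\<zero>\<^bsub>rat_mv\<^esub> = 0"
  "\<one>\<^bsub>rat_mv\<^esub> = 1" "a \<odot>\<^bsub>rat_mv\<^esub> b = max 0 (a + b - 1)"
  by (auto simp: rat_mv_def mv_one_def mv_times_def)

lemma mv_chain_rat_mv: "mv_chain rat_mv"
  by unfold_locales (auto simp: mv_le_def min_def)

lemma mv_image_simps [simp]:
  assumes "inj f"
  shows "carrier (mv_image f A) = f ` carrier A" 
    "f a \<oplus>\<^bsub>mv_image f A\<^esub> f b = f (a \<oplus>\<^bsub>A\<^esub> b)" "\<sim>\<^bsub>mv_image f A\<^esub> f a = f (\<sim>\<^bsub>A\<^esub> a)" "\<zero>\<^bsub>mv_image f A\<^esub> = f \<zero>\<^bsub>A\<^esub>"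
    "\<one>\<^bsub>mv_image f A\<^esub> = f \<one>\<^bsub>A\<^esub>" "f a \<odot>\<^bsub>mv_image f A\<^esub> f b = f (a \<odot>\<^bsub>A\<^esub> b)"
  using assms by (auto simp: mv_image_def mv_one_def mv_times_def the_inv_f_f)

lemma mv_chain_image:
  assumes "mv_chain A" and f: "inj f"
  shows "mv_chain (mv_image f A)"
proof -
  interpret mv_chain A by fact
  note [simp] = mv_image_simps[OF f]
  show ?thesis
  proof
    show "\<sim>\<^bsub>mv_image f A\<^esub> (\<sim>\<^bsub>mv_image f A\<^esub> x \<oplus>\<^bsub>mv_image f A\<^esub> y) \<oplus>\<^bsub>mv_image f A\<^esub> y =
      \<sim>\<^bsub>mv_image f A\<^esub> (\<sim>\<^bsub>mv_image f A\<^esub> y \<oplus>\<^bsub>mv_image f A\<^esub> x) \<oplus>\<^bsub>mv_image f A\<^esub> x"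
      if "x \<in> carrier (mv_image f A)" "y \<in> carrier (mv_image f A)" for x y
      using that by (auto simp: lukasiewicz)
    show "x \<oplus>\<^bsub>mv_image f A\<^esub> y = y \<oplus>\<^bsub>mv_image f A\<^esub> x"
      if "x \<in> carrier (mv_image f A)" "y \<in> carrier (mv_image f A)" for x y
      using that by (auto simp: plus_comm)
    show "mv_le (mv_image f A) x y \<or> mv_le (mv_image f A) y x"
      if xy: "x \<in> carrier (mv_image f A)" "y \<in> carrier (mv_image f A)" for x y
    proof -
      have "mv_le (mv_image f A) (f a) (f b) \<longleftrightarrow> mv_le A a b" for a b
        by (simp add: mv_le_def inj_eq[OF f])
      moreover obtain a b where "x = f a" "a \<in> carrier A" "y = f b" "b \<in> carrier A"
        using xy by auto
      ultimately show ?thesis using linear[of a b] by simp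
    qed
  qed (use zero_neq_one in \<open>auto simp: plus_assoc inj_eq[OF f]\<close>)
qed

lemma tval_mv_image: "inj f \<Longrightarrow> tval (mv_image f A) (\<lambda>v. f (s v)) p = f (tval A s p)"
  by (induction p) simp_all

text \<open>An element outside the kernel has positive rational value, so by the Archimedean
  property some multiple of it has value 1. The negation of that multiple is in the kernel, and an
  ideal containing both contains \<open>\<one>\<close>.\<close>

lemma maximal_ideal_kernel:
  assumes U: "mv_algebra U" and enc: "inj enc" and h: "h \<in> mv_hom U (mv_image enc rat_mv)"
  shows "mv_maximal_ideal U {x \<in> carrier U. h x = enc 0}" (is "mv_maximal_ideal U ?K")
proof -
  interpret U: mv_algebra U by fact
  note [simp] = mv_image_simps[OF enc]
  define g where "g x = the_inv enc (h x)" for x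
  have h_eq: "h x = enc (g x)" and g01: "0 \<le> g x" "g x \<le> 1" if "x \<in> carrier U" for x
    using mv_hom_simps(1)[OF h that] by (auto simp: g_def the_inv_f_f[OF enc])
  have gI: "g x = r" if "h x = enc r" for x r using that by (simp add: g_def the_inv_f_f[OF enc])
  have g0: "g \<zero>\<^bsub>U\<^esub> = 0" using mv_hom_simps(2)[OF h] by (intro gI) simp
  have g_neg: "g (\<sim>\<^bsub>U\<^esub> x) = 1 - g x" if "x \<in> carrier U" for x
    using mv_hom_simps(3)[OF h that] h_eq[OF that] by (intro gI) simp
  have g_plus: "g (x \<oplus>\<^bsub>U\<^esub> y) = min 1 (g x + g y)" if "x \<in> carrier U" "y \<in> carrier U" for x y
    using mv_hom_simps(4)[OF h that] h_eq[OF that(1)] h_eq[OF that(2)] by (intro gI) simp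
  have g1: "g \<one>\<^bsub>U\<^esub> = 1" using g_neg[of "\<zero>\<^bsub>U\<^esub>"] g0 by simp
  have K: "?K = {x \<in> carrier U. g x = 0}" using h_eq by (auto simp: inj_eq[OF enc])
  have mono: "g x \<le> g y" if "mv_le U x y" "x \<in> carrier U" "y \<in> carrier U" for x y
  proof -
    have "g (\<sim>\<^bsub>U\<^esub> x \<oplus>\<^bsub>U\<^esub> y) = 1" using that(1) g1 by (simp add: mv_le_def)
    then have "min 1 (1 - g x + g y) = 1" using that(2,3) by (simp add: g_neg g_plus)
    then show ?thesis by (simp add: min_def split: if_splits)
  qed
  have "mv_ideal U ?K"
    unfolding K mv_ideal_def
  proof (intro conjI ballI impI)
    show "x \<in> {x \<in> carrier U. g x = 0}"
      if "x \<in> carrier U" "y \<in> {x \<in> carrier U. g x = 0}" "mv_le U x y" for x y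
      using that mono[of x y] g01(1)[of x] by simp
  qed (auto simp: g0 g_plus)
  moreover have "?K \<noteq> carrier U" unfolding K using g1 U.one_closed by force
  moreover have "J = carrier U" if J: "mv_ideal U J" "?K \<subset> J" for J
  proof -
    have Jc: "J \<subseteq> carrier U" "\<zero>\<^bsub>U\<^esub> \<in> J" and Jp: "\<And>x y. x \<in> J \<Longrightarrow> y \<in> J \<Longrightarrow> x \<oplus>\<^bsub>U\<^esub> y \<in> J"
      and Jd: "\<And>x y. x \<in> carrier U \<Longrightarrow> y \<in> J \<Longrightarrow> mv_le U x y \<Longrightarrow> x \<in> J"
      using J(1) unfolding mv_ideal_def by blast+
    obtain x where x: "x \<in> J" "x \<notin> ?K" using J(2) by blast
    have xc: "x \<in> carrier U" using x Jc by blast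
    then have pos: "g x > 0" using x(2) g01(1)[OF xc] unfolding K by force
    obtain n :: nat where n: "1 < of_nat n * g x" using ex_less_of_nat_mult[OF pos] by blast
    have nm: "U.nmult k x \<in> J \<and> g (U.nmult k x) = min 1 (of_nat k * g x)" for k
    proof (induction k)
      case (Suc k)
      then show ?case using x xc Jp g_plus pos g01(2)[OF xc] by (auto simp: algebra_simps min_def)
    qed (use Jc g0 in auto)
    then have "g (\<sim>\<^bsub>U\<^esub> (U.nmult n x)) = 0" using n xc g_neg by simp
    then have "\<sim>\<^bsub>U\<^esub> (U.nmult n x) \<in> J" using J(2) xc unfolding K by blast
    then have "\<one>\<^bsub>U\<^esub> \<in> J" using Jp nm xc U.neg_plus_self[of "U.nmult n x"] by (metis U.nmult_closed)
    then show ?thesis using Jc Jd U.le_one by blast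
  qed
  ultimately show ?thesis unfolding mv_maximal_ideal_def by blast
qed

section \<open>Atoms of finite subalgebras\<close>

definition mv_atoms :: "('a, 'm) mv_struct_scheme \<Rightarrow> 'a set \<Rightarrow> 'a set"
  where "mv_atoms A B = {e \<in> B. e \<noteq> \<zero>\<^bsub>A\<^esub> \<and> (\<forall>b\<in>B. mv_le A b e \<longrightarrow> b = \<zero>\<^bsub>A\<^esub> \<or> b = e)}"

text \<open>\<open>d\<close> counts how often each element of \<open>E\<close> is added; the counts
  are integers because they are subtracted later, as linear forms. Each summand is orthogonal to the
  partial sum before it, so additive maps can be evaluated along a derivation.\<close>

inductive orth_sum :: "('a, 'm) mv_struct_scheme \<Rightarrow> 'a set \<Rightarrow> 'a \<Rightarrow> ('a \<Rightarrow> int) \<Rightarrow> bool"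
  for A :: "('a, 'm) mv_struct_scheme" and E :: "'a set"
  where
    orth_sum_zero: "orth_sum A E \<zero>\<^bsub>A\<^esub> (\<lambda>_. 0)"
  | orth_sum_plus: "\<lbrakk>orth_sum A E a d; e \<in> E; a \<odot>\<^bsub>A\<^esub> e = \<zero>\<^bsub>A\<^esub>\<rbrakk>
      \<Longrightarrow> orth_sum A E (a \<oplus>\<^bsub>A\<^esub> e) (\<lambda>i. d i + (if i = e then 1 else 0))"

context mv_algebra
begin

lemma orth_sum_closed: "\<lbrakk>orth_sum A E a d; E \<subseteq> carrier A\<rbrakk> \<Longrightarrow> a \<in> carrier A"
  by (induction rule: orth_sum.induct) auto

lemma orth_sum_support: "\<lbrakk>orth_sum A E a d; i \<notin> E\<rbrakk> \<Longrightarrow> d i = 0"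
  by (induction rule: orth_sum.induct) auto

lemma subalgebra_derived:
  assumes "mv_subalgebra A B" "x \<in> B"
  shows "x \<in> carrier A" "\<one> \<in> B" "y \<in> B \<Longrightarrow> x \<odot> y \<in> B" "y \<in> B \<Longrightarrow> x \<ominus> y \<in> B" "y \<in> B \<Longrightarrow> mv_meet A x y \<in> B"
proof -
  have B: "\<zero> \<in> B" "\<And>u. u \<in> B \<Longrightarrow> \<sim> u \<in> B" "\<And>u v. u \<in> B \<Longrightarrow> v \<in> B \<Longrightarrow> u \<oplus> v \<in> B"
    using assms(1) unfolding mv_subalgebra_def by blast+
  show "x \<in> carrier A" using assms unfolding mv_subalgebra_def by blast
  show "\<one> \<in> B" unfolding mv_one_def by (intro B)
  have times: "u \<odot> v \<in> B" if "u \<in> B" "v \<in> B" for u v unfolding mv_times_def by (intro B that)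
  then show "y \<in> B \<Longrightarrow> x \<odot> y \<in> B" "y \<in> B \<Longrightarrow> x \<ominus> y \<in> B" "y \<in> B \<Longrightarrow> mv_meet A x y \<in> B"
    unfolding mv_meet_def mv_minus_def using assms(2) B(2) by simp_all
qed

lemma atom_below:
  assumes B: "mv_subalgebra A B" "finite B" and a: "a \<in> B" "a \<noteq> \<zero>"
  obtains e where "e \<in> mv_atoms A B" "e \<preceq> a"
proof -
  \<comment> \<open>The number of elements of \<open>B\<close> below serves as a rank: a nonzero
    element under \<open>a\<close> of least rank is an atom.\<close>
  define r where "r b = card {c \<in> B. c \<preceq> b}" for b
  obtain e where e: "e \<in> B" "e \<noteq> \<zero>" "e \<preceq> a"
    and least: "\<And>b. b \<in> B \<and> b \<noteq> \<zero> \<and> b \<preceq> a \<Longrightarrow> r e \<le> r b"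
    using ex_has_least_nat[of "\<lambda>b. b \<in> B \<and> b \<noteq> \<zero> \<and> b \<preceq> a" a r] a subalgebra_derived(1)[OF B(1)] by auto
  have "b = e" if b: "b \<in> B" "b \<preceq> e" "b \<noteq> \<zero>" for b
  proof (rule ccontr)
    assume "b \<noteq> e"
    note c = subalgebra_derived(1)[OF B(1)]
    have "b \<preceq> a" using b e a c le_trans by blast
    then have "r e \<le> r b" using least b by blast
    moreover have "{c \<in> B. c \<preceq> b} \<subset> {c \<in> B. c \<preceq> e}"
    proof
      show "{c \<in> B. c \<preceq> b} \<subseteq> {c \<in> B. c \<preceq> e}" using b e c le_trans by blast
      have "\<not> e \<preceq> b" using \<open>b \<noteq> e\<close> b e c le_antisym by blast
      then show "{c \<in> B. c \<preceq> b} \<noteq> {c \<in> B. c \<preceq> e}" using e c le_refl by blast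
    qed
    then have "r b < r e" unfolding r_def using B(2) by (intro psubset_card_mono) auto
    ultimately show False by simp
  qed
  then show ?thesis using that e by (auto simp: mv_atoms_def)
qed

text \<open>Subtracting an atom leaves fewer elements of \<open>B\<close> below, so the process
  ends. The same atom may be subtracted repeatedly, hence multiplicities.\<close>

lemma orth_sum_of_atoms:
  assumes B: "mv_subalgebra A B" "finite B" and "a \<in> B"
  shows "\<exists>d. orth_sum A (mv_atoms A B) a d"
  using assms(3)
proof (induction "card {c \<in> B. c \<preceq> a}" arbitrary: a rule: less_induct)
  case less
  note c = subalgebra_derived[OF B(1)]
  show ?case
  proof (cases "a = \<zero>")
    case True
    then show ?thesis using orth_sum_zero by metis
  next
    case False
    then obtain e where e: "e \<in> mv_atoms A B" "e \<preceq> a" using atom_below[OF B less.prems] by blast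
    then have eB: "e \<in> B" "e \<noteq> \<zero>" by (auto simp: mv_atoms_def)
    let ?b = "a \<ominus> e"
    have cc: "a \<in> carrier A" "e \<in> carrier A" using c(1) less.prems eB by auto
    have bB: "?b \<in> B" using c(4) less.prems eB by blast
    have be: "?b \<odot> e = \<zero>" using cc by (simp add: mv_minus_def times_assoc)
    have sum: "?b \<oplus> e = a" using plus_minus_of_le[OF e(2)] cc by (simp add: plus_comm)
    \<comment> \<open>If nothing were lost, \<open>e\<close> would be absorbed by \<open>a\<close>
      although orthogonal to it, and cancellation would make it zero.\<close>
    have "\<not> a \<preceq> ?b"
    proof
      assume "a \<preceq> ?b"
      then have eq: "?b = a" using cc by (simp add: le_antisym minus_le)
      have "(e \<oplus> a) \<odot> \<sim> a = e"
        using cc be unfolding eq by (intro minus_plus_cancel) (auto simp: times_eq_zero_iff times_comm[of a])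
      moreover have "e \<oplus> a = a" using sum cc unfolding eq by (simp add: plus_comm)
      ultimately show False using cc eB by simp
    qed
    have "{c \<in> B. c \<preceq> ?b} \<subset> {c \<in> B. c \<preceq> a}"
    proof
      show "{c \<in> B. c \<preceq> ?b} \<subseteq> {c \<in> B. c \<preceq> a}" using cc c(1) minus_le le_trans by (metis (mono_tags, lifting) Collect_mono minus_closed)
      show "{c \<in> B. c \<preceq> ?b} \<noteq> {c \<in> B. c \<preceq> a}" using \<open>\<not> a \<preceq> ?b\<close> less.prems cc le_refl by blast
    qed
    then have "card {c \<in> B. c \<preceq> ?b} < card {c \<in> B. c \<preceq> a}" using B(2) by (intro psubset_card_mono) auto
    then obtain d where "orth_sum A (mv_atoms A B) ?b d" using less.hyps bB by blast
    from orth_sum_plus[OF this e(1) be] show ?thesis using sum by auto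
  qed
qed

lemma atoms_disjoint:
  assumes B: "mv_subalgebra A B" and e: "e \<in> mv_atoms A B" "e' \<in> mv_atoms A B" "e \<noteq> e'"
  shows "mv_meet A e e' = \<zero>"
proof -
  have B': "e \<in> B" "e' \<in> B" using e by (auto simp: mv_atoms_def)
  then have "mv_meet A e e' \<in> B" "e \<in> carrier A" "e' \<in> carrier A"
    using subalgebra_derived(5)[OF B] subalgebra_derived(1)[OF B] by auto
  then have "mv_meet A e e' = \<zero> \<or> mv_meet A e e' = e" "mv_meet A e e' = \<zero> \<or> mv_meet A e e' = e'"
    using e(1,2) meet_le[of e e'] meet_le'[of e e'] by (simp_all add: mv_atoms_def)
  then show ?thesis using e(3) by auto
qed

lemma generated_subalgebra:
  assumes "S \<subseteq> carrier A"
  shows "mv_subalgebra A (mv_generated A S)" "S \<subseteq> mv_generated A S"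
proof -
  have "mv_subalgebra A (carrier A)" by (simp add: mv_subalgebra_def)
  then have "mv_generated A S \<subseteq> carrier A" using assms by (auto simp: mv_generated_def)
  then show "mv_subalgebra A (mv_generated A S)"
    unfolding mv_subalgebra_def by (auto simp: mv_generated_def mv_subalgebra_def)
  show "S \<subseteq> mv_generated A S" by (auto simp: mv_generated_def)
qed

end

section \<open>Rational-valued functionals\<close>

context mv_chain
begin

abbreviation "GC \<equiv> UNIV \<times> (carrier A - {\<one>}) :: (int \<times> 'a) set"

lemma chang_group_simps [simp]:
  "x \<otimes>\<^bsub>chang_group\<^esub> y = carry_add x y" "one chang_group = (0, \<zero>)"
  by (simp_all add: chang_group_def)

lemma carry_add_integer: "(k, r) \<in> GC \<Longrightarrow> carry_add (k, r) (m, \<zero>) = (k + m, r)"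
  by (simp add: carry_add_def)

lemma integer_in_group [simp]: "(m, \<zero>) \<in> GC"
  using zero_neq_one by simp

lemma integer_pow: "(p, \<zero>) [^]\<^bsub>chang_group\<^esub> (n :: nat) = (int n * p, \<zero>)"
proof (induction n)
  case (Suc n)
  then show ?case using zero_neq_one by (simp add: carry_add_integer algebra_simps)
qed simp

lemma snd_pow_chang_embed:
  assumes "mv_subalgebra A B" "c \<in> B"
  shows "snd (chang_embed c [^]\<^bsub>chang_group\<^esub> (n :: nat)) \<in> B"
proof (induction n)
  case 0
  then show ?case using assms by (simp add: mv_subalgebra_def)
next
  case (Suc n)
  have "snd (chang_embed c) \<in> B" using assms by (simp add: chang_embed_def mv_subalgebra_def)
  then show ?case using Suc assms(1) subalgebra_derived(3)[OF assms(1)]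
    by (auto simp: carry_add_def mv_subalgebra_def)
qed

text \<open>The second components of the multiples of \<open>chang_embed c\<close> stay in the
  finite set \<open>B\<close>. By the pigeonhole principle two multiples share theirs, and their
  difference is an integer multiple of the unit.\<close>

lemma chang_embed_torsion:
  assumes B: "mv_subalgebra A B" "finite B" and c: "c \<in> B"
  shows "\<exists>q>0. \<exists>p. chang_embed c [^]\<^bsub>chang_group\<^esub> (q :: nat) = (p, \<zero>)"
proof -
  let ?g = "chang_embed c"
  have g: "?g \<in> GC" using subalgebra_derived(1)[OF B(1) c] by (rule chang_embed_closed)
  define f where "f n = snd (?g [^]\<^bsub>chang_group\<^esub> (n :: nat))" for n
  have "range f \<subseteq> B" using snd_pow_chang_embed[OF B(1) c] by (auto simp: f_def)
  then have "finite (range f)" using B(2) finite_subset by blast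
  then have "\<not> inj f" using finite_imageD infinite_UNIV_nat by blast
  then obtain i j where ij: "i < j" "f i = f j" 
    by (metis injI linorder_neqE_nat)
  obtain k r where kr: "?g [^]\<^bsub>chang_group\<^esub> i = (k, r)" by fastforce
  obtain l where l: "?g [^]\<^bsub>chang_group\<^esub> j = (l, r)" using ij(2) kr by (metis f_def prod.collapse snd_conv)
  have in_G: "?g [^]\<^bsub>chang_group\<^esub> (n :: nat) \<in> GC" for n using g by (rule G.nat_pow_closed)
  have krG: "(k, r) \<in> GC" using in_G[of i] unfolding kr .
  have "carry_add (?g [^]\<^bsub>chang_group\<^esub> i) (?g [^]\<^bsub>chang_group\<^esub> (j - i)) = ?g [^]\<^bsub>chang_group\<^esub> j"
    using G.nat_pow_mult[OF g, of i "j - i"] ij(1) by simp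
  also have "\<dots> = carry_add (?g [^]\<^bsub>chang_group\<^esub> i) (l - k, \<zero>)"
    using carry_add_integer[OF krG] by (simp add: kr l)
  finally have "?g [^]\<^bsub>chang_group\<^esub> (j - i) = (l - k, \<zero>)"
    by (simp only: G.Units_l_cancel[unfolded G.Units_eq, OF in_G in_G integer_in_group])
  then show ?thesis using ij(1) by (metis zero_less_diff)
qed

text \<open>Meaningful only if some positive multiple of \<open>g\<close> is a multiple of the unit.\<close>

definition chang_ratio :: "int \<times> 'a \<Rightarrow> rat"
  where "chang_ratio g = (SOME r. \<exists>(q::nat) p. q > 0 \<and> g [^]\<^bsub>chang_group\<^esub> q = (p, \<zero>) \<and> r = of_int p / of_nat q)"

lemma chang_ratio_eq:
  assumes g: "g \<in> GC" and q: "q > 0" "g [^]\<^bsub>chang_group\<^esub> (q :: nat) = (p, \<zero>)"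
  shows "chang_ratio g = of_int p / of_nat q"
proof -
  have "r = of_int p / of_nat q"
    if r: "q' > 0" "g [^]\<^bsub>chang_group\<^esub> (q' :: nat) = (p', \<zero>)" "r = of_int p' / of_nat q'" for r :: rat and q' p'
  proof -
    have "g [^]\<^bsub>chang_group\<^esub> (q * q') = (int q' * p, \<zero>)"
      using G.nat_pow_pow[OF g, of q q'] q(2) by (simp add: integer_pow)
    moreover have "g [^]\<^bsub>chang_group\<^esub> (q * q') = (int q * p', \<zero>)"
      using G.nat_pow_pow[OF g, of q' q] r(2) by (simp add: integer_pow mult.commute)
    ultimately have "int q' * p = int q * p'" by simp
    then have "of_int (int q' * p) = (of_int (int q * p') :: rat)" by simp
    then show ?thesis using q(1) r(1) unfolding r(3) by (simp add: field_simps)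
  qed
  then show ?thesis unfolding chang_ratio_def
    by (intro some_equality) (use q in blast)+
qed

lemma chang_ratio_add:
  assumes "g \<in> GC" "h \<in> GC" "q > 0" "g [^]\<^bsub>chang_group\<^esub> (q :: nat) = (p, \<zero>)"
    "q' > 0" "h [^]\<^bsub>chang_group\<^esub> (q' :: nat) = (p', \<zero>)"
  shows "chang_ratio (carry_add g h) = chang_ratio g + chang_ratio h"
proof -
  have "carry_add g h [^]\<^bsub>chang_group\<^esub> (q * q') =
    carry_add (g [^]\<^bsub>chang_group\<^esub> (q * q')) (h [^]\<^bsub>chang_group\<^esub> (q * q'))"
    using assms(1,2) by (rule G.nat_pow_distrib)
  also have "g [^]\<^bsub>chang_group\<^esub> (q * q') = (int q' * p, \<zero>)"
    using G.nat_pow_pow[OF assms(1), of q q'] assms(4) by (simp add: integer_pow)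
  also have "h [^]\<^bsub>chang_group\<^esub> (q * q') = (int q * p', \<zero>)"
    using G.nat_pow_pow[OF assms(2), of q' q] assms(6) by (simp add: integer_pow mult.commute)
  also have "carry_add (int q' * p, \<zero>) (int q * p', \<zero>) = (int q' * p + int q * p', \<zero>)"
    by (rule carry_add_integer) (rule integer_in_group)
  finally have "chang_ratio (carry_add g h) = of_int (int q' * p + int q * p') / of_nat (q * q')"
    using assms by (intro chang_ratio_eq G.m_closed) auto
  also have "\<dots> = of_int p / of_nat q + of_int p' / of_nat q'"
    using assms(3,5) by (simp add: field_simps)
  finally show ?thesis using chang_ratio_eq assms by simp
qed

lemma fst_pow_nonneg: "0 \<le> fst g \<Longrightarrow> 0 \<le> fst (g [^]\<^bsub>chang_group\<^esub> (n :: nat))"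
proof (induction n)
  case (Suc n)
  then show ?case using fst_carry_add[of "g [^]\<^bsub>chang_group\<^esub> n" g] by simp
qed simp

lemma chang_ratio_embed_nonneg:
  assumes "c \<in> carrier A" "q > 0" "chang_embed c [^]\<^bsub>chang_group\<^esub> (q :: nat) = (p, \<zero>)"
  shows "0 \<le> chang_ratio (chang_embed c)" and "c \<noteq> \<zero> \<Longrightarrow> 0 < chang_ratio (chang_embed c)"
proof -
  have g: "chang_embed c \<in> GC" using assms(1) by (rule chang_embed_closed)
  have p: "p \<ge> 0" using fst_pow_nonneg[OF fst_chang_embed, of c q] assms(3) by simp
  have r: "chang_ratio (chang_embed c) = of_int p / of_nat q" using chang_ratio_eq[OF g assms(2,3)] .
  show "0 \<le> chang_ratio (chang_embed c)" using r p by simp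
  assume c: "c \<noteq> \<zero>"
  have "p \<noteq> 0"
  proof
    assume "p = 0"
    \<comment> \<open>One summand is split off: a nonnegative element plus the positive
      \<open>chang_embed c\<close> is not neutral.\<close>
    obtain n where n: "q = Suc n" using assms(2) gr0_implies_Suc by blast
    have "carry_add (chang_embed c [^]\<^bsub>chang_group\<^esub> n) (chang_embed c) = (0, \<zero>)"
      using assms(3) \<open>p = 0\<close> by (simp add: n)
    then show False
      using carry_add_chang_embed_neq[OF assms(1) c G.nat_pow_closed[OF g] fst_pow_nonneg[OF fst_chang_embed]] by blast
  qed
  then show "0 < chang_ratio (chang_embed c)" using r p assms(2) by simp
qed

end

lemma mv_subalgebra_image:
  assumes "f \<in> mv_hom A C" "mv_subalgebra A B"
  shows "mv_subalgebra C (f ` B)"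
proof -
  note h = mv_hom_simps[OF assms(1)]
  have B: "B \<subseteq> carrier A" "\<zero>\<^bsub>A\<^esub> \<in> B" "\<And>u. u \<in> B \<Longrightarrow> \<sim>\<^bsub>A\<^esub> u \<in> B" "\<And>u v. u \<in> B \<Longrightarrow> v \<in> B \<Longrightarrow> u \<oplus>\<^bsub>A\<^esub> v \<in> B"
    using assms(2) unfolding mv_subalgebra_def by blast+
  show ?thesis unfolding mv_subalgebra_def
  proof (intro conjI ballI)
    show "f ` B \<subseteq> carrier C" using B(1) h(1) by auto
    show "\<zero>\<^bsub>C\<^esub> \<in> f ` B" using B(2) h(2) by (metis imageI)
  next
    fix x assume "x \<in> f ` B"
    then obtain u where "u \<in> B" "x = f u" by blast
    then show "\<sim>\<^bsub>C\<^esub> x \<in> f ` B" using h(3)[of u] B by (metis imageI subsetD)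
  next
    fix x y assume "x \<in> f ` B" "y \<in> f ` B"
    then obtain u v where "u \<in> B" "x = f u" "v \<in> B" "y = f v" by blast
    then show "x \<oplus>\<^bsub>C\<^esub> y \<in> f ` B" using h(4)[of u v] B by (metis imageI subsetD)
  qed
qed

text \<open>\<open>\<phi> a\<close> measures \<open>f a\<close> against the unit, in the group of a
  chain quotient in which \<open>e\<close> survives. The subalgebra generated by \<open>a\<close>
  alone is finite, which makes \<open>f a\<close> commensurable with the unit. In a chain one of two
  disjoint elements is zero, so everything disjoint from \<open>e\<close> is killed.\<close>

lemma rational_functional_exists:
  fixes M :: "'a mv_struct"
  assumes M: "mv_algebra M" "mv_locally_finite M" and e: "e \<in> carrier M" "e \<noteq> \<zero>\<^bsub>M\<^esub>"
  obtains \<phi> :: "'a \<Rightarrow> rat" where "\<And>a. a \<in> carrier M \<Longrightarrow> 0 \<le> \<phi> a"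
    "\<And>a b. \<lbrakk>a \<in> carrier M; b \<in> carrier M; a \<odot>\<^bsub>M\<^esub> b = \<zero>\<^bsub>M\<^esub>\<rbrakk> \<Longrightarrow> \<phi> (a \<oplus>\<^bsub>M\<^esub> b) = \<phi> a + \<phi> b"
    "0 < \<phi> e" "\<And>a. \<lbrakk>a \<in> carrier M; mv_meet M e a = \<zero>\<^bsub>M\<^esub>\<rbrakk> \<Longrightarrow> \<phi> a = 0"
proof -
  interpret M: mv_algebra M by fact
  obtain C :: "'a mv_struct" and f where C: "mv_chain C" and f: "f \<in> mv_hom M C" "f e \<noteq> \<zero>\<^bsub>C\<^esub>"
    using M.hom_to_chain_exists[OF e] by blast
  interpret C: mv_chain C by fact
  note h = mv_hom_simps[OF f(1)] and hd = mv_hom_derived[OF f(1) M(1)]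
  define \<phi> where "\<phi> a = C.chang_ratio (C.chang_embed (f a))" for a
  have tor: "\<exists>q>0. \<exists>p. C.chang_embed (f a) [^]\<^bsub>C.chang_group\<^esub> (q :: nat) = (p, \<zero>\<^bsub>C\<^esub>)" if a: "a \<in> carrier M" for a
  proof (rule C.chang_embed_torsion)
    show "mv_subalgebra C (f ` mv_generated M {a})"
      using mv_subalgebra_image[OF f(1)] M.generated_subalgebra(1)[of "{a}"] a by simp
    show "finite (f ` mv_generated M {a})" using M(2) a by (simp add: mv_locally_finite_def)
    show "f a \<in> f ` mv_generated M {a}" using M.generated_subalgebra(2)[of "{a}"] a by simp
  qed
  show ?thesis
  proof (rule that[of \<phi>])
    show nonneg: "0 \<le> \<phi> a" if "a \<in> carrier M" for a
      using tor[OF that] C.chang_ratio_embed_nonneg(1)[OF h(1)[OF that]] unfolding \<phi>_def by blast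
    show add: "\<phi> (a \<oplus>\<^bsub>M\<^esub> b) = \<phi> a + \<phi> b" if ab: "a \<in> carrier M" "b \<in> carrier M" "a \<odot>\<^bsub>M\<^esub> b = \<zero>\<^bsub>M\<^esub>" for a b
    proof -
      have "f a \<odot>\<^bsub>C\<^esub> f b = \<zero>\<^bsub>C\<^esub>" using hd(2)[OF ab(1,2)] ab(3) h(2) by simp
      then have "C.chang_embed (f (a \<oplus>\<^bsub>M\<^esub> b)) = C.carry_add (C.chang_embed (f a)) (C.chang_embed (f b))"
        using C.chang_embed_add h ab by simp
      moreover obtain q p where "q > 0" "C.chang_embed (f a) [^]\<^bsub>C.chang_group\<^esub> (q :: nat) = (p, \<zero>\<^bsub>C\<^esub>)"
        using tor[OF ab(1)] by blast
      moreover obtain q' p' where "q' > 0" "C.chang_embed (f b) [^]\<^bsub>C.chang_group\<^esub> (q' :: nat) = (p', \<zero>\<^bsub>C\<^esub>)"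
        using tor[OF ab(2)] by blast
      ultimately show ?thesis unfolding \<phi>_def
        using C.chang_ratio_add C.chang_embed_closed h(1) ab by metis
    qed
    show "0 < \<phi> e"
      using tor[OF e(1)] C.chang_ratio_embed_nonneg(2)[OF h(1)[OF e(1)] _ _ f(2)] unfolding \<phi>_def by blast
    show "\<phi> a = 0" if a: "a \<in> carrier M" "mv_meet M e a = \<zero>\<^bsub>M\<^esub>" for a
    proof -
      have "mv_meet C (f e) (f a) = f (mv_meet M e a)"
        using e(1) a(1) by (simp add: mv_meet_def hd(3))
      then have meet: "mv_meet C (f e) (f a) = \<zero>\<^bsub>C\<^esub>" using a(2) h(2) by simp
      have "f a = \<zero>\<^bsub>C\<^esub>"
        using C.linear[OF h(1)[OF e(1)] h(1)[OF a(1)]]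
      proof
        assume "mv_le C (f e) (f a)"
        then show ?thesis using C.meet_eq h(1) e a meet f(2) by metis
      next
        assume "mv_le C (f a) (f e)"
        then show ?thesis using C.meet_eq C.meet_comm h(1) e a meet by metis
      qed
      then have "f a = f \<zero>\<^bsub>M\<^esub>" using h(2) by simp
      moreover have "\<phi> \<zero>\<^bsub>M\<^esub> = 0" using add[of "\<zero>\<^bsub>M\<^esub>" "\<zero>\<^bsub>M\<^esub>"] by simp
      ultimately show ?thesis by (simp add: \<phi>_def)
    qed
  qed
qed

section \<open>Linear forms and term functions\<close>

text \<open>Here \<open>N\<close> is the set of nonnegative elements of a total preorder on the group of linear forms; the
  proof eliminates one variable at a time.\<close>

lemma rational_point_with_signs:
  fixes N :: "('i \<Rightarrow> int) set"
  assumes add: "\<And>c d. c \<in> N \<Longrightarrow> d \<in> N \<Longrightarrow> (\<lambda>i. c i + d i) \<in> N"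
    and total: "\<And>d. d \<in> N \<or> (\<lambda>i. - d i) \<in> N"
    and "finite E" "finite D" "\<And>d i. d \<in> D \<Longrightarrow> i \<notin> E \<Longrightarrow> d i = 0"
  shows "\<exists>x :: 'i \<Rightarrow> rat. \<forall>d\<in>D. 0 \<le> (\<Sum>i\<in>E. of_int (d i) * x i) \<longleftrightarrow> d \<in> N"
  using assms(3-5)
proof (induction E arbitrary: D)
  case empty
  \<comment> \<open>With no variables left only the zero form occurs, and totality puts it into
    \<open>N\<close>.\<close>
  then have "d = (\<lambda>i. - d i)" if "d \<in> D" for d using that by (auto simp: fun_eq_iff)
  then have "d \<in> N" if "d \<in> D" for d using total that by metis
  then show ?case by auto
next
  case (insert j E)
  define neg :: "('i \<Rightarrow> int) \<Rightarrow> 'i \<Rightarrow> int" where "neg d = (\<lambda>i. - d i)" for d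
  \<comment> \<open>If \<open>c\<close> and \<open>d\<close> have positive coefficients at
    \<open>j\<close>, this is a difference of positive multiples in which \<open>j\<close> cancels.
    Its sign tells how the bounds that \<open>c\<close> and \<open>d\<close> put on the variable
    \<open>j\<close> compare.\<close>
  define comb :: "('i \<Rightarrow> int) \<Rightarrow> ('i \<Rightarrow> int) \<Rightarrow> 'i \<Rightarrow> int"
    where "comb c d = (\<lambda>i. d j * c i - c j * d i)" for c d
  have neg_neg [simp]: "neg (neg d) = d" for d by (simp add: neg_def)
  have pmult: "(\<lambda>i. k * d i) \<in> N" if "d \<in> N" "k > 0" for d and k :: int
  proof -
    have "(\<lambda>i. int (Suc n) * d i) \<in> N" for n
    proof (induction n)
      case (Suc n)
      then show ?case using add[OF Suc that(1)] by (simp add: algebra_simps)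
    qed (use that in simp)
    from this[of "nat k - 1"] that(2) show ?thesis by simp
  qed
  \<comment> \<open>Division by \<open>k\<close>: were \<open>d\<close> outside \<open>N\<close>,
    its negative would be inside, and \<open>k - 1\<close> times the negative plus \<open>k\<close>
    times \<open>d\<close> is \<open>d\<close>.\<close>
  have pmultD: "d \<in> N" if "(\<lambda>i. k * d i) \<in> N" "k > 0" for d and k :: int
  proof (rule ccontr)
    assume "d \<notin> N"
    show False
    proof (cases "k = 1")
      case True
      then show ?thesis using that \<open>d \<notin> N\<close> by simp
    next
      case False
      then have "(\<lambda>i. (k - 1) * neg d i) \<in> N"
        using total[of d] \<open>d \<notin> N\<close> pmult[of "neg d" "k - 1"] that(2) by (simp add: neg_def)
      from add[OF this that(1)] have "d \<in> N" by (simp add: neg_def algebra_simps)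
      then show ?thesis using \<open>d \<notin> N\<close> by simp
    qed
  qed
  \<comment> \<open>With the negations added, every form involving \<open>j\<close> is, up to sign,
    one with a positive coefficient there.\<close>
  define D1 where "D1 = D \<union> neg ` D"
  define P where "P = {d \<in> D1. d j > 0}"
  define D' where "D' = {d \<in> D1. d j = 0} \<union> (\<lambda>(c, d). comb c d) ` (P \<times> P)"
  have "finite D1" using insert by (simp add: D1_def)
  then have fin: "finite P" "finite D'" by (simp_all add: P_def D'_def)
  have D1_supp: "d i = 0" if "d \<in> D1" "i \<notin> insert j E" for d i
    using that insert.prems(2) by (auto simp: D1_def neg_def)
  have D'_supp: "d i = 0" if "d \<in> D'" "i \<notin> E" for d i
  proof (cases "i = j")
    case True
    then show ?thesis using that by (auto simp: D'_def comb_def)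
  next
    case False
    then have z: "c i = 0" if "c \<in> D1" for c using that \<open>i \<notin> E\<close> D1_supp[of c i] by simp
    consider "d \<in> D1" | a b where "d = comb a b" "a \<in> D1" "b \<in> D1"
      using \<open>d \<in> D'\<close> by (auto simp: D'_def P_def)
    then show ?thesis by cases (simp_all add: z comb_def)
  qed
  have "\<exists>x :: 'i \<Rightarrow> rat. \<forall>d\<in>D'. 0 \<le> (\<Sum>i\<in>E. of_int (d i) * x i) \<longleftrightarrow> d \<in> N"
    by (rule insert.IH[OF fin(2)]) (rule D'_supp)
  then obtain x :: "'i \<Rightarrow> rat" where
    x: "\<And>d. d \<in> D' \<Longrightarrow> 0 \<le> (\<Sum>i\<in>E. of_int (d i) * x i) \<longleftrightarrow> d \<in> N" by blast
  define S where "S d = (\<Sum>i\<in>E. of_int (d i) * x i)" for d :: "'i \<Rightarrow> int"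
  \<comment> \<open>The value of the variable \<open>j\<close> at which \<open>d\<close> vanishes
    once the other variables are fixed by \<open>x\<close>.\<close>
  define b where "b d = - S d / of_int (d j)" for d
  have S_comb: "S (comb c d) = of_int (d j) * S c - of_int (c j) * S d" for c d
    by (simp add: S_def comb_def sum_subtractf sum_distrib_left algebra_simps)
  have b_le: "b c \<le> b d \<longleftrightarrow> comb c d \<in> N" if cd: "c \<in> P" "d \<in> P" for c d
  proof -
    have pos: "0 < rat_of_int (c j)" "0 < rat_of_int (d j)" using cd by (auto simp: P_def)
    have "b c \<le> b d \<longleftrightarrow> 0 \<le> S (comb c d)"
      unfolding S_comb b_def using pos by (simp add: field_simps)
    also have "\<dots> \<longleftrightarrow> comb c d \<in> N"
      using x[of "comb c d"] cd by (force simp: S_def D'_def)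
    finally show ?thesis .
  qed
  have comb1: "comb c d \<in> N" if "c \<in> N" "neg d \<in> N" "c \<in> P" "d \<in> P" for c d
    using add[OF pmult[of c "d j"] pmult[of "neg d" "c j"]] that
    by (simp add: P_def comb_def neg_def)
  have comb2: "neg d \<in> N" if "comb c d \<in> N" "neg c \<in> N" "c \<in> P" "d \<in> P" for c d
  proof -
    have "(\<lambda>i. c j * neg d i) = (\<lambda>i. comb c d i + d j * neg c i)"
      by (simp add: comb_def neg_def algebra_simps)
    then show ?thesis
      using add[OF that(1) pmult[of "neg c" "d j"]] that pmultD[of "c j" "neg d"] by (simp add: P_def)
  qed
  have comb3: "c \<in> N" if "comb c d \<in> N" "d \<in> N" "c \<in> P" "d \<in> P" for c d
  proof -
    have "(\<lambda>i. d j * c i) = (\<lambda>i. comb c d i + c j * d i)"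
      by (simp add: comb_def algebra_simps)
    then show ?thesis
      using add[OF that(1) pmult[of d "c j"]] that pmultD[of "d j" c] by (simp add: P_def)
  qed
  \<comment> \<open>A form that lies in \<open>N\<close> together with its negative must vanish,
    which forces \<open>y\<close> to be its bound. If there is none in \<open>P\<close>, every bound
    is strict, and any \<open>y\<close> strictly between the lower and the upper bounds will
    do.\<close>
  obtain y where y: "\<And>d. d \<in> P \<Longrightarrow> b d \<le> y \<longleftrightarrow> d \<in> N" "\<And>d. d \<in> P \<Longrightarrow> y \<le> b d \<longleftrightarrow> neg d \<in> N"
  proof (cases "\<exists>e\<in>P. e \<in> N \<and> neg e \<in> N")
    case True
    then obtain e where e: "e \<in> P" "e \<in> N" "neg e \<in> N" by blast
    have "b d \<le> b e \<longleftrightarrow> d \<in> N" if "d \<in> P" for d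
      using b_le[OF that e(1)] comb1[of d e] comb3[of d e] that e by blast
    moreover have "b e \<le> b d \<longleftrightarrow> neg d \<in> N" if "d \<in> P" for d
      using b_le[OF e(1) that] comb1[of e d] comb2[of e d] that e by blast
    ultimately show ?thesis using that by blast
  next
    case False
    define L where "L = {d \<in> P. d \<in> N}"
    define R where "R = {d \<in> P. neg d \<in> N}"
    have "finite L" "finite R" using fin by (auto simp: L_def R_def)
    have LR: "b c < b d" if "c \<in> L" "d \<in> R" for c d
    proof -
      have "\<not> b d \<le> b c"
        using b_le[of d c] comb3[of d c] that False by (auto simp: L_def R_def)
      then show ?thesis by simp
    qed
    have "\<exists>y. (\<forall>c\<in>L. b c < y) \<and> (\<forall>d\<in>R. y < b d)"
    proof (cases "L = {}")
      case True
      \<comment> \<open>The inserted 0 keeps the minimum meaningful when \<open>R\<close> is empty;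
        subtracting 1 makes the inequality strict.\<close>
      have "\<forall>d\<in>R. Min (insert 0 (b ` R)) - 1 < b d"
      proof
        fix d assume "d \<in> R"
        then have "Min (insert 0 (b ` R)) \<le> b d" using \<open>finite R\<close> by (intro Min_le) auto
        then show "Min (insert 0 (b ` R)) - 1 < b d" by linarith
      qed
      then show ?thesis using True by blast
    next
      case L: False
      show ?thesis
      proof (cases "R = {}")
        case True
        have "\<forall>d\<in>L. b d < Max (insert 0 (b ` L)) + 1"
        proof
          fix d assume "d \<in> L"
          then have "b d \<le> Max (insert 0 (b ` L))" using \<open>finite L\<close> by (intro Max_ge) auto
          then show "b d < Max (insert 0 (b ` L)) + 1" by linarith
        qed
        then show ?thesis using True by blast
      next
        case False
        have "Max (b ` L) < Min (b ` R)"
          using L False \<open>finite L\<close> \<open>finite R\<close> LR by simp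
        then obtain y where "Max (b ` L) < y" "y < Min (b ` R)" using dense by blast
        then have "(\<forall>c\<in>L. b c < y) \<and> (\<forall>d\<in>R. y < b d)"
          using L False \<open>finite L\<close> \<open>finite R\<close> by simp
        then show ?thesis by blast
      qed
    qed
    then obtain y where y: "\<And>c. c \<in> L \<Longrightarrow> b c < y" "\<And>d. d \<in> R \<Longrightarrow> y < b d" by blast
    have dich: "d \<in> L \<and> d \<notin> R \<or> d \<in> R \<and> d \<notin> L" if "d \<in> P" for d
      using that False total[of d] by (auto simp: L_def R_def neg_def)
    show ?thesis
    proof (rule that[of y])
      fix d assume d: "d \<in> P"
      show "b d \<le> y \<longleftrightarrow> d \<in> N" 
        using dich[OF d] y(1)[of d] y(2)[of d] d by (auto simp: L_def R_def)
      show "y \<le> b d \<longleftrightarrow> neg d \<in> N"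
        using dich[OF d] y(1)[of d] y(2)[of d] d by (auto simp: L_def R_def)
    qed
  qed
  define x' where "x' = x(j := y)"
  have S': "(\<Sum>i\<in>insert j E. of_int (d i) * x' i) = of_int (d j) * y + S d" for d :: "'i \<Rightarrow> int"
  proof -
    have "(\<Sum>i\<in>E. of_int (d i) * x' i) = S d"
      unfolding S_def by (rule sum.cong) (use insert.hyps in \<open>auto simp: x'_def\<close>)
    then show ?thesis using insert.hyps by (simp add: x'_def)
  qed
  have "0 \<le> of_int (d j) * y + S d \<longleftrightarrow> d \<in> N" if d: "d \<in> D" for d
  proof -
    consider "d j = 0" | "d j > 0" | "d j < 0" by linarith
    then show ?thesis
    proof cases
      case 1
      then show ?thesis using x[of d] d by (simp add: D'_def D1_def S_def)
    next
      case 2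
      then have P: "d \<in> P" using d by (simp add: P_def D1_def)
      have "0 \<le> of_int (d j) * y + S d \<longleftrightarrow> b d \<le> y"
        using 2 by (simp add: b_def field_simps) linarith
      then show ?thesis using y(1)[OF P] by simp
    next
      case 3
      then have P: "neg d \<in> P" using d by (simp add: P_def D1_def neg_def)
      have Sn: "S (neg d) = - S d" by (simp add: S_def neg_def sum_negf)
      have "rat_of_int (d j) < 0" using 3 by simp
      then have "0 \<le> of_int (d j) * y + S d \<longleftrightarrow> y \<le> b (neg d)"
        unfolding b_def Sn by (simp add: neg_def field_simps) linarith
      then show ?thesis using y(2)[OF P] by simp
    qed
  qed
  then have "\<forall>d\<in>D. 0 \<le> (\<Sum>i\<in>insert j E. of_int (d i) * x' i) \<longleftrightarrow> d \<in> N" by (simp add: S')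
  then show ?case by blast
qed

section \<open>Linear forms evaluated in the group of a chain\<close>

context mv_chain
begin

lemma fst_carry_add_embed:
  "a \<oplus> b = \<one> \<Longrightarrow> 1 \<le> fst (carry_add (chang_embed a) (chang_embed b))"
  by (auto simp: chang_embed_def carry_add_def)

text \<open>The integral linear form with coefficients \<open>d\<close> at the images of
  \<open>E\<close>; the group is written multiplicatively, so coefficients appear as
  exponents.\<close>

definition form_val :: "('i \<Rightarrow> 'a) \<Rightarrow> 'i set \<Rightarrow> ('i \<Rightarrow> int) \<Rightarrow> int \<times> 'a"
  where "form_val s E d = finprod chang_group (\<lambda>e. chang_embed (s e) [^]\<^bsub>chang_group\<^esub> d e) E"

context
  fixes s :: "'i \<Rightarrow> 'a" and E :: "'i set"
  assumes sE: "s \<in> E \<rightarrow> carrier A" and E: "finite E"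
begin

private lemma s: "e \<in> E \<Longrightarrow> s e \<in> carrier A"
  using sE by auto

lemma form_val_fun: "(\<lambda>e. chang_embed (s e) [^]\<^bsub>chang_group\<^esub> (d e :: int)) \<in> E \<rightarrow> GC"
  using s chang_embed_closed G.int_pow_closed by blast

lemma form_val_closed: "form_val s E d \<in> GC"
  unfolding form_val_def using form_val_fun by (rule G.finprod_closed)

lemma form_val_add: "form_val s E (\<lambda>i. c i + d i) = carry_add (form_val s E c) (form_val s E d)"
proof -
  have "form_val s E (\<lambda>i. c i + d i) = finprod chang_group
    (\<lambda>e. carry_add (chang_embed (s e) [^]\<^bsub>chang_group\<^esub> c e) (chang_embed (s e) [^]\<^bsub>chang_group\<^esub> d e)) E"
    unfolding form_val_def
  proof (rule G.finprod_cong')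
    show "chang_embed (s e) [^]\<^bsub>chang_group\<^esub> (c e + d e) = 
      carry_add (chang_embed (s e) [^]\<^bsub>chang_group\<^esub> c e) (chang_embed (s e) [^]\<^bsub>chang_group\<^esub> d e)" if "e \<in> E" for e
      using G.int_pow_mult[OF chang_embed_closed[OF s[OF that]]] .
    show "(\<lambda>e. carry_add (chang_embed (s e) [^]\<^bsub>chang_group\<^esub> c e) (chang_embed (s e) [^]\<^bsub>chang_group\<^esub> d e)) \<in> E \<rightarrow> GC"
      using form_val_fun[of c] form_val_fun[of d] G.m_closed by blast
  qed simp
  then show ?thesis
    unfolding form_val_def using G.finprod_multf[OF form_val_fun form_val_fun] by simp
qed

lemma form_val_zero: "form_val s E (\<lambda>_. 0) = (0, \<zero>)"
  unfolding form_val_def by (rule G.finprod_one_eqI) simp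

lemma form_val_neg: "form_val s E (\<lambda>i. - d i) = m_inv chang_group (form_val s E d)"
proof -
  have "carry_add (form_val s E (\<lambda>i. - d i)) (form_val s E d) = (0, \<zero>)"
    using form_val_add[of "\<lambda>i. - d i" d] form_val_zero by simp
  then show ?thesis using G.inv_equality[OF _ form_val_closed form_val_closed] by metis
qed

lemma form_val_single:
  assumes e: "e \<in> E"
  shows "form_val s E (\<lambda>i. if i = e then 1 else 0) = chang_embed (s e)"
proof -
  have "form_val s E (\<lambda>i. if i = e then 1 else 0) =
    finprod chang_group (\<lambda>j. if e = j then chang_embed (s j) else (0, \<zero>)) E"
    unfolding form_val_def
  proof (rule G.finprod_cong')
    show "chang_embed (s i) [^]\<^bsub>chang_group\<^esub> (if i = e then 1 else 0 :: int) = 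
        (if e = i then chang_embed (s i) else (0, \<zero>))" if "i \<in> E" for i
      using G.int_pow_1[OF chang_embed_closed[OF s[OF that]]] by simp
  qed (use chang_embed_closed s zero_neq_one in auto)
  also have "\<dots> = chang_embed (s e)"
    by (rule G.finprod_singleton[OF e E]) (use chang_embed_closed s in auto)
  finally show ?thesis .
qed

text \<open>With \<open>n\<close> as the form of the unit, subtraction from \<open>n\<close>
  realizes negation, because \<open>a\<close> and \<open>\<sim> a\<close> are orthogonal with sum
  \<open>\<one>\<close>.\<close>

lemma form_val_cancel:
  assumes "form_val s E c = chang_embed a" "form_val s E n = chang_embed \<one>" "a \<in> carrier A"
  shows "form_val s E (\<lambda>i. n i - c i) = chang_embed (\<sim> a)"
proof -
  have "carry_add (form_val s E (\<lambda>i. n i - c i)) (chang_embed a) = carry_add (chang_embed (\<sim> a)) (chang_embed a)"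
    using form_val_add[of "\<lambda>i. n i - c i" c] assms chang_embed_add[of "\<sim> a" a] by simp
  then show ?thesis
    using G.right_cancel[OF chang_embed_closed[OF assms(3)] form_val_closed chang_embed_closed] assms(3) by simp
qed

end

text \<open>Additivity of \<open>s\<close> turns each step of the orthogonal sum into an addition in
  the group. Different \<open>d\<close> for the same \<open>a\<close> therefore have the same
  value.\<close>

lemma orth_sum_form_val:
  assumes M: "mv_algebra M" and s: "mv_additive M A s" and E: "E \<subseteq> carrier M" "finite E"
    and a: "orth_sum M E a d"
  shows "form_val s E d = chang_embed (s a)"
proof -
  interpret M: mv_algebra M by fact
  have sc: "s x \<in> carrier A" if "x \<in> carrier M" for x using s that by (auto simp: mv_additive_def)
  then have sE: "s \<in> E \<rightarrow> carrier A" using E by blast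
  note fv = form_val_add[OF sE E(2)] form_val_zero[OF sE E(2)] form_val_single[OF sE E(2)]
  have add: "chang_embed (s (x \<oplus>\<^bsub>M\<^esub> y)) = carry_add (chang_embed (s x)) (chang_embed (s y))"
    if "x \<in> carrier M" "y \<in> carrier M" "x \<odot>\<^bsub>M\<^esub> y = \<zero>\<^bsub>M\<^esub>" for x y
    using s that chang_embed_add sc unfolding mv_additive_def by metis
  show ?thesis using a
  proof induction
    case orth_sum_zero
    have "chang_embed (s \<zero>\<^bsub>M\<^esub>) = carry_add (chang_embed (s \<zero>\<^bsub>M\<^esub>)) (chang_embed (s \<zero>\<^bsub>M\<^esub>))"
      using add[of "\<zero>\<^bsub>M\<^esub>" "\<zero>\<^bsub>M\<^esub>"] by simp
    then have "chang_embed (s \<zero>\<^bsub>M\<^esub>) = (0, \<zero>)"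
      using G.l_cancel_one'[OF chang_embed_closed chang_embed_closed] sc by simp
    then show ?case using fv(2) by simp
  next
    case (orth_sum_plus a d e)
    have "a \<in> carrier M" "e \<in> carrier M" using M.orth_sum_closed orth_sum_plus E by auto
    then have "chang_embed (s (a \<oplus>\<^bsub>M\<^esub> e)) = carry_add (chang_embed (s a)) (chang_embed (s e))"
      using add orth_sum_plus by blast
    then show ?case using orth_sum_plus fv(1)[where c = d and d = "\<lambda>i. if i = e then 1 else 0"] fv(3) by simp
  qed
qed

end

definition dot :: "'i set \<Rightarrow> ('i \<Rightarrow> int) \<Rightarrow> ('i \<Rightarrow> rat) \<Rightarrow> rat"
  where "dot E d x = (\<Sum>i\<in>E. of_int (d i) * x i)"

lemma dot_simps [simp]:
  "dot E (\<lambda>_. 0) x = 0"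
  "dot E (\<lambda>i. c i + d i) x = dot E c x + dot E d x"
  "dot E (\<lambda>i. c i - d i) x = dot E c x - dot E d x"
  "dot E (\<lambda>i. - d i) x = - dot E d x"
  by (simp_all add: dot_def sum.distrib sum_subtractf sum_negf algebra_simps)

lemma dot_single: "finite E \<Longrightarrow> e \<in> E \<Longrightarrow> dot E (\<lambda>i. if i = e then 1 else 0) x = x e"
  by (simp add: dot_def if_distrib[of "\<lambda>k. of_int k * _"] sum.delta cong: if_cong)

lemma dot_scale: "dot E d (\<lambda>i. r * x i) = r * dot E d x"
  by (simp add: dot_def sum_distrib_left algebra_simps)

text \<open>On the region cut out by the finitely many inequalities in \<open>D\<close>, which record the case distinctions
  made in the evaluation of the term in the chain \<open>A\<close>, the term function is the linear form \<open>d\<close>.\<close>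

lemma (in mv_chain) term_linear:
  assumes M: "mv_algebra M" and s: "mv_additive M A s" and E: "E \<subseteq> carrier M" "finite E"
    and n: "orth_sum M E \<one>\<^bsub>M\<^esub> n" and p: "\<forall>v\<in>set_mv_term p. \<exists>d. orth_sum M E v d"
  shows "\<exists>d D. finite D \<and> (\<forall>c\<in>insert d D. \<forall>i. i \<notin> E \<longrightarrow> c i = 0) \<and> (\<forall>c\<in>D. 0 \<le> fst (form_val s E c)) \<and>
    form_val s E d = chang_embed (tval A s p) \<and>
    (\<forall>x t. (\<forall>c\<in>D. 0 \<le> dot E c x) \<and> dot E n x = 1 \<and> (\<forall>a c. orth_sum M E a c \<longrightarrow> t a = dot E c x) \<longrightarrow>
      tval rat_mv t p = dot E d x)"
  using p
proof (induction p)
  interpret M: mv_algebra M by fact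
  have sc: "s x \<in> carrier A" if "x \<in> carrier M" for x using s that by (auto simp: mv_additive_def)
  then have sE: "s \<in> E \<rightarrow> carrier A" using E by blast
  note fv_add = form_val_add[OF sE E(2)] and fv_zero = form_val_zero[OF sE E(2)]
    and fv_neg = form_val_neg[OF sE E(2)] and fv_cancel = form_val_cancel[OF sE E(2)]
    and fv_closed = form_val_closed[OF sE E(2)]
  have n1: "form_val s E n = chang_embed \<one>"
    using orth_sum_form_val[OF M s E n] s by (simp add: mv_additive_def)
  have n0: "n i = 0" if "i \<notin> E" for i using M.orth_sum_support[OF n that] .
  have closed: "tval A s p \<in> carrier A" if "\<forall>v\<in>set_mv_term p. \<exists>d. orth_sum M E v d" for p
    using that M.orth_sum_closed E(1) sc by (intro tval_closed) blast
  {
    case (Var v)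
    then obtain d where d: "orth_sum M E v d" by auto
    then show ?case
      using orth_sum_form_val[OF M s E d] M.orth_sum_support[OF d]
      by (intro exI[of _ d] exI[of _ "{}"]) auto
  next
    case Zero
    show ?case using fv_zero zero_neq_one
      by (intro exI[of _ "\<lambda>_. 0"] exI[of _ "{}"]) (auto simp: chang_embed_def)
  next
    case (Neg p)
    then obtain d D where dD: "finite D" "\<forall>c\<in>insert d D. \<forall>i. i \<notin> E \<longrightarrow> c i = 0" "\<forall>c\<in>D. 0 \<le> fst (form_val s E c)"
      "form_val s E d = chang_embed (tval A s p)"
      "\<And>x t. (\<forall>c\<in>D. 0 \<le> dot E c x) \<and> dot E n x = 1 \<and> (\<forall>a c. orth_sum M E a c \<longrightarrow> t a = dot E c x) \<Longrightarrow>
        tval rat_mv t p = dot E d x" by auto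
    have "tval A s p \<in> carrier A" using closed Neg.prems by simp
    then have "form_val s E (\<lambda>i. n i - d i) = chang_embed (tval A s (Neg p))"
      using fv_cancel dD(4) n1 by simp
    then show ?case using dD n0
      by (intro exI[of _ "\<lambda>i. n i - d i"] exI[of _ D]) auto
  next
    case (Plus p q)
    obtain d D where dD: "finite D" "\<forall>c\<in>insert d D. \<forall>i. i \<notin> E \<longrightarrow> c i = 0" "\<forall>c\<in>D. 0 \<le> fst (form_val s E c)"
      "form_val s E d = chang_embed (tval A s p)"
      "\<And>x t. (\<forall>c\<in>D. 0 \<le> dot E c x) \<and> dot E n x = 1 \<and> (\<forall>a c. orth_sum M E a c \<longrightarrow> t a = dot E c x) \<Longrightarrow>
        tval rat_mv t p = dot E d x" using Plus by auto
    obtain d' D' where dD': "finite D'" "\<forall>c\<in>insert d' D'. \<forall>i. i \<notin> E \<longrightarrow> c i = 0" "\<forall>c\<in>D'. 0 \<le> fst (form_val s E c)"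
      "form_val s E d' = chang_embed (tval A s q)"
      "\<And>x t. (\<forall>c\<in>D'. 0 \<le> dot E c x) \<and> dot E n x = 1 \<and> (\<forall>a c. orth_sum M E a c \<longrightarrow> t a = dot E c x) \<Longrightarrow>
        tval rat_mv t q = dot E d' x" using Plus by auto
    let ?a = "tval A s p" and ?b = "tval A s q"
    have ab: "?a \<in> carrier A" "?b \<in> carrier A" using closed Plus.prems by simp_all
    show ?case
    proof (cases "?a \<oplus> ?b = \<one>")
      case True
      \<comment> \<open>The sum reaches the unit, so the value is given by the form
        \<open>n\<close>; the recorded comparison is that \<open>d + d'\<close> is at least
        \<open>n\<close>.\<close>
      let ?c = "\<lambda>i. (d i + d' i) + - n i"
      have "form_val s E ?c = carry_add (carry_add (chang_embed ?a) (chang_embed ?b)) (form_val s E (\<lambda>i. - n i))"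
        using fv_add[where c = "\<lambda>i. d i + d' i" and d = "\<lambda>i. - n i"] fv_add[where c = d and d = d'] dD(4) dD'(4) by simp
      moreover have "form_val s E (\<lambda>i. - n i) = (- 1, \<zero>)"
      proof -
        have "carry_add (- 1, \<zero>) (form_val s E n) = (0, \<zero>)"
          using n1 carry_add_integer[of "-1" \<zero> 1] zero_neq_one by (simp add: chang_embed_def)
        then show ?thesis unfolding fv_neg
          using G.inv_equality[OF _ fv_closed integer_in_group] by blast
      qed
      ultimately have "0 \<le> fst (form_val s E ?c)"
        using fst_carry_add[of "carry_add (chang_embed ?a) (chang_embed ?b)" "(- 1, \<zero>)"]
          fst_carry_add_embed[OF True] by simp
      moreover have "tval rat_mv t (Plus p q) = dot E n x"
        if "\<forall>c\<in>insert ?c (D \<union> D'). 0 \<le> dot E c x" "dot E n x = 1" "\<forall>a c. orth_sum M E a c \<longrightarrow> t a = dot E c x" for x t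
        using that dD(5)[of x t] dD'(5)[of x t] by simp
      moreover have "form_val s E n = chang_embed (tval A s (Plus p q))" using n1 True by simp
      ultimately show ?thesis using dD(1-3) dD'(1-3) n0
        by (intro exI[of _ n] exI[of _ "insert ?c (D \<union> D')"]) auto
    next
      case False
      then have "?a \<odot> ?b = \<zero>" using plus_eq_one_or_times_eq_zero ab by blast
      then have val: "form_val s E (\<lambda>i. d i + d' i) = chang_embed (tval A s (Plus p q))"
        using fv_add[where c = d and d = d'] dD(4) dD'(4) ab by (simp add: chang_embed_add)
      \<comment> \<open>The sum is not truncated; the comparison \<open>d + d' \<le> n\<close> holds
        because the difference represents \<open>\<sim> (?a \<oplus> ?b)\<close>.\<close>
      let ?c = "\<lambda>i. n i - (d i + d' i)"
      have "0 \<le> fst (form_val s E ?c)"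
        using fv_cancel[OF val n1] ab by (simp add: fst_chang_embed)
      moreover have "tval rat_mv t (Plus p q) = dot E (\<lambda>i. d i + d' i) x"
        if "\<forall>c\<in>insert ?c (D \<union> D'). 0 \<le> dot E c x" "dot E n x = 1" "\<forall>a c. orth_sum M E a c \<longrightarrow> t a = dot E c x" for x t
        using that dD(5)[of x t] dD'(5)[of x t] by simp
      ultimately show ?thesis using dD(1-3) dD'(1-3) n0 val
        by (intro exI[of _ "\<lambda>i. d i + d' i"] exI[of _ "insert ?c (D \<union> D')"]) auto
    qed
  }
qed

section \<open>Separation by rational states\<close>

text \<open>Of \<open>s\<close> only the signs of finitely many forms are used. The functionals
  attached to the atoms of \<open>B\<close> are defined on all of \<open>M\<close>, and so extend a
  point given on these atoms to a state of \<open>M\<close>.\<close>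

lemma rational_state_exists:
  fixes M :: "'a mv_struct" and C :: "'c mv_struct"
  assumes M: "mv_algebra M" "mv_locally_finite M" and C: "mv_chain C" and s: "mv_additive M C s"
    and p: "set_mv_term p \<subseteq> carrier M" "tval C s p \<noteq> \<zero>\<^bsub>C\<^esub>"
  obtains t where "mv_additive M rat_mv t" "tval rat_mv t p \<noteq> 0"
proof -
  interpret M: mv_algebra M by fact
  interpret C: mv_chain C by fact
  define B where "B = mv_generated M (set_mv_term p)"
  define E where "E = mv_atoms M B"
  have B: "mv_subalgebra M B" "set_mv_term p \<subseteq> B"
    unfolding B_def using M.generated_subalgebra[OF p(1)] by auto
  have "finite (set_mv_term p)" by (induction p) auto
  then have Bfin: "finite B" using M(2) p(1) by (simp add: B_def mv_locally_finite_def)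
  have BM: "B \<subseteq> carrier M" using B(1) by (simp add: mv_subalgebra_def)
  have EB: "E \<subseteq> B" by (auto simp: E_def mv_atoms_def)
  then have E: "E \<subseteq> carrier M" "finite E" using BM Bfin finite_subset by blast+
  have sum: "\<exists>d. orth_sum M E a d" if "a \<in> B" for a
    using M.orth_sum_of_atoms[OF B(1) Bfin that] by (simp add: E_def)
  have vars: "\<forall>v\<in>set_mv_term p. \<exists>d. orth_sum M E v d" using sum B(2) by blast
  have "\<one>\<^bsub>M\<^esub> \<in> B" using M.subalgebra_derived(2)[OF B(1)] B(1) by (auto simp: mv_subalgebra_def)
  then obtain n where n: "orth_sum M E \<one>\<^bsub>M\<^esub> n" using sum by blast
  have sc: "s x \<in> carrier C" if "x \<in> carrier M" for x using s that by (auto simp: mv_additive_def)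
  then have sE: "s \<in> E \<rightarrow> carrier C" using E by blast
  let ?ev = "C.form_val s E"
  note ev_closed = C.form_val_closed[OF sE E(2)] and ev_add = C.form_val_add[OF sE E(2)]
    and ev_neg = C.form_val_neg[OF sE E(2)] and ev_single = C.form_val_single[OF sE E(2)]
  obtain d D where D: "finite D" "\<forall>c\<in>insert d D. \<forall>i. i \<notin> E \<longrightarrow> c i = 0"
      "\<forall>c\<in>D. 0 \<le> fst (?ev c)" "?ev d = C.chang_embed (tval C s p)"
      "\<forall>x t. (\<forall>c\<in>D. 0 \<le> dot E c x) \<and> dot E n x = 1 \<and> (\<forall>a c. orth_sum M E a c \<longrightarrow> t a = dot E c x) \<longrightarrow>
        tval rat_mv t p = dot E d x"
    using C.term_linear[OF M(1) s E n vars] by (elim exE conjE) (rule that; assumption)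
  define N where "N = {c. 0 \<le> fst (?ev c)}"
  have neg_notin: "(\<lambda>i. - c i) \<notin> N" if "?ev c = C.chang_embed b" "b \<in> carrier C" "b \<noteq> \<zero>\<^bsub>C\<^esub>" for c b
  proof
    assume "(\<lambda>i. - c i) \<in> N"
    then have "C.carry_add (?ev (\<lambda>i. - c i)) (C.chang_embed b) \<noteq> (0, \<zero>\<^bsub>C\<^esub>)"
      using that ev_closed by (intro C.carry_add_chang_embed_neq) (auto simp: N_def)
    moreover have "C.carry_add (?ev (\<lambda>i. - c i)) (?ev c) = (0, \<zero>\<^bsub>C\<^esub>)"
      unfolding ev_neg by (rule C.G.l_inv[OF ev_closed])
    ultimately show False using that(1) by simp
  qed
  have n1: "?ev n = C.chang_embed \<one>\<^bsub>C\<^esub>"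
    using C.orth_sum_form_val[OF M(1) s E n] s by (simp add: mv_additive_def)
  define unit :: "'a \<Rightarrow> 'a \<Rightarrow> int" where "unit e = (\<lambda>i. if i = e then 1 else 0)" for e
  \<comment> \<open>Besides the comparisons in \<open>D\<close>, the unit forms keep the point
    nonnegative, while the failing signs of \<open>- d\<close> and \<open>- n\<close> give
    \<open>d\<close> and \<open>n\<close> strictly positive values.\<close>
  define D1 where "D1 = D \<union> unit ` E \<union> {\<lambda>i. - d i, \<lambda>i. - n i}"
  have "\<exists>x. \<forall>c\<in>D1. 0 \<le> (\<Sum>i\<in>E. of_int (c i) * x i :: rat) \<longleftrightarrow> c \<in> N"
  proof (rule rational_point_with_signs)
    show "(\<lambda>i. b i + c i) \<in> N" if "b \<in> N" "c \<in> N" for b c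
      using that C.fst_carry_add[of "?ev b" "?ev c"] by (simp add: N_def ev_add)
    show "c \<in> N \<or> (\<lambda>i. - c i) \<in> N" for c
      using C.chang_cone_total[OF ev_closed] by (simp add: N_def ev_neg)
    show "finite E" "finite D1" using E D by (auto simp: D1_def)
    show "c i = 0" if "c \<in> D1" "i \<notin> E" for c i
      using that D(2) M.orth_sum_support[OF n] by (auto simp: D1_def unit_def)
  qed
  then obtain x0 :: "'a \<Rightarrow> rat" where x0: "\<And>c. c \<in> D1 \<Longrightarrow> 0 \<le> dot E c x0 \<longleftrightarrow> c \<in> N"
    unfolding dot_def by blast
  have "tval C s p \<in> carrier C" using p(1) sc by (intro C.tval_closed) blast
  then have "(\<lambda>i. - d i) \<notin> N" using neg_notin[OF D(4)] p(2) by blast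
  then have d_pos: "0 < dot E d x0" using x0[of "\<lambda>i. - d i"] by (simp add: D1_def)
  have "(\<lambda>i. - n i) \<notin> N" using neg_notin[OF n1] C.zero_neq_one C.one_closed by metis
  then have n_pos: "0 < dot E n x0" using x0[of "\<lambda>i. - n i"] by (simp add: D1_def)
  \<comment> \<open>All sign conditions are homogeneous, so the point may be rescaled to give the
    unit the value 1.\<close>
  define x where "x i = inverse (dot E n x0) * x0 i" for i
  have dot_x: "dot E c x = inverse (dot E n x0) * dot E c x0" for c
    unfolding x_def by (rule dot_scale)
  have x_nonneg: "0 \<le> x e" if "e \<in> E" for e
  proof -
    have "unit e \<in> N" using ev_single[OF that] C.fst_chang_embed by (simp add: N_def unit_def)
    then have "0 \<le> dot E (unit e) x0" using x0 that by (simp add: D1_def)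
    then show ?thesis using n_pos dot_single[OF E(2) that, of x0] by (simp add: unit_def x_def)
  qed
  have xD: "\<forall>c\<in>D. 0 \<le> dot E c x"
    using x0 D(3) n_pos by (auto simp: D1_def N_def dot_x)
  have xn: "dot E n x = 1" using n_pos by (simp add: dot_x)
  define Q where "Q e \<phi> \<longleftrightarrow> (\<forall>a\<in>carrier M. 0 \<le> \<phi> a) \<and>
    (\<forall>a\<in>carrier M. \<forall>b\<in>carrier M. a \<odot>\<^bsub>M\<^esub> b = \<zero>\<^bsub>M\<^esub> \<longrightarrow> \<phi> (a \<oplus>\<^bsub>M\<^esub> b) = \<phi> a + \<phi> b) \<and>
    0 < \<phi> e \<and> (\<forall>e'\<in>E. e' \<noteq> e \<longrightarrow> \<phi> e' = 0)" for e and \<phi> :: "'a \<Rightarrow> rat"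
  have "\<exists>\<phi>. Q e \<phi>" if e: "e \<in> E" for e
  proof -
    have e': "e \<in> carrier M" "e \<noteq> \<zero>\<^bsub>M\<^esub>" using e E by (auto simp: E_def mv_atoms_def)
    obtain \<phi> :: "'a \<Rightarrow> rat" where "\<And>a. a \<in> carrier M \<Longrightarrow> 0 \<le> \<phi> a"
      "\<And>a b. \<lbrakk>a \<in> carrier M; b \<in> carrier M; a \<odot>\<^bsub>M\<^esub> b = \<zero>\<^bsub>M\<^esub>\<rbrakk> \<Longrightarrow> \<phi> (a \<oplus>\<^bsub>M\<^esub> b) = \<phi> a + \<phi> b"
      "0 < \<phi> e" "\<And>a. \<lbrakk>a \<in> carrier M; mv_meet M e a = \<zero>\<^bsub>M\<^esub>\<rbrakk> \<Longrightarrow> \<phi> a = 0"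
      using rational_functional_exists[OF M e'] by blast
    moreover have "mv_meet M e b = \<zero>\<^bsub>M\<^esub>" if "b \<in> E" "b \<noteq> e" for b
      using M.atoms_disjoint[OF B(1)] e that by (simp add: E_def)
    ultimately show ?thesis unfolding Q_def using E(1) by (intro exI[of _ \<phi>]) auto
  qed
  then obtain \<phi> where "\<And>e. e \<in> E \<Longrightarrow> Q e (\<phi> e)" by metis
  then have
    \<phi>: "\<And>e a. e \<in> E \<Longrightarrow> a \<in> carrier M \<Longrightarrow> 0 \<le> \<phi> e a"
      "\<And>e a b. \<lbrakk>e \<in> E; a \<in> carrier M; b \<in> carrier M; a \<odot>\<^bsub>M\<^esub> b = \<zero>\<^bsub>M\<^esub>\<rbrakk> \<Longrightarrow> \<phi> e (a \<oplus>\<^bsub>M\<^esub> b) = \<phi> e a + \<phi> e b"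
      "\<And>e. e \<in> E \<Longrightarrow> 0 < \<phi> e e" "\<And>e e'. \<lbrakk>e \<in> E; e' \<in> E; e' \<noteq> e\<rbrakk> \<Longrightarrow> \<phi> e e' = 0"
    unfolding Q_def by blast+
  \<comment> \<open>The functionals \<open>\<phi> e / \<phi> e e\<close> are dual to the atoms, so
    \<open>t\<close> takes the value \<open>x e\<close> at each atom \<open>e\<close>.\<close>
  define t where "t a = (\<Sum>e\<in>E. \<phi> e a / \<phi> e e * x e)" for a
  have t_nonneg: "0 \<le> t a" if "a \<in> carrier M" for a
    unfolding t_def using \<phi>(1,3) x_nonneg that by (intro sum_nonneg mult_nonneg_nonneg divide_nonneg_pos) auto
  have t_add: "t (a \<oplus>\<^bsub>M\<^esub> b) = t a + t b"
    if "a \<in> carrier M" "b \<in> carrier M" "a \<odot>\<^bsub>M\<^esub> b = \<zero>\<^bsub>M\<^esub>" for a b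
    unfolding t_def sum.distrib[symmetric]
    by (rule sum.cong) (use \<phi>(2) that in \<open>auto simp: add_divide_distrib algebra_simps\<close>)
  have t_atom: "t e = x e" if e: "e \<in> E" for e
  proof -
    have "t e = (\<Sum>i\<in>E. if i = e then x i else 0)"
      unfolding t_def
    proof (rule sum.cong)
      fix i assume "i \<in> E"
      then show "\<phi> i e / \<phi> i i * x i = (if i = e then x i else 0)"
        using \<phi>(3)[of i] \<phi>(4)[of i e] e by auto
    qed simp
    also have "\<dots> = x e" using E(2) e by (simp add: sum.delta)
    finally show ?thesis .
  qed
  have t_sum: "t a = dot E c x" if "orth_sum M E a c" for a c
    using that
  proof induction
    case orth_sum_zero
    have "t (\<zero>\<^bsub>M\<^esub> \<oplus>\<^bsub>M\<^esub> \<zero>\<^bsub>M\<^esub>) = t \<zero>\<^bsub>M\<^esub> + t \<zero>\<^bsub>M\<^esub>" by (rule t_add) auto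
    then show ?case by simp
  next
    case (orth_sum_plus a c e)
    have "a \<in> carrier M" "e \<in> carrier M" using M.orth_sum_closed orth_sum_plus E by auto
    then have "t (a \<oplus>\<^bsub>M\<^esub> e) = t a + x e" using t_add t_atom orth_sum_plus by simp
    then show ?case using orth_sum_plus dot_single[OF E(2), of e x] by simp
  qed
  have t_one: "t \<one>\<^bsub>M\<^esub> = 1" using t_sum[OF n] xn by simp
  have t_neg: "t a + t (\<sim>\<^bsub>M\<^esub> a) = 1" if "a \<in> carrier M" for a
    using t_add[of a "\<sim>\<^bsub>M\<^esub> a"] that t_one by simp
  have t_le: "t a \<le> 1" if "a \<in> carrier M" for a
    using t_neg[OF that] t_nonneg[of "\<sim>\<^bsub>M\<^esub> a"] that by simp
  have "t a + t b \<le> 1" if "a \<in> carrier M" "b \<in> carrier M" "a \<odot>\<^bsub>M\<^esub> b = \<zero>\<^bsub>M\<^esub>" for a b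
    using t_add[OF that] t_le[of "a \<oplus>\<^bsub>M\<^esub> b"] that by simp
  then have "mv_additive M rat_mv t"
    unfolding mv_additive_def using t_nonneg t_le t_add t_one by auto
  moreover have "tval rat_mv t p = dot E d x" using D(5) xD xn t_sum by blast
  moreover have "dot E d x > 0" using d_pos n_pos by (simp add: dot_x)
  ultimately show ?thesis using that by simp
qed

text \<open>The iterated negations of \<open>Zero\<close> are infinitely many distinct terms without
  variables, available for every \<open>'a\<close>; their singletons lie in the type of the test
  algebras.\<close>

lemma rat_into_terms: obtains enc :: "rat \<Rightarrow> 'a mv_term set" where "inj enc"
proof
  have "inj (\<lambda>n. (Neg ^^ n) (Zero :: 'a mv_term))"
  proof (rule injI)
    have size: "size ((Neg ^^ n) (Zero :: 'a mv_term)) = n + size (Zero :: 'a mv_term)" for n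
      by (induction n) auto
    fix m n assume "(Neg ^^ m) (Zero :: 'a mv_term) = (Neg ^^ n) Zero"
    from arg_cong[OF this, of size] show "m = n" unfolding size by simp
  qed
  then show "inj (\<lambda>r :: rat. {(Neg ^^ to_nat r) (Zero :: 'a mv_term)})"
    by (simp add: inj_def) (meson from_nat_to_nat inj_to_nat injD)
qed

theorem theorem6p1:
  fixes M :: "'a mv_struct" and U :: "'b mv_struct" and \<upsilon> :: "'a \<Rightarrow> 'b"
  assumes "mv_algebra M"
    and "mv_locally_finite M"
    and "universal_state M U \<upsilon>"
  shows "mv_semisimple U"
proof -
  have U: "mv_algebra U" and st: "mv_state M U \<upsilon>"
    and un: "universal_among TYPE('a mv_term set) M U \<upsilon>"
    using assms(3) by (auto simp: universal_state_def)
  interpret M: mv_algebra M by fact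
  interpret U: mv_algebra U by fact
  have add: "mv_additive M U \<upsilon>" using st mv_state_iff[OF assms(1) U] by blast
  then have \<upsilon>: "\<upsilon> a \<in> carrier U" if "a \<in> carrier M" for a
    using that by (auto simp: mv_additive_def)
  have "\<exists>I. mv_maximal_ideal U I \<and> e \<notin> I" if e: "e \<in> carrier U" "e \<noteq> \<zero>\<^bsub>U\<^esub>" for e
  proof -
    obtain p where p: "set_mv_term p \<subseteq> carrier M" "e = tval U \<upsilon> p"
      using universal_state_generated[OF assms(1,3) e(1)] by blast
    obtain C :: "'b mv_struct" and f where C: "mv_chain C" and f: "f \<in> mv_hom U C" "f e \<noteq> \<zero>\<^bsub>C\<^esub>"
      using U.hom_to_chain_exists[OF e] by blast
    define s where "s a = f (\<upsilon> a)" for a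
    note h = mv_hom_simps[OF f(1)] and hd = mv_hom_derived[OF f(1) U]
    have "mv_additive M C s"
      unfolding mv_additive_def
    proof (intro conjI ballI impI)
      show "s \<in> carrier M \<rightarrow> carrier C" using h(1) \<upsilon> by (auto simp: s_def)
      show "s \<one>\<^bsub>M\<^esub> = \<one>\<^bsub>C\<^esub>" using add hd(1) by (simp add: s_def mv_additive_def)
      fix a b assume ab: "a \<in> carrier M" "b \<in> carrier M" "a \<odot>\<^bsub>M\<^esub> b = \<zero>\<^bsub>M\<^esub>"
      then have *: "\<upsilon> a \<odot>\<^bsub>U\<^esub> \<upsilon> b = \<zero>\<^bsub>U\<^esub>" "\<upsilon> (a \<oplus>\<^bsub>M\<^esub> b) = \<upsilon> a \<oplus>\<^bsub>U\<^esub> \<upsilon> b"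
        using add by (auto simp: mv_additive_def)
      show "s a \<odot>\<^bsub>C\<^esub> s b = \<zero>\<^bsub>C\<^esub>"
        using *(1) hd(2)[OF \<upsilon>[OF ab(1)] \<upsilon>[OF ab(2)]] h(2) by (simp add: s_def)
      show "s (a \<oplus>\<^bsub>M\<^esub> b) = s a \<oplus>\<^bsub>C\<^esub> s b"
        using *(2) h(4)[OF \<upsilon>[OF ab(1)] \<upsilon>[OF ab(2)]] by (simp add: s_def)
    qed
    moreover have "tval C s p \<noteq> \<zero>\<^bsub>C\<^esub>"
    proof -
      have "f e = tval C s p"
        unfolding p(2) by (rule hom_tval[OF f(1) U]) (use p(1) \<upsilon> in \<open>auto simp: s_def\<close>)
      then show ?thesis using f(2) by simp
    qed
    ultimately obtain t where t: "mv_additive M rat_mv t" "tval rat_mv t p \<noteq> 0"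
      using rational_state_exists[OF assms(1,2) C _ p(1)] by blast
    obtain enc :: "rat \<Rightarrow> 'a mv_term set" where enc: "inj enc" using rat_into_terms by blast
    let ?N = "mv_image enc rat_mv" and ?t = "\<lambda>a. enc (t a)"
    interpret N: mv_chain ?N using mv_chain_image[OF mv_chain_rat_mv enc] .
    have N: "mv_algebra ?N" ..
    have addN: "mv_additive M ?N ?t"
      using t(1) unfolding mv_additive_def by (auto simp: enc)
    \<comment> \<open>The copy of the rational unit interval is a chain, so cancellation holds there
      and the additive map is a state.\<close>
    moreover have "gs_cancel ?N (?t a) (?t b)"
      if "a \<in> carrier M" "b \<in> carrier M" "a \<odot>\<^bsub>M\<^esub> b = \<zero>\<^bsub>M\<^esub>" for a b
      using addN that unfolding mv_additive_def by (intro N.gs_cancel_chain) auto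
    ultimately have "mv_state M ?N ?t" using mv_state_iff[OF assms(1) N] by blast
    with un N have "\<exists>!g. g \<in> mv_hom U ?N \<and> (\<forall>a\<in>carrier M. g (\<upsilon> a) = ?t a)"
      unfolding universal_among_def by simp
    from ex1_implies_ex[OF this]
    obtain g where "g \<in> mv_hom U ?N \<and> (\<forall>a\<in>carrier M. g (\<upsilon> a) = ?t a)" by (rule exE)
    then have g: "g \<in> mv_hom U ?N" "\<And>a. a \<in> carrier M \<Longrightarrow> g (\<upsilon> a) = ?t a" by simp_all
    have "g e = tval ?N ?t p"
      unfolding p(2) by (rule hom_tval[OF g(1) U]) (use p(1) \<upsilon> g(2) in auto)
    also have "\<dots> = enc (tval rat_mv t p)" using tval_mv_image[OF enc] .
    finally have "g e \<noteq> enc 0" using t(2) by (simp add: inj_eq[OF enc])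
    then show ?thesis using maximal_ideal_kernel[OF U enc g(1)] by blast
  qed
  moreover have "\<zero>\<^bsub>U\<^esub> \<in> I" if "mv_maximal_ideal U I" for I
    using that by (simp add: mv_maximal_ideal_def mv_ideal_def)
  ultimately have "mv_radical U = {\<zero>\<^bsub>U\<^esub>}" unfolding mv_radical_def by blast
  then show ?thesis by (simp add: mv_semisimple_def)
qed

end
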